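(* Fix $\lambda\in(0,1]$. Let $P_n\to\infty$ as $n\to\infty$ and, for each $n$, let $(\varphi_{P_n,\lambda},\mu_{P_n,\lambda})$ be an admissible $P_n$-periodic solution pair of relative height $\lambda$ (as defined in the context). Then there is a subsequence along which $(\varphi_{P_n,\lambda},\mu_{P_n,\lambda})$ converges, locally uniformly on $\mathbb{R}$ in the first component, to a solution pair $$(\phi_\lambda,\nu_\lambda)\in C(\mathbb{R})\times[0,1]$$ of the steady Whitham equation, i.e. $-\nu_\lambda\phi_\lambda+L\phi_\lambda+\phi_\lambda^2=0$, with relative height $\lambda$, i.e. $\phi_\lambda(0)=\frac{\lambda\nu_\lambda}{2}$, and satisfying $$\nu_\lambda-1\le\phi_\lambda\le\frac{\lambda\nu_\lambda}{2}.$$ The limit $\phi_\lambda$ is even, nonconstant, nonperiodic, strictly increasing with $\phi_\lambda'>0$ on $(-\infty,0)$, and, in the case that $\lambda\in(0,1)$ and $\nu_\lambda>0$, smooth on $\mathbb{R}$.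
   Context: Let $m(\xi)=\sqrt{\tanh(\xi)/\xi}$ (with $m(0)=1$) and let $K(x)=\frac{1}{2\pi}\int_{\mathbb{R}}m(\xi)e^{ix\xi}\,d\xi$ be the Whitham kernel; $K$ is even, positive, and integrable with $\|K\|_{L^1(\mathbb{R})}=1$. Let $Lf=K\ast f$. The steady Whitham equation with wave speed $\mu$ is $-\mu\varphi+L\varphi+\varphi^2=0$, required to hold pointwise in $\mathbb{R}$; then $(\varphi,\mu)$ is called a solution pair. Admissible periodic solution pairs: for finite $P>0$ and $\lambda\in(0,1]$, an admissible $P$-periodic solution pair of relative height $\lambda$ is a pair $(\varphi_{P,\lambda},\mu_{P,\lambda})$ such that $\varphi_{P,\lambda}\in C^{1/2}(\mathbb{R})$ (Hölder space) is a $P$-periodic solution of the steady Whitham equation with wave speed $\mu_{P,\lambda}$; $0<\mu_{P,\lambda}\le1$; $\mu_{P,\lambda}-1\le\varphi_{P,\lambda}\le\varphi_{P,\lambda}(0)=\frac{\lambda\mu_{P,\lambda}}{2}$; $\varphi_{P,\lambda}$ is even, strictly increasing on $(-P/2,0)$ and smooth on $\mathbb{R}\setminus P\mathbb{Z}$; and $\varphi_{P,\lambda}\in C^\infty(\mathbb{R})$ if $\lambda\in(0,1)$. (Such pairs are known to exist for every $P>0$ and $\lambda\in(0,1]$ by earlier work of Ehrnström and Wahlén.) *)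

theory Defs
  imports "HOL-Analysis.Analysis" "HOL-Library.Periodic_Fun"
begin

definition whitham_symbol :: "real \<Rightarrow> real" where
  "whitham_symbol \<xi> = (if \<xi> = 0 then 1 else sqrt (tanh \<xi> / \<xi>))"

text \<open>
  The symbol decays only like \<open>\<bar>\<xi>\<bar> powr (-1/2)\<close>, so the inverse Fourier integral is not
  absolutely convergent. The Henstock--Kurzweil integral over the whole line is the improper
  integral, which exists for every \<open>x \<noteq> 0\<close>. At \<open>x = 0\<close> it diverges and the value is
  a dummy; this single point does not affect convolutions with the kernel. The symbol is even, so the
  integral is real and taking the real part only changes the type.
\<close>

definition whitham_kernel :: "real \<Rightarrow> real" where
  "whitham_kernel x =
     Re (1 / (2 * of_real pi) *
         integral UNIV (\<lambda>\<xi>. of_real (whitham_symbol \<xi>) * exp (\<i> * of_real x * of_real \<xi>)))"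

definition whitham_op :: "(real \<Rightarrow> real) \<Rightarrow> real \<Rightarrow> real" where
  "whitham_op f x = (LINT y|lborel. whitham_kernel (x - y) * f y)"

definition whitham_solution_pair :: "(real \<Rightarrow> real) \<Rightarrow> real \<Rightarrow> bool" where
  "whitham_solution_pair \<phi> \<mu> \<longleftrightarrow>
     (\<forall>x. - \<mu> * \<phi> x + whitham_op \<phi> x + (\<phi> x)\<^sup>2 = 0)"

text \<open>The usual space \<open>C\<^sup>\<alpha>\<close> on the line, whose elements are bounded.\<close>

definition hoelder_space :: "real \<Rightarrow> (real \<Rightarrow> real) set" where
  "hoelder_space \<alpha> =
     {f. bounded (range f) \<and> (\<exists>C. \<forall>x y. \<bar>f x - f y\<bar> \<le> C * \<bar>x - y\<bar> powr \<alpha>)}"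

text \<open>
  Used only for open \<open>S\<close>, where the two-sided derivatives at points of \<open>S\<close> depend only
  on the values of \<open>f\<close> on \<open>S\<close>.
\<close>

definition smooth_on :: "real set \<Rightarrow> (real \<Rightarrow> real) \<Rightarrow> bool" where
  "smooth_on S f \<longleftrightarrow> (\<forall>k. \<forall>x\<in>S. (deriv ^^ k) f differentiable (at x))"

definition even_fun :: "(real \<Rightarrow> real) \<Rightarrow> bool" where
  "even_fun f \<longleftrightarrow> (\<forall>x. f (- x) = f x)"

text \<open>Here \<open>\<kappa>\<close> is the relative height and \<open>\<mu>\<close> the wave speed.\<close>

definition admissible_pair :: "real \<Rightarrow> real \<Rightarrow> (real \<Rightarrow> real) \<Rightarrow> real \<Rightarrow> bool" where
  "admissible_pair P \<kappa> \<phi> \<mu> \<longleftrightarrow>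
     0 < P \<and> 0 < \<kappa> \<and> \<kappa> \<le> 1 \<and>
     \<phi> \<in> hoelder_space (1/2) \<and>
     periodic_fun_simple \<phi> P \<and>
     whitham_solution_pair \<phi> \<mu> \<and>
     0 < \<mu> \<and> \<mu> \<le> 1 \<and>
     (\<forall>x. \<mu> - 1 \<le> \<phi> x \<and> \<phi> x \<le> \<phi> 0) \<and>
     \<phi> 0 = \<kappa> * \<mu> / 2 \<and>
     even_fun \<phi> \<and>
     strict_mono_on {- P / 2<..<0} \<phi> \<and>
     smooth_on (- range (\<lambda>k::int. P * of_int k)) \<phi> \<and>
     (\<kappa> < 1 \<longrightarrow> smooth_on UNIV \<phi>)"

end

theory Submission
  imports Defs "HOL-Complex_Analysis.Complex_Analysis"
begin

text \<open>
  Deforming the contour of \<open>sqrt (tanh \<xi> / \<xi>)\<close> onto its branch cuts on the imaginary axis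
  represents the symbol as a superposition of Lorentzians \<open>2 \<eta> / (\<eta>\<^sup>2 + \<xi>\<^sup>2)\<close> with a nonnegative density,
  so the kernel is the corresponding superposition of exponentials \<open>exp (- \<eta> \<bar>x\<bar>)\<close>. It is therefore
  positive, integrable with integral 1, decreasing and convex on the positive half-line, and at most of
  size \<open>\<bar>x\<bar> powr (-1/2)\<close>, with derivative at most \<open>\<bar>x\<bar> powr (-3/2)\<close>.

  Since \<open>(\<mu>/2 - \<phi>)\<^sup>2 = \<mu>\<^sup>2/4 - L \<phi>\<close> and \<open>L\<close> gains half a derivative, solutions below \<open>\<mu>/2\<close> are
  equicontinuous, which gives a convergent subsequence. For the qualitative properties let
  \<open>E c = \<phi> (c + h/2) - \<phi> (c - h/2)\<close>. This function is odd, periodic and nonnegative on the left half-period,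
  and convexity of the kernel makes the periodised kernel decrease over a half-period, so that
  \<open>(\<mu> - \<phi> (z + h/2) - \<phi> (z - h/2)) E z = (K * E) z \<ge> d \<integral> E\<close> on compact subintervals of the negative
  half-line, with \<open>d > 0\<close> independent of the period. This keeps \<open>\<mu>/2 - \<phi>\<close> away from zero, hence excludes a
  constant limit, and it passes to the limit, where it yields strict monotonicity and a positive derivative.
\<close>

section \<open>Cauchy integrals over rectangles\<close>

text \<open>Writing z = \<i> \<xi> turns tanh \<xi> / \<xi> into tan z / z, so the cuts lie on the
  real axis and the principal root is analytic in the open upper half-plane. The inverse Fourier
  integral converges only conditionally, so Fubini is applied over finite frequency windows alone:
  the error of each Lorentzian is bounded by its values at the ends of the window, and these
  integrate against the density to values of the symbol, which decays. Finite increments replace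
  derivatives because the crest of a wave with \<open>\<kappa> = 1\<close> need not be smooth and
  because they survive pointwise limits. They are centred so that evenness makes E odd, which folds
  the convolution onto half a period. The danger is that the waves flatten out with speeds tending
  to 0. The increment inequality is homogeneous in E apart from its coefficient, so the smallest
  increment cancels and the coefficient is bounded below whatever the amplitude. At a point where
  \<mu>/2 - \<phi> > 0, regularity then improves through (\<mu>/2 - \<phi>)^2 = \<mu>^2/4 - L
  \<phi>, half a derivative at a time.\<close>

lemma contour_integral_linepath_same_Im:
  assumes "a < b"
  shows "contour_integral (linepath (Complex a c) (Complex b c)) f = integral {a..b} (\<lambda>x. f (Complex x c))"
proof -
  have "(f has_contour_integral I) (linepath (Complex a c) (Complex b c)) \<longleftrightarrow>
      ((\<lambda>x. f (Complex x c)) has_integral I) {a..b}" for I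
  proof -
    have "(f has_contour_integral I) (linepath (Complex a c) (Complex b c)) \<longleftrightarrow>
          ((\<lambda>x. f (linepath (Complex a c) (Complex b c) x) * (Complex b c - Complex a c)) has_integral I) {0..1}"
      by (subst has_contour_integral_linepath) simp_all
    also have "\<dots> \<longleftrightarrow> ((\<lambda>x. f (Complex (a + (b-a)*x) c) * (b - a)) has_integral I) {0..1}"
      by (intro has_integral_cong arg_cong2[of _ _ _ _ "(*)"] arg_cong[of _ _ f])
         (auto simp: linepath_def complex_eq_iff algebra_simps)
    also have "{0..1} = (\<lambda>x. x / (b - a)) ` {0..b-a}"
      using assms by simp
    also have "((\<lambda>x. f (Complex (a + (b-a)*x) c) * (b-a)) has_integral I) \<dots> \<longleftrightarrow>
             ((\<lambda>x. f (Complex (a + x) c) * (b-a)) has_integral ((b-a) *\<^sub>R I)) {0..b-a}"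
      by (subst has_integral_stretch_real_iff) (use assms in simp_all)
    also have "\<dots> \<longleftrightarrow> ((\<lambda>x. of_real (b-a) * (f (Complex x c))) has_integral (b-a) *\<^sub>R I) {a..b}"
      by (subst has_integral_shift_real_ivl_iff[where c = "-a"])
         (simp_all add: scaleR_conv_of_real mult_ac)
    also have "\<dots> \<longleftrightarrow> ((\<lambda>x. f (Complex x c)) has_integral I) {a..b}"
      by (subst has_integral_mult_right_iff) (use assms in \<open>auto simp: scaleR_conv_of_real\<close>)
    finally show ?thesis .
  qed
  then show ?thesis
    unfolding contour_integral_def contour_integrable_on_def integral_def integrable_on_def by simp
qed

text \<open>The bottom edge carries the integral that is wanted; the other three, of total length 2
  (d - c) + (b - a), are merely estimated. For the symbol the bottom edge runs just above the real
  axis, for the Lorentzian it is the real axis itself.\<close>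

lemma Cauchy_rectangle_bound:
  fixes F :: "complex \<Rightarrow> complex"
  assumes S: "convex S" "open S" "F holomorphic_on S" "cbox (Complex a c) (Complex b d) \<subseteq> S"
    and p: "a < Re p" "Re p < b" "c < Im p" "Im p < d"
    and left: "\<And>y. y \<in> {c..d} \<Longrightarrow> norm (F (Complex a y) / (Complex a y - p)) \<le> B"
    and right: "\<And>y. y \<in> {c..d} \<Longrightarrow> norm (F (Complex b y) / (Complex b y - p)) \<le> B"
    and top: "\<And>x. x \<in> {a..b} \<Longrightarrow> norm (F (Complex x d) / (Complex x d - p)) \<le> B"
  shows "norm (integral {a..b} (\<lambda>x. F (Complex x c) / (Complex x c - p)) - 2 * of_real pi * \<i> * F p)
           \<le> B * (2 * (d - c) + (b - a))"
proof -
  define G where "G = (\<lambda>z. F z / (z - p))"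
  define A1 A2 A3 A4 where A: "A1 = Complex a c" "A2 = Complex b c" "A3 = Complex b d" "A4 = Complex a d"
  have lt: "a < b" "c < d" using p by auto
  have pS: "p \<in> box A1 A3" using p by (auto simp: A in_box_complex_iff)
  have pS': "p \<in> S" using pS S(4) box_subset_cbox by (auto simp: A)
  have pi: "path_image (rectpath A1 A3) = cbox A1 A3 - box A1 A3"
    using lt by (intro path_image_rectpath_cbox_minus_box) (auto simp: A)
  have sub: "path_image (rectpath A1 A3) \<subseteq> S - {p}" using pi pS S(4) by (auto simp: A)
  have "((\<lambda>w. F w / (w - p)) has_contour_integral complex_of_real (2 * pi) * \<i> * winding_number (rectpath A1 A3) p * F p) (rectpath A1 A3)"
    using S pS' sub by (intro Cauchy_integral_formula_convex_simple) (auto simp: interior_open)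
  then have 1: "(G has_contour_integral 2 * of_real pi * \<i> * F p) (rectpath A1 A3)"
    using winding_number_rectpath[OF pS] by (simp add: G_def)
  have G: "continuous_on (S - {p}) G"
    unfolding G_def using holomorphic_on_imp_continuous_on[OF S(3)]
    by (intro continuous_intros) (auto intro: continuous_on_subset)
  have rp: "rectpath A1 A3 = linepath A1 A2 +++ linepath A2 A3 +++ linepath A3 A4 +++ linepath A4 A1"
    by (simp add: rectpath_def A Let_def)
  have segs: "closed_segment A1 A2 \<subseteq> S - {p}" "closed_segment A2 A3 \<subseteq> S - {p}"
     "closed_segment A3 A4 \<subseteq> S - {p}" "closed_segment A4 A1 \<subseteq> S - {p}"
    using sub by (auto simp: rp path_image_join)
  have ci: "G contour_integrable_on linepath A1 A2" "G contour_integrable_on linepath A2 A3"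
    "G contour_integrable_on linepath A3 A4" "G contour_integrable_on linepath A4 A1"
    using segs G by (auto intro!: contour_integrable_continuous_linepath intro: continuous_on_subset)
  have 2: "2 * of_real pi * \<i> * F p = contour_integral (linepath A1 A2) G + (contour_integral (linepath A2 A3) G
      + (contour_integral (linepath A3 A4) G + contour_integral (linepath A4 A1) G))"
    using contour_integral_unique[OF 1] ci by (simp add: rp)
  have B0: "0 \<le> B" using left[of c] lt norm_ge_zero order_trans by (metis atLeastAtMost_iff less_imp_le order_refl)
  have seg: "x \<in> closed_segment (Complex u v) (Complex u v') \<Longrightarrow> v \<le> v' \<Longrightarrow> \<exists>y\<in>{v..v'}. x = Complex u y" for x u v v'
    by (auto simp: closed_segment_same_Re closed_segment_eq_real_ivl complex_eq_iff)
  have segI: "x \<in> closed_segment (Complex u v) (Complex u' v) \<Longrightarrow> u \<le> u' \<Longrightarrow> \<exists>y\<in>{u..u'}. x = Complex y v" for x u v u'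
    by (auto simp: closed_segment_same_Im closed_segment_eq_real_ivl complex_eq_iff)
  have "norm (contour_integral (linepath A2 A3) G) \<le> B * norm (A3 - A2)"
    using seg[of _ b c d] right lt by (intro contour_integral_bound_linepath ci B0) (force simp: G_def A)
  moreover have "norm (A3 - A2) = d - c"
    using lt by (simp add: A cmod_def)
  ultimately have n1: "norm (contour_integral (linepath A2 A3) G) \<le> B * (d - c)" by simp
  have "norm (contour_integral (linepath A4 A1) G) \<le> B * norm (A1 - A4)"
    using seg[of _ a c d] left lt by (intro contour_integral_bound_linepath ci B0) (force simp: G_def A closed_segment_commute)
  moreover have "norm (A1 - A4) = d - c"
    using lt by (simp add: A cmod_def)
  ultimately have n2: "norm (contour_integral (linepath A4 A1) G) \<le> B * (d - c)" by simp
  have "norm (contour_integral (linepath A3 A4) G) \<le> B * norm (A4 - A3)"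
    using segI[of _ a d b] top lt by (intro contour_integral_bound_linepath ci B0) (force simp: G_def A closed_segment_commute)
  moreover have "norm (A4 - A3) = b - a"
    using lt by (simp add: A cmod_def)
  ultimately have n3: "norm (contour_integral (linepath A3 A4) G) \<le> B * (b - a)" by simp
  have "contour_integral (linepath A1 A2) G = integral {a..b} (\<lambda>x. G (Complex x c))"
    unfolding A by (rule contour_integral_linepath_same_Im[OF lt(1)])
  then have "integral {a..b} (\<lambda>x. G (Complex x c)) - 2 * of_real pi * \<i> * F p
     = - (contour_integral (linepath A2 A3) G + contour_integral (linepath A3 A4) G + contour_integral (linepath A4 A1) G)"
    using 2 by (simp add: algebra_simps)
  then have "norm (integral {a..b} (\<lambda>x. G (Complex x c)) - 2 * of_real pi * \<i> * F p)
     \<le> norm (contour_integral (linepath A2 A3) G) + norm (contour_integral (linepath A3 A4) G) + norm (contour_integral (linepath A4 A1) G)"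
    by (simp only: norm_minus_cancel) (intro norm_triangle_le add_mono norm_triangle_ineq order_refl)
  also have "\<dots> \<le> B * (2 * (d - c) + (b - a))" using n1 n2 n3 by (simp add: algebra_simps)
  finally show ?thesis by (simp add: G_def)
qed

lemma cmod_sin_squared: "(cmod (sin z))\<^sup>2 = (sin (Re z))\<^sup>2 + (sinh (Im z))\<^sup>2"
proof -
  have "(cmod (sin z))\<^sup>2 = (sin (Re z))\<^sup>2 * (cosh (Im z))\<^sup>2 + (cos (Re z))\<^sup>2 * (sinh (Im z))\<^sup>2"
    unfolding cmod_power2 Re_sin Im_sin
    by (simp add: cosh_field_def sinh_field_def exp_minus power2_eq_square field_simps)
  also have "\<dots> = (sin (Re z))\<^sup>2 + (sinh (Im z))\<^sup>2"
    unfolding cos_squared_eq cosh_square_eq by (simp add: algebra_simps)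
  finally show ?thesis .
qed

lemma cmod_cos_squared: "(cmod (cos z))\<^sup>2 = (cos (Re z))\<^sup>2 + (sinh (Im z))\<^sup>2"
proof -
  have "(cmod (cos z))\<^sup>2 = (cos (Re z))\<^sup>2 * (cosh (Im z))\<^sup>2 + (sin (Re z))\<^sup>2 * (sinh (Im z))\<^sup>2"
    unfolding cmod_power2 Re_cos Im_cos
    by (simp add: cosh_field_def sinh_field_def exp_minus power2_eq_square field_simps)
  also have "\<dots> = (cos (Re z))\<^sup>2 + (sinh (Im z))\<^sup>2"
    unfolding sin_squared_eq cosh_square_eq by (simp add: algebra_simps)
  finally show ?thesis .
qed

lemma cos_ne_0_upper: "Im z \<noteq> 0 \<Longrightarrow> cos z \<noteq> 0"
  using cmod_cos_squared[of z] by (auto simp: add_nonneg_eq_0_iff)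

section \<open>The function tan z / z on the upper half-plane\<close>

lemma integrable_abs_diff_powr:
  fixes a s u v :: real
  assumes "s > -1"
  shows "(\<lambda>x. \<bar>x - a\<bar> powr s) integrable_on {u..v}"
proof -
  define M where "M = \<bar>u - a\<bar> + \<bar>v - a\<bar>"
  have p: "(\<lambda>x. \<bar>x\<bar> powr s) integrable_on {0..M}"
    using has_integral_powr_from_0[OF assms, of M]
    by (intro integrable_eq[OF has_integral_integrable]) (auto simp: M_def)
  have n: "(\<lambda>x. \<bar>x\<bar> powr s) integrable_on {-M..0}"
    using p Henstock_Kurzweil_Integration.integrable_reflect_real[where f = "\<lambda>x. \<bar>x\<bar> powr s" and a = 0 and b = M] by simp
  have "(\<lambda>x. \<bar>x\<bar> powr s) integrable_on {-M..M}"
    using Henstock_Kurzweil_Integration.integrable_combine[OF _ _ n p] by (auto simp: M_def)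
  then have "(\<lambda>x. \<bar>x + (-a)\<bar> powr s) integrable_on {-M-(-a)..M-(-a)}"
    by (rule integrable_shift_real_ivl)
  then have "(\<lambda>x. \<bar>x - a\<bar> powr s) integrable_on {a-M..M+a}" by simp
  then show ?thesis
    by (rule integrable_subinterval_real) (auto simp: M_def)
qed

text \<open>Up to pi/3 the mean value theorem gives slope at least cos (pi/3) = 1/2; beyond it sin t
  is at least sqrt 3 / 2, which exceeds pi/4.\<close>

lemma abs_sin_ge_half:
  fixes t :: real
  assumes "\<bar>t\<bar> \<le> pi / 2"
  shows "\<bar>t\<bar> / 2 \<le> \<bar>sin t\<bar>"
proof -
  have *: "t / 2 \<le> sin t" if t: "0 \<le> t" "t \<le> pi / 2" for t :: real
  proof (cases "t \<le> pi / 3")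
    case True
    show ?thesis
    proof (cases "t = 0")
      case False
      then obtain z where z: "0 < z" "z < t" "sin t - sin 0 = (t - 0) * cos z"
        using t MVT2[of 0 t sin cos] by (auto intro!: derivative_eq_intros)
      have "cos (pi/3) \<le> cos z" using z True t by (intro cos_monotone_0_pi_le) auto
      then show ?thesis using z t by (simp add: cos_60)
    qed simp
  next
    case False
    have "sin (pi/3) \<le> sin t" using False t by (intro sin_monotone_2pi_le) auto
    moreover have "sqrt 3 \<ge> 1.6" by (rule real_le_rsqrt) (simp add: power2_eq_square)
    ultimately show ?thesis using t pi_less_4 pi_approx by (simp add: sin_60)
  qed
  show ?thesis using *[of t] *[of "-t"] assms by (cases "t \<ge> 0") auto
qed

lemma finite_cos_zeros: "finite {x \<in> {a..b::real}. cos x = 0}"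
proof -
  have "{x \<in> {a..b}. cos x = 0} \<subseteq> (\<lambda>i::int. of_int i * (pi / 2)) ` {\<lfloor>a / (pi/2)\<rfloor> .. \<lceil>b / (pi/2)\<rceil>}"
  proof
    fix x assume "x \<in> {x \<in> {a..b}. cos x = 0}"
    then have x: "a \<le> x" "x \<le> b" and c: "cos x = 0" by auto
    obtain i :: int where i: "x = of_int i * (pi / 2)" using c cos_zero_iff_int by auto
    have "a / (pi/2) \<le> of_int i" "of_int i \<le> b / (pi/2)" using x i by (simp_all add: field_simps)
    then have "\<lfloor>a / (pi/2)\<rfloor> \<le> i" "i \<le> \<lceil>b / (pi/2)\<rceil>" by linarith+
    then show "x \<in> (\<lambda>i::int. of_int i * (pi / 2)) ` {\<lfloor>a / (pi/2)\<rfloor> .. \<lceil>b / (pi/2)\<rceil>}"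
      using i by auto
  qed
  then show ?thesis by (rule finite_subset) simp
qed

text \<open>Supplies the dominating function when the contour descends to the real axis. Each zero
  of the cosine is simple, so the singularities are inverse square roots, and the summand of the
  nearest zero already dominates.\<close>

lemma integrable_inverse_sqrt_abs_cos:
  "(\<lambda>x. 1 / sqrt \<bar>cos x\<bar>) integrable_on {0..pi * real k}"
proof (cases "k = 0")
  case k: False
  show ?thesis
  proof (rule measurable_bounded_by_integrable_imp_integrable)
  define a where "a j = pi / 2 + pi * real j" for j
  show "(\<lambda>x. 1 / sqrt \<bar>cos x\<bar>) \<in> borel_measurable (lebesgue_on {0..pi * real k})"
    by (intro measurable_restrict_space1 measurable_completion) measurable
  show "(\<lambda>x. \<Sum>j<k. 2 * \<bar>x - a j\<bar> powr (-1/2)) integrable_on {0..pi * real k}"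
    by (intro integrable_sum integrable_on_mult_right integrable_abs_diff_powr) auto
  fix x assume x: "x \<in> {0..pi * real k}"
  show "norm (1 / sqrt \<bar>cos x\<bar>) \<le> (\<Sum>j<k. 2 * \<bar>x - a j\<bar> powr (-1/2))"
  \<comment> \<open>At a zero of the cosine the left side is 0, since division by zero yields
    0.\<close>
  proof (cases "cos x = 0")
    case True
    then show ?thesis using x by (auto simp: sum_nonneg)
  next
    case False
    \<comment> \<open>The right end pi k belongs to the last cell, for which the floor would be one
      too large.\<close>
    define j where "j = (if x = pi * real k then k - 1 else nat \<lfloor>x / pi\<rfloor>)"
    have j: "pi * real j \<le> x \<and> x \<le> pi * real j + pi \<and> j < k"
    proof (cases "x = pi * real k")
      case True then show ?thesis using k by (auto simp: j_def of_nat_diff algebra_simps)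
    next
      case False': False
      have "0 \<le> x / pi" "x / pi < real k" using x False' by (auto simp: field_simps)
      then have "real j \<le> x / pi" "x / pi < real j + 1" "j < k" using False' unfolding j_def
        by (simp_all add: floor_less_iff nat_less_iff) 
      then show ?thesis by (simp add: field_simps)
    qed
    define t where "t = x - a j"
    have t: "\<bar>t\<bar> \<le> pi / 2" unfolding t_def a_def abs_le_iff using j by (auto simp: field_simps)
    have "cos x = cos (t + pi / 2 + pi * real j)" by (simp add: t_def a_def)
    also have "\<dots> = cos (pi * real j) * cos (t + pi/2) - sin (pi * real j) * sin (t + pi/2)"
      by (simp add: cos_add)
    also have "\<dots> = - ((-1)^j * sin t)"
      by (simp add: mult.commute[of pi] cos_npi sin_npi cos_add)
    finally have "\<bar>cos x\<bar> = \<bar>sin t\<bar>" by (simp add: abs_mult)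
    then have ge: "\<bar>t\<bar> / 4 \<le> \<bar>cos x\<bar>" using abs_sin_ge_half[OF t] by simp
    have t0: "t \<noteq> 0" using \<open>\<bar>cos x\<bar> = \<bar>sin t\<bar>\<close> False by auto
    have "sqrt (\<bar>t\<bar> / 4) \<le> sqrt \<bar>cos x\<bar>" using ge by simp
    then have "1 / sqrt \<bar>cos x\<bar> \<le> 1 / sqrt (\<bar>t\<bar> / 4)" using t0 by (intro divide_left_mono) auto
    also have "\<dots> = 2 * \<bar>t\<bar> powr (-1/2)"
    proof -
      have "\<bar>t\<bar> powr (-1/2) = 1 / sqrt \<bar>t\<bar>"
        using powr_minus_divide[of "\<bar>t\<bar>" "1/2"] powr_half_sqrt[of "\<bar>t\<bar>"] by simp
      then show ?thesis by (simp add: real_sqrt_divide)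
    qed
    also have "\<dots> \<le> (\<Sum>j<k. 2 * \<bar>x - a j\<bar> powr (-1/2))"
      unfolding t_def using j by (intro member_le_sum) auto
    finally show ?thesis by simp
  qed
  qed auto
next
  case True
  then show ?thesis using integrable_on_refl[of "\<lambda>x. 1 / sqrt \<bar>cos x\<bar>" "0::real"] by simp
qed

lemma sinh_real_upper:
  fixes y :: real assumes "0 \<le> y" "y \<le> 1" shows "sinh y \<le> 2 * y"
proof -
  have "exp y \<le> 1 + y + y^2" using exp_bound assms by simp
  moreover have "1 - y \<le> exp (-y)" using exp_ge_add_one_self[of "-y"] by simp
  moreover have "y^2 \<le> y" using assms by (simp add: power2_eq_square mult_left_le_one_le)
  ultimately show ?thesis using assms by (simp add: sinh_field_def)
qed

text \<open>Multiplying by the conjugates of both denominators leaves sin z cnj (cos z) cnj z up to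
  a positive factor. The signs of its parts follow from |sin x cos x| <= |x| and sinh y cosh y > y.
  So tan z / z is real only on the imaginary axis, where it is positive, and never meets the cut of
  the principal root.\<close>

lemma tan_over_upper_half_plane:
  assumes "Im z > 0"
  shows "Re z > 0 \<Longrightarrow> Im (tan z / z) > 0" "Re z < 0 \<Longrightarrow> Im (tan z / z) < 0"
    "Re z = 0 \<Longrightarrow> Re (tan z / z) > 0"
proof -
  define x y where "x = Re z" and "y = Im z"
  have y: "y > 0" using assms by (simp add: y_def)
  have z0: "z \<noteq> 0" and c0: "cos z \<noteq> 0" using assms cos_ne_0_upper by auto
  define D where "D = (cmod (cos z))\<^sup>2 * (cmod z)\<^sup>2"
  have D: "D > 0" using z0 c0 by (simp add: D_def)
  have tD: "tan z / z = sin z * cnj (cos z) * cnj z / of_real D"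
    unfolding D_def tan_def of_real_mult complex_norm_square using z0 c0
    by (simp add: divide_simps)
  have s: "sin z * cnj (cos z) = Complex (sin x * cos x) (sinh y * cosh y)"
  proof -
    have t: "Re (sin z) = sin x * cosh y" "Im (sin z) = cos x * sinh y" 
      "Re (cos z) = cos x * cosh y" "Im (cos z) = - (sin x * sinh y)"
      unfolding x_def y_def by (simp_all add: Re_sin Im_sin Re_cos Im_cos cosh_field_def sinh_field_def exp_minus field_simps)
    have "Re (sin z * cnj (cos z)) = sin x * cos x * ((cosh y)\<^sup>2 - (sinh y)\<^sup>2)"
      by (simp add: t power2_eq_square algebra_simps)
    moreover have "Im (sin z * cnj (cos z)) = ((sin x)\<^sup>2 + (cos x)\<^sup>2) * (sinh y * cosh y)"
      by (simp add: t power2_eq_square algebra_simps del: sin_cos_squared_add sin_cos_squared_add2 sin_cos_squared_add3)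
    ultimately show ?thesis by (simp add: complex_eq_iff cosh_square_eq del: times_complex.sel)
  qed
  have "Im (sin z * cnj (cos z) * cnj z) = x * (sinh y * cosh y) - y * (sin x * cos x)"
    unfolding s by (simp add: x_def y_def algebra_simps)
  then have im: "Im (tan z / z) = (x * (sinh y * cosh y) - y * (sin x * cos x)) / D"
    unfolding tD by simp
  have "Re (sin z * cnj (cos z) * cnj z) = x * (sin x * cos x) + y * (sinh y * cosh y)"
    unfolding s by (simp add: x_def y_def algebra_simps)
  then have re: "Re (tan z / z) = (x * (sin x * cos x) + y * (sinh y * cosh y)) / D"
    unfolding tD by simp
  have sc: "\<bar>sin x * cos x\<bar> \<le> \<bar>x\<bar>"
    using mult_mono[OF abs_sin_x_le_abs_x[of x] abs_cos_le_one[of x]] by (simp add: abs_mult)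
  have hy: "y < sinh y * cosh y"
  proof -
    have "y \<le> sinh y" using real_le_x_sinh[of y] y by (simp add: sinh_field_def exp_minus)
    moreover have "1 < cosh y" using y cosh_real_strict_mono[of 0 y] by simp
    ultimately show ?thesis using y mult_less_le_imp_less[of 1 "cosh y" y "sinh y"] by (simp add: mult.commute)
  qed
  have b: "\<bar>y * (sin x * cos x)\<bar> \<le> y * \<bar>x\<bar>" using sc y by (simp add: abs_mult)
  {
    assume "Re z > 0"
    then have x: "x > 0" by (simp add: x_def)
    have "y * (sin x * cos x) \<le> y * x" using b x by linarith
    also have "\<dots> < x * (sinh y * cosh y)" using hy x by (simp add: mult.commute)
    finally show "Im (tan z / z) > 0" unfolding im using D by simp
  }
  {
    assume "Re z < 0"
    then have x: "x < 0" by (simp add: x_def)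
    have "x * (sinh y * cosh y) < x * y" using hy x by simp
    also have "x * y \<le> y * (sin x * cos x)" using b x by (simp add: abs_le_iff mult.commute)
    finally show "Im (tan z / z) < 0" unfolding im using D by (simp add: divide_neg_pos)
  }
  {
    assume "Re z = 0"
    then show "Re (tan z / z) > 0" unfolding re using D y by (simp add: x_def)
  }
qed

lemma tan_over_not_nonpos:
  assumes "Im z > 0"
  shows "tan z / z \<notin> \<real>\<^sub>\<le>\<^sub>0"
  using tan_over_upper_half_plane[OF assms] by (force simp: complex_nonpos_Reals_iff)

text \<open>This is why the vertical sides of the rectangles are placed at multiples of pi, away
  from the poles of the tangent.\<close>

lemma cmod_tan_le_1:
  assumes "sin (Re z) = 0" shows "cmod (tan z) \<le> 1"
proof -
  have "(cos (Re z))\<^sup>2 = 1" using assms by (simp add: cos_squared_eq)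
  then have "(cmod (sin z))\<^sup>2 \<le> (cmod (cos z))\<^sup>2" using assms by (simp add: cmod_sin_squared cmod_cos_squared)
  then have "cmod (sin z) \<le> cmod (cos z)" by (rule power2_le_imp_le) simp
  then show ?thesis by (simp add: tan_def norm_divide divide_le_eq_1)
qed

lemma cmod_tan_le_2:
  assumes "Im z \<ge> 1" shows "cmod (tan z) \<le> 2"
proof -
  have "sinh (Im z) \<ge> 1" using real_le_x_sinh[of "Im z"] assms by (simp add: sinh_field_def exp_minus)
  then have "(sinh (Im z))\<^sup>2 \<ge> 1" by simp
  moreover have "(sin (Re z))\<^sup>2 \<le> 1" by (simp add: abs_square_le_1)
  ultimately have "(sin (Re z))\<^sup>2 + (sinh (Im z))\<^sup>2 \<le> 4 * ((cos (Re z))\<^sup>2 + (sinh (Im z))\<^sup>2)"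
    using zero_le_power2[of "cos (Re z)"] by argo
  then have "(cmod (sin z))\<^sup>2 \<le> (2 * cmod (cos z))\<^sup>2"
    by (simp add: power_mult_distrib cmod_sin_squared cmod_cos_squared)
  then have "cmod (sin z) \<le> 2 * cmod (cos z)" by (rule power2_le_imp_le) simp
  moreover have "cos z \<noteq> 0" using assms cos_ne_0_upper by auto
  ultimately show ?thesis by (simp add: tan_def norm_divide divide_le_eq)
qed

text \<open>The bound does not degenerate as \<open>Im z\<close> tends to 0: |sin z| <= 2 |z|
  cancels the factor z, and the cosine is bounded below by its value at the real part.\<close>

lemma cmod_tan_over_le:
  assumes "0 < Im z" "Im z \<le> 1" "cos (Re z) \<noteq> 0"
  shows "cmod (tan z / z) \<le> 2 / \<bar>cos (Re z)\<bar>"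
proof -
  have z0: "z \<noteq> 0" using assms by auto
  have s2: "(sin (Re z))\<^sup>2 \<le> (Re z)\<^sup>2" using abs_sin_x_le_abs_x[of "Re z"] by (simp add: abs_le_square_iff)
  have "(sinh (Im z))\<^sup>2 \<le> (2 * Im z)\<^sup>2" using sinh_real_upper assms by (intro power_mono) auto
  then have "(sinh (Im z))\<^sup>2 \<le> 4 * (Im z)\<^sup>2" by (simp add: power_mult_distrib)
  then have "(sin (Re z))\<^sup>2 + (sinh (Im z))\<^sup>2 \<le> 4 * ((Re z)\<^sup>2 + (Im z)\<^sup>2)"
    using s2 zero_le_power2[of "Re z"] by argo
  then have "(cmod (sin z))\<^sup>2 \<le> (2 * cmod z)\<^sup>2"
    by (simp add: power_mult_distrib cmod_sin_squared cmod_power2[symmetric])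
  then have s: "cmod (sin z) \<le> 2 * cmod z" by (rule power2_le_imp_le) simp
  have "\<bar>cos (Re z)\<bar>\<^sup>2 \<le> (cmod (cos z))\<^sup>2" by (simp add: cmod_cos_squared)
  then have c: "\<bar>cos (Re z)\<bar> \<le> cmod (cos z)" by (rule power2_le_imp_le) simp
  have "cmod (tan z / z) = (cmod (sin z) / cmod z) / cmod (cos z)"
    by (simp add: tan_def norm_divide norm_mult)
  also have "\<dots> \<le> 2 / \<bar>cos (Re z)\<bar>"
    using s c z0 assms by (intro frac_le) (auto simp: divide_le_eq)
  finally show ?thesis .
qed

section \<open>Spectral representation of the symbol\<close>

text \<open>The density of the measure representing the Whitham kernel as a Laplace transform: the jump of
  \<open>sqrt (tan z / z)\<close> across the real axis.\<close>

definition whitham_density :: "real \<Rightarrow> real" where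
  "whitham_density \<eta> = (if 0 < \<eta> then sqrt (max 0 (- (tan \<eta> / \<eta>))) else 0)"

definition sqrt_tan :: "complex \<Rightarrow> complex" where
  "sqrt_tan z = csqrt (tan z / z)"

lemma whitham_density_nonneg [simp]: "0 \<le> whitham_density \<eta>"
  by (simp add: whitham_density_def)

lemma whitham_density_measurable [measurable]: "whitham_density \<in> borel_measurable borel"
  unfolding whitham_density_def[abs_def] tan_def by measurable

lemma Im_csqrt_of_real: "Im (csqrt (of_real t)) = sqrt (max 0 (- t))"
  by (auto simp: csqrt_of_real' max_def)

lemma sqrt_tan_holomorphic: "sqrt_tan holomorphic_on {z. Im z > 0}"
  unfolding sqrt_tan_def[abs_def] tan_def
  by (intro holomorphic_intros) (use tan_over_not_nonpos in \<open>auto simp: cos_ne_0_upper tan_def\<close>)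

text \<open>Makes the halves of a horizontal edge negative conjugates of each other once the odd
  factor 2 z is included, so only an imaginary part survives in their sum.\<close>

lemma sqrt_tan_reflect:
  assumes "Im z > 0" shows "sqrt_tan (- cnj z) = cnj (sqrt_tan z)"
proof -
  have "tan (- cnj z) / (- cnj z) = cnj (tan z / z)"
    using cnj_tan[of z] by simp
  then show ?thesis unfolding sqrt_tan_def by (simp only: cnj_csqrt[OF tan_over_not_nonpos[OF assms]])
qed

lemma sqrt_tan_imaginary:
  assumes "\<xi> > 0" shows "sqrt_tan (\<i> * of_real \<xi>) = of_real (whitham_symbol \<xi>)"
proof -
  have "tan (\<i> * of_real \<xi>) = \<i> * of_real (tanh \<xi>)"
    using tanh_conv_tan[of "of_real \<xi>"] by (simp add: tanh_def sinh_field_def cosh_field_def flip: of_real_minus exp_of_real)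
  then have "tan (\<i> * of_real \<xi>) / (\<i> * of_real \<xi>) = of_real (tanh \<xi> / \<xi>)" by simp
  then show ?thesis using assms by (simp add: sqrt_tan_def whitham_symbol_def csqrt_of_real del: of_real_divide)
qed

text \<open>The right side is continuous up to the negative real axis when approached from above,
  whereas \<open>csqrt\<close> jumps there.\<close>

lemma csqrt_upper:
  assumes "Im u \<ge> 0"
  shows "csqrt u = Complex (sqrt ((cmod u + Re u) / 2)) (sqrt ((cmod u - Re u) / 2))"
  using assms by (auto simp: complex_eq_iff sgn_if)

lemma sqrt_tan_boundary:
  assumes "x > 0" "cos x \<noteq> 0" and e: "\<And>j. e j > 0" "e \<longlonglongrightarrow> 0"
  shows "(\<lambda>j. sqrt_tan (Complex x (e j))) \<longlonglongrightarrow> csqrt (of_real (tan x / x))"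
proof -
  have 1: "(\<lambda>j. Complex x (e j)) \<longlonglongrightarrow> of_real x"
    using tendsto_Complex[OF tendsto_const e(2), of x] by (simp add: complex_of_real_def)
  have c: "cos (complex_of_real x) \<noteq> 0" using assms by (simp add: cos_of_real)
  have u: "(\<lambda>j. tan (Complex x (e j)) / Complex x (e j)) \<longlonglongrightarrow> tan (of_real x) / of_real x"
    unfolding tan_def using assms c by (intro tendsto_divide tendsto_sin tendsto_cos 1) auto
  have r: "tan (complex_of_real x) / of_real x = of_real (tan x / x)"
    by (simp add: tan_def cos_of_real sin_of_real)
  have s: "sqrt_tan (Complex x (e j)) = (let u = tan (Complex x (e j)) / Complex x (e j) in
       Complex (sqrt ((cmod u + Re u) / 2)) (sqrt ((cmod u - Re u) / 2)))" for j
    unfolding sqrt_tan_def Let_def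
    using tan_over_upper_half_plane(1)[of "Complex x (e j)"] assms e(1) by (intro csqrt_upper) (simp add: less_imp_le)
  have "csqrt (of_real (tan x / x)) = (let u = of_real (tan x / x) in 
       Complex (sqrt ((cmod u + Re u) / 2)) (sqrt ((cmod u - Re u) / 2)))"
    unfolding Let_def by (intro csqrt_upper) simp
  then show ?thesis unfolding s Let_def
    using u unfolding r by (simp only:) (intro tendsto_intros u; simp)
qed

text \<open>The rational factor has one pole in the upper half-plane, at \<i> \<xi>, with residue 1,
  so the residue of the whole is the symbol at \<xi>. On the real axis the factor is the Lorentzian
  at frequency \<xi>.\<close>

definition spectral_integrand :: "real \<Rightarrow> complex \<Rightarrow> complex" where
  "spectral_integrand \<xi> z = sqrt_tan z * (2 * z) / (z\<^sup>2 + of_real (\<xi>\<^sup>2))"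

text \<open>The bound is of order R^(-3/2) and the sides have length of order R, so their
  contribution vanishes as R grows. The 3 rounds up 8/3.\<close>

lemma cmod_spectral_integrand_le:
  assumes "cmod (tan z) \<le> 2" "R \<le> cmod z" "2 * \<xi> \<le> R" "0 < R" "0 < \<xi>"
  shows "cmod (spectral_integrand \<xi> z) \<le> sqrt (2 / R) * (3 / R)"
proof -
  have z: "cmod z > 0" using assms by linarith
  have "cmod (tan z) / cmod z \<le> 2 / R" using assms by (intro frac_le) auto
  then have 1: "cmod (sqrt_tan z) \<le> sqrt (2 / R)" by (simp add: sqrt_tan_def norm_divide)
  have "\<xi>\<^sup>2 \<le> (cmod z / 2)\<^sup>2" using assms by (intro power_mono) auto
  then have "(cmod z)\<^sup>2 * (3/4) \<le> (cmod z)\<^sup>2 - \<xi>\<^sup>2" by (simp add: power_divide)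
  also have "\<dots> \<le> cmod (z\<^sup>2 + of_real (\<xi>\<^sup>2))"
    using norm_diff_ineq[of "z\<^sup>2" "of_real (\<xi>\<^sup>2)"] by (simp add: norm_power)
  finally have "cmod (2 * z) / cmod (z\<^sup>2 + of_real (\<xi>\<^sup>2)) \<le> (2 * cmod z) / ((cmod z)\<^sup>2 * (3/4))"
    using z by (intro frac_le) (auto simp: norm_mult)
  also have "\<dots> = (8/3) / cmod z" using z by (simp add: power2_eq_square field_simps)
  also have "\<dots> \<le> 3 / R" using assms z by (intro frac_le) auto
  finally have 2: "cmod (2 * z) / cmod (z\<^sup>2 + of_real (\<xi>\<^sup>2)) \<le> 3 / R" .
  have "cmod (spectral_integrand \<xi> z) = cmod (sqrt_tan z) * (cmod (2 * z) / cmod (z\<^sup>2 + of_real (\<xi>\<^sup>2)))"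
    by (simp add: spectral_integrand_def norm_mult norm_divide)
  also have "\<dots> \<le> sqrt (2 / R) * (3 / R)" using 1 2 assms by (intro mult_mono) auto
  finally show ?thesis .
qed

text \<open>The line stays at a height \<epsilon> > 0 because the tangent has poles on the real
  axis. By the reflection symmetry the bottom edge contributes 2 \<i> times an imaginary part over
  \<open>{0..R}\<close>, which halves the constant 12 of the rectangle estimate.\<close>

lemma spectral_integral_approx:
  assumes \<xi>: "0 < \<xi>" and R: "R = pi * real k" "2 * \<xi> \<le> R" "1 \<le> R" and \<epsilon>: "0 < \<epsilon>" "\<epsilon> < \<xi>"
  defines "f \<equiv> (\<lambda>x. spectral_integrand \<xi> (Complex x \<epsilon>))"
  shows "\<bar>integral {0..R} (\<lambda>x. Im (f x)) - pi * whitham_symbol \<xi>\<bar> \<le> 6 * sqrt (2 / R)"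
    and "continuous_on UNIV f"
proof -
  define F where "F z = sqrt_tan z * (2 * z) / (z + \<i> * of_real \<xi>)" for z
  define p where "p = \<i> * of_real \<xi>"
  define S where "S = {z. Im z > 0}"
  have S: "convex S" "open S" unfolding S_def by (auto simp: convex_halfspace_Im_gt open_halfspace_Im_gt)
  have ne: "z + \<i> * of_real \<xi> \<noteq> 0" if "z \<in> S" for z
    using that \<xi> by (auto simp: S_def complex_eq_iff)
  have F: "F holomorphic_on S"
    unfolding F_def using sqrt_tan_holomorphic ne by (intro holomorphic_intros) (auto simp: S_def)
  have q: "F z / (z - p) = spectral_integrand \<xi> z" for z
    by (simp add: F_def p_def spectral_integrand_def algebra_simps power2_eq_square)
  have nz: "(Complex x \<epsilon>)\<^sup>2 + of_real (\<xi>\<^sup>2) \<noteq> 0" for x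
  proof
    assume "(Complex x \<epsilon>)\<^sup>2 + of_real (\<xi>\<^sup>2) = 0"
    then have "(Complex x \<epsilon> + \<i> * of_real \<xi>) * (Complex x \<epsilon> - \<i> * of_real \<xi>) = 0"
      by (simp add: algebra_simps power2_eq_square)
    then have "Complex x \<epsilon> + \<i> * of_real \<xi> = 0 \<or> Complex x \<epsilon> - \<i> * of_real \<xi> = 0"
      by (simp only: mult_eq_0_iff)
    then show False using \<xi> \<epsilon> by (auto simp: complex_eq_iff)
  qed
  have cC: "continuous_on UNIV (\<lambda>x. Complex x \<epsilon>)"
    unfolding Complex_eq by (intro continuous_intros)
  have cs: "continuous_on UNIV (\<lambda>x. sqrt_tan (Complex x \<epsilon>))"
    using \<epsilon> by (intro continuous_on_compose2[OF holomorphic_on_imp_continuous_on[OF sqrt_tan_holomorphic] cC]) auto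
  show cf: "continuous_on UNIV f"
    unfolding f_def spectral_integrand_def using nz by (intro continuous_intros cC cs) auto
  define B where "B = sqrt (2 / R) * (3 / R)"
  have side: "cmod (F z / (z - p)) \<le> B" if "\<bar>Re z\<bar> = R" for z
  proof -
    have "sin (Re z) = 0" using that R(1) by (auto simp: abs_if mult.commute[of pi] sin_npi split: if_splits) (metis add.inverse_inverse neg_equal_0_iff_equal sin_minus sin_npi)
    then have "cmod (tan z) \<le> 2" using cmod_tan_le_1[of z] by simp
    then show ?thesis unfolding q B_def
      using that R \<xi> abs_Re_le_cmod[of z] by (intro cmod_spectral_integrand_le) auto
  qed
  have top: "cmod (F z / (z - p)) \<le> B" if "Im z = R" for z
    unfolding q B_def using that R \<xi> abs_Im_le_cmod[of z] cmod_tan_le_2[of z] by (intro cmod_spectral_integrand_le) auto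
  have "norm (integral {-R..R} (\<lambda>x. F (Complex x \<epsilon>) / (Complex x \<epsilon> - p)) - 2 * of_real pi * \<i> * F p)
           \<le> B * (2 * (R - \<epsilon>) + (R - (-R)))"
    using R \<epsilon> \<xi> by (intro Cauchy_rectangle_bound[OF S F] side top) (auto simp: p_def S_def in_cbox_complex_iff)
  also have "\<dots> \<le> B * (4 * R)" using R \<epsilon> by (intro mult_left_mono) (auto simp: B_def)
  also have "\<dots> = 12 * sqrt (2 / R)" using R by (simp add: B_def)
  also have "F p = of_real (whitham_symbol \<xi>)"
    using sqrt_tan_imaginary[OF \<xi>] \<xi> by (simp add: F_def p_def)
  also have "(\<lambda>x. F (Complex x \<epsilon>) / (Complex x \<epsilon> - p)) = f" by (simp add: q f_def)
  finally have main: "cmod (integral {-R..R} f - 2 * of_real pi * \<i> * of_real (whitham_symbol \<xi>)) \<le> 12 * sqrt (2 / R)" .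
  have int: "f integrable_on {a..b}" for a b
    using cf by (intro integrable_continuous_real) (auto intro: continuous_on_subset)
  have refl: "f (- x) = - cnj (f x)" for x
  proof -
    have "Complex (-x) \<epsilon> = - cnj (Complex x \<epsilon>)" by (simp add: complex_eq_iff)
    then show ?thesis using sqrt_tan_reflect[of "Complex x \<epsilon>"] \<epsilon>
      by (simp add: f_def spectral_integrand_def del: Complex_eq)
  qed
  have "integral {-R..R} f = integral {-R..0} f + integral {0..R} f"
    using R by (intro Henstock_Kurzweil_Integration.integral_combine[symmetric] int) auto
  also have "integral {-R..0} f = integral {0..R} (\<lambda>x. f (-x))"
    using Henstock_Kurzweil_Integration.integral_reflect_real[where f = f and a = "-R" and b = 0] by simp
  also have "\<dots> = - cnj (integral {0..R} f)"
    using integral_linear[OF int bounded_linear_cnj, of 0 R] by (simp add: refl o_def)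
  also have "- cnj (integral {0..R} f) + integral {0..R} f = 2 * \<i> * of_real (Im (integral {0..R} f))"
    by (simp add: complex_eq_iff)
  also have "Im (integral {0..R} f) = integral {0..R} (\<lambda>x. Im (f x))"
    using integral_linear[OF int bounded_linear_Im, of 0 R] by (simp add: o_def)
  finally have "cmod (2 * \<i> * of_real (integral {0..R} (\<lambda>x. Im (f x)) - pi * whitham_symbol \<xi>)) \<le> 12 * sqrt (2 / R)"
    using main by (simp add: algebra_simps)
  then show "\<bar>integral {0..R} (\<lambda>x. Im (f x)) - pi * whitham_symbol \<xi>\<bar> \<le> 6 * sqrt (2 / R)"
    by (simp add: norm_mult del: of_real_diff)
qed

lemma cmod_spectral_integrand_near_axis:
  assumes \<xi>: "0 < \<xi>" and x: "0 \<le> x" "x \<le> R" "cos x \<noteq> 0" and e: "0 < e" "e \<le> 1" "e \<le> \<xi> / 2"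
  shows "cmod (spectral_integrand \<xi> (Complex x e)) \<le> sqrt 2 * (2 * (R + 1)) / (\<xi>\<^sup>2 / 2) * (1 / sqrt \<bar>cos x\<bar>)"
proof -
  define z where "z = Complex x e"
  have "cmod (tan z / z) \<le> 2 / \<bar>cos x\<bar>"
    using cmod_tan_over_le[of z] e x by (simp add: z_def)
  then have 1: "cmod (sqrt_tan z) \<le> sqrt 2 * (1 / sqrt \<bar>cos x\<bar>)"
    unfolding sqrt_tan_def norm_csqrt
    using real_sqrt_le_mono[of "cmod (tan z / z)" "2 / \<bar>cos x\<bar>"] by (simp add: real_sqrt_divide)
  have 2: "cmod (2 * z) \<le> 2 * (R + 1)"
    using cmod_le[of z] x e by (simp add: norm_mult z_def)
  have "z\<^sup>2 + of_real (\<xi>\<^sup>2) = (z + \<i> * of_real \<xi>) * (z - \<i> * of_real \<xi>)"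
    by (simp add: algebra_simps power2_eq_square)
  then have "cmod (z\<^sup>2 + of_real (\<xi>\<^sup>2)) = cmod (z + \<i> * of_real \<xi>) * cmod (z - \<i> * of_real \<xi>)"
    by (simp add: norm_mult)
  moreover have "\<xi> \<le> cmod (z + \<i> * of_real \<xi>)"
    using abs_Im_le_cmod[of "z + \<i> * of_real \<xi>"] e \<xi> by (simp add: z_def)
  moreover have "\<xi> / 2 \<le> cmod (z - \<i> * of_real \<xi>)"
    using abs_Im_le_cmod[of "z - \<i> * of_real \<xi>"] e \<xi> by (simp add: z_def)
  ultimately have 3: "\<xi>\<^sup>2 / 2 \<le> cmod (z\<^sup>2 + of_real (\<xi>\<^sup>2))"
    using mult_mono[of \<xi> "cmod (z + \<i> * of_real \<xi>)" "\<xi> / 2" "cmod (z - \<i> * of_real \<xi>)"] \<xi>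
    by (simp add: power2_eq_square)
  have "cmod (spectral_integrand \<xi> z) = cmod (sqrt_tan z) * cmod (2 * z) / cmod (z\<^sup>2 + of_real (\<xi>\<^sup>2))"
    by (simp add: spectral_integrand_def norm_mult norm_divide)
  also have "\<dots> \<le> (sqrt 2 * (1 / sqrt \<bar>cos x\<bar>)) * (2 * (R + 1)) / (\<xi>\<^sup>2 / 2)"
    using x \<xi> by (intro frac_le mult_mono 1 2 3) auto
  finally show ?thesis by (simp add: z_def mult_ac)
qed

lemma spectral_integral_box:
  assumes \<xi>: "0 < \<xi>" and R: "R = pi * real k" "2 * \<xi> \<le> R" "1 \<le> R"
  defines "g \<equiv> (\<lambda>x. whitham_density x * (2 * x / (x\<^sup>2 + \<xi>\<^sup>2)))"
  shows "g integrable_on {0..R}" "\<bar>integral {0..R} g - pi * whitham_symbol \<xi>\<bar> \<le> 6 * sqrt (2 / R)"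
proof -
  \<comment> \<open>Heights of at most \<xi>/2 keep the line well below the pole \<i> \<xi>, and
    heights of at most 1 are required by the estimate of the tangent near the axis.\<close>
  define e where "e j = min \<xi> 1 / 2 * inverse (real (Suc j))" for j
  have e: "0 < e j" "e j \<le> 1" "e j \<le> \<xi> / 2" "e j < \<xi>" for j
  proof -
    have "e j \<le> min \<xi> 1 / 2 * 1"
      unfolding e_def using \<xi> by (intro mult_left_mono) (auto simp: inverse_le_1_iff)
    then show "e j \<le> 1" "e j \<le> \<xi> / 2" "e j < \<xi>" using \<xi> by linarith+
    show "0 < e j" using \<xi> by (simp add: e_def)
  qed
  have e0: "e \<longlonglongrightarrow> 0"
    unfolding e_def by (rule tendsto_mult_right_zero[OF LIMSEQ_inverse_real_of_nat])
  define f where "f j x = Im (spectral_integrand \<xi> (Complex x (e j)))" for j x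
  \<comment> \<open>The boundary values are known only at positive points where the cosine does not
    vanish; the finite set of remaining points does not affect integrals.\<close>
  define Z where "Z = insert 0 {x \<in> {0..R}. cos x = 0}"
  have nZ: "negligible Z" unfolding Z_def using finite_cos_zeros by (intro negligible_finite) auto
  define S where "S = {0..R} - Z"
  define h where "h x = sqrt 2 * (2 * (R + 1)) / (\<xi>\<^sup>2 / 2) * (1 / sqrt \<bar>cos x\<bar>)" for x
  have spike: "integral S u = integral {0..R} u" "u integrable_on S \<longleftrightarrow> u integrable_on {0..R}" for u :: "real \<Rightarrow> real"
  proof -
    have n: "negligible {x \<in> S - {0..R}. u x \<noteq> 0}" "negligible {x \<in> {0..R} - S. u x \<noteq> 0}"
      by (auto simp: S_def intro: negligible_subset[OF nZ])
    show "integral S u = integral {0..R} u" by (rule integral_spike_set[OF n])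
    show "u integrable_on S \<longleftrightarrow> u integrable_on {0..R}" 
      unfolding integrable_on_def has_integral_spike_set_eq[OF n] ..
  qed
  have fint: "f j integrable_on {0..R}" for j
  proof -
    have "continuous_on UNIV (\<lambda>x. spectral_integrand \<xi> (Complex x (e j)))"
      using spectral_integral_approx(2)[OF \<xi> R e(1,4)] .
    then show ?thesis unfolding f_def
      by (intro integrable_continuous_real continuous_intros) (auto intro: continuous_on_subset)
  qed
  have hint: "h integrable_on {0..R}"
    unfolding h_def R(1) by (intro integrable_on_mult_right integrable_inverse_sqrt_abs_cos)
  have dom: "norm (f j x) \<le> h x" if "x \<in> S" for j x
    using cmod_spectral_integrand_near_axis[OF \<xi>, of x R "e j"] that e[of j]
      abs_Im_le_cmod[of "spectral_integrand \<xi> (Complex x (e j))"]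
    by (auto simp: S_def Z_def f_def h_def)
  have lim: "(\<lambda>j. f j x) \<longlonglongrightarrow> g x" if "x \<in> S" for x
  proof -
    have x: "x > 0" "cos x \<noteq> 0" using that by (auto simp: S_def Z_def)
    have C: "(\<lambda>j. Complex x (e j)) \<longlonglongrightarrow> of_real x"
      using tendsto_Complex[OF tendsto_const e0, of x] by (simp add: complex_of_real_def)
    have nz: "(complex_of_real x)\<^sup>2 + of_real (\<xi>\<^sup>2) \<noteq> 0"
    proof -
      have "x\<^sup>2 + \<xi>\<^sup>2 \<noteq> 0" using x by simp
      then show ?thesis by (simp only: of_real_power[symmetric] of_real_add[symmetric] of_real_eq_0_iff not_False_eq_True)
    qed
    have "(\<lambda>j. spectral_integrand \<xi> (Complex x (e j))) \<longlonglongrightarrow>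
        csqrt (of_real (tan x / x)) * (2 * of_real x) / ((of_real x)\<^sup>2 + of_real (\<xi>\<^sup>2))"
      unfolding spectral_integrand_def
      using sqrt_tan_boundary[OF x e(1) e0] nz by (intro tendsto_intros C)
    then have "(\<lambda>j. f j x) \<longlonglongrightarrow> Im (csqrt (of_real (tan x / x)) * (2 * of_real x) / ((of_real x)\<^sup>2 + of_real (\<xi>\<^sup>2)))"
      unfolding f_def by (rule tendsto_Im)
    also have "csqrt (of_real (tan x / x)) * (2 * of_real x) / ((of_real x)\<^sup>2 + of_real (\<xi>\<^sup>2))
        = csqrt (of_real (tan x / x)) * of_real (2 * x / (x\<^sup>2 + \<xi>\<^sup>2))" by simp
    also have "Im \<dots> = g x"
      unfolding g_def using x Im_csqrt_of_real[of "tan x / x"] by (simp add: whitham_density_def del: of_real_divide csqrt.simps)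
    finally show ?thesis .
  qed
  have dc: "g integrable_on S" "(\<lambda>j. integral S (f j)) \<longlonglongrightarrow> integral S g"
    using dominated_convergence[of f S h g] fint hint dom lim spike(2) by blast+
  show "g integrable_on {0..R}" using dc(1) spike(2) by blast
  have "(\<lambda>j. \<bar>integral S (f j) - pi * whitham_symbol \<xi>\<bar>) \<longlonglongrightarrow> \<bar>integral S g - pi * whitham_symbol \<xi>\<bar>"
    by (intro tendsto_intros dc)
  moreover have "\<bar>integral S (f j) - pi * whitham_symbol \<xi>\<bar> \<le> 6 * sqrt (2 / R)" for j
    using spectral_integral_approx(1)[OF \<xi> R e(1,4)] unfolding spike(1) f_def .
  ultimately show "\<bar>integral {0..R} g - pi * whitham_symbol \<xi>\<bar> \<le> 6 * sqrt (2 / R)"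
    unfolding spike(1) by (intro LIMSEQ_le_const2) auto
qed

lemma filterlim_pi_real: "filterlim (\<lambda>k. pi * real k) at_top sequentially"
  by (intro filterlim_tendsto_pos_mult_at_top[OF tendsto_const] filterlim_real_sequentially) auto

text \<open>The integrand is nonnegative, so the boxes exhaust the half-line by monotone convergence
  while the error of order R^(-1/2) disappears.\<close>

theorem whitham_symbol_spectral:
  assumes \<xi>: "0 < \<xi>"
  shows "has_bochner_integral lborel (\<lambda>\<eta>. whitham_density \<eta> * (2 * \<eta> / (\<eta>\<^sup>2 + \<xi>\<^sup>2))) (pi * whitham_symbol \<xi>)"
proof -
  define g where "g = (\<lambda>x. whitham_density x * (2 * x / (x\<^sup>2 + \<xi>\<^sup>2)))"
  have g0: "0 \<le> g x" for x
    by (cases "x > 0") (auto simp: g_def whitham_density_def)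
  obtain N where N: "\<And>k. k \<ge> N \<Longrightarrow> pi * real k \<ge> 2 * \<xi> + 1"
    using filterlim_pi_real unfolding filterlim_at_top eventually_sequentially by meson
  \<comment> \<open>The shift by \<open>N\<close> makes every box large enough for the box
    estimate.\<close>
  define R where "R k = pi * real (k + N)" for k
  have R: "2 * \<xi> \<le> R k" "1 \<le> R k" for k using N[of "k + N"] \<xi> by (auto simp: R_def)
  note box = spectral_integral_box[OF \<xi> R_def R, folded g_def]
  have Rt: "filterlim R at_top sequentially"
    unfolding R_def using filterlim_compose[OF filterlim_pi_real filterlim_add_const_nat_at_top[of N]] by simp
  have I: "((\<lambda>x. if x \<in> {0..R k} then g x else 0) has_integral integral {0..R k} g) {0..}" for k
    using integrable_integral[OF box(1)[of k]] by (subst has_integral_restrict) auto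
  have L: "(\<lambda>k. integral {0..R k} g) \<longlonglongrightarrow> pi * whitham_symbol \<xi>"
  proof (rule Lim_null_comparison[of "\<lambda>k. integral {0..R k} g - pi * whitham_symbol \<xi>", THEN LIM_zero_cancel])
    show "\<forall>\<^sub>F k in sequentially. norm (integral {0..R k} g - pi * whitham_symbol \<xi>) \<le> 6 * sqrt (2 / R k)"
      using box(2) by simp
    have "(\<lambda>k. 2 / R k) \<longlonglongrightarrow> 0" by (rule real_tendsto_divide_at_top[OF tendsto_const Rt])
    then show "(\<lambda>k. 6 * sqrt (2 / R k)) \<longlonglongrightarrow> 0"
      using tendsto_real_sqrt[of "\<lambda>k. 2 / R k" 0 sequentially] by (intro tendsto_mult_right_zero) simp
  qed
  have C: "(\<lambda>k. if x \<in> {0..R k} then g x else 0) \<longlonglongrightarrow> g x" if "x \<in> {0..}" for x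
  proof (rule tendsto_eventually)
    have "\<forall>\<^sub>F k in sequentially. x \<le> R k" using Rt by (simp add: filterlim_at_top)
    then show "\<forall>\<^sub>F k in sequentially. (if x \<in> {0..R k} then g x else 0) = g x"
      by (rule eventually_mono) (use that in auto)
  qed
  have M: "(if x \<in> {0..R k} then g x else 0) \<le> (if x \<in> {0..R (Suc k)} then g x else 0)" for x k
    using g0 by (auto simp: R_def mult_le_cancel_left_pos intro: order_trans)
  have "(g has_integral pi * whitham_symbol \<xi>) {0..}"
    by (rule has_integral_monotone_convergence_increasing[OF I M C L])
  then have "(\<integral>\<^sup>+x. ennreal (indicator {0..} x * g x) \<partial>lborel) = ennreal (pi * whitham_symbol \<xi>)"
    using g0 by (intro nn_integral_has_integral_lebesgue)
  also have "(\<lambda>x. indicator {0..} x * g x) = g" by (auto simp: g_def whitham_density_def indicator_def)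
  finally have "(\<integral>\<^sup>+x. ennreal (g x) \<partial>lborel) = ennreal (pi * whitham_symbol \<xi>)" .
  moreover have "0 \<le> pi * whitham_symbol \<xi>" using \<xi> by (simp add: whitham_symbol_def)
  ultimately have "has_bochner_integral lborel g (pi * whitham_symbol \<xi>)"
    using g0 by (intro has_bochner_integral_nn_integral) (auto simp: g_def)
  then show ?thesis by (simp add: g_def)
qed

section \<open>Fourier transform of the Lorentzian\<close>

lemma norm_diff_diff_le:
  fixes a b c :: "'a :: real_normed_vector"
  shows "norm (a - b - c) \<le> norm a + norm b + norm c"
  using norm_triangle_ineq4[of "a - b" c] norm_triangle_ineq4[of a b] by linarith

text \<open>One integration by parts against the oscillating factor. Since \<rho> decreases on
  [b, R], the remaining integral is at most (\<rho> b - \<rho> R) / |x|; with the two boundary terms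
  this makes 2 \<rho> b / |x|, independently of R.\<close>

lemma lorentzian_tail:
  fixes x b R \<eta> :: real
  assumes x: "x \<noteq> 0" and b: "0 < b" "b \<le> R" and \<eta>: "0 < \<eta>"
  defines "\<rho> \<equiv> (\<lambda>\<xi>. 2 * \<eta> / (\<eta>\<^sup>2 + \<xi>\<^sup>2))"
  shows "norm (integral {b..R} (\<lambda>\<xi>. of_real (\<rho> \<xi>) * exp (\<i> * of_real x * of_real \<xi>))) \<le> 2 * \<rho> b / \<bar>x\<bar>"
proof -
  define \<rho>' where "\<rho>' = (\<lambda>\<xi>. - (2 * \<eta> * (2 * \<xi>)) / (\<eta>\<^sup>2 + \<xi>\<^sup>2)\<^sup>2)"
  define E where "E = (\<lambda>\<xi>. exp (\<i> * of_real x * of_real \<xi>))"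
  have den: "\<eta>\<^sup>2 + \<xi>\<^sup>2 \<noteq> 0" for \<xi> using \<eta> by (metis add_nonneg_eq_0_iff less_irrefl power_eq_0_iff zero_le_power2)
  have d\<rho>: "(\<rho> has_real_derivative \<rho>' \<xi>) (at \<xi> within A)" for \<xi> A
    unfolding \<rho>_def \<rho>'_def using den[of \<xi>] by (auto intro!: derivative_eq_intros simp: power2_eq_square)
  have nE: "norm (E \<xi>) = 1" for \<xi> by (simp add: E_def norm_exp_eq_Re)
  have dE: "(E has_vector_derivative (\<i> * of_real x * E \<xi>)) (at \<xi> within A)" for \<xi> A
  proof -
    have "((\<lambda>z. exp (\<i> * of_real x * z)) has_field_derivative (\<i> * of_real x * E \<xi>)) (at (of_real \<xi>))"
      unfolding E_def by (auto intro!: derivative_eq_intros)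
    then have "(E has_vector_derivative (\<i> * of_real x * E \<xi>)) (at \<xi>)"
      unfolding E_def by (rule has_vector_derivative_real_field)
    then show ?thesis by (rule has_vector_derivative_at_within)
  qed
  define G where "G = (\<lambda>\<xi>. of_real (\<rho> \<xi>) * E \<xi> / (\<i> * of_real x))"
  have dG: "(G has_vector_derivative (of_real (\<rho> \<xi>) * E \<xi> + of_real (\<rho>' \<xi>) * E \<xi> / (\<i> * of_real x))) (at \<xi> within A)" for \<xi> A
  proof -
    have "((\<lambda>\<xi>. complex_of_real (\<rho> \<xi>)) has_vector_derivative of_real (\<rho>' \<xi>)) (at \<xi> within A)"
      using d\<rho> by (intro has_vector_derivative_of_real) (auto simp: has_real_derivative_iff_has_vector_derivative)
    from has_vector_derivative_divide[OF has_vector_derivative_mult[OF this dE], of "\<i> * of_real x"]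
    show ?thesis unfolding G_def using x by (simp add: field_simps)
  qed
  have "((\<lambda>\<xi>. of_real (\<rho> \<xi>) * E \<xi> + of_real (\<rho>' \<xi>) * E \<xi> / (\<i> * of_real x)) has_integral (G R - G b)) {b..R}"
    by (rule fundamental_theorem_of_calculus[OF b(2) dG])
  moreover have c\<rho>': "continuous_on {b..R} (\<lambda>\<xi>. complex_of_real (\<rho>' \<xi>) * E \<xi> / (\<i> * of_real x))"
    unfolding \<rho>'_def E_def using den x by (intro continuous_intros) auto
  then have i2: "(\<lambda>\<xi>. of_real (\<rho>' \<xi>) * E \<xi> / (\<i> * of_real x)) integrable_on {b..R}"
    by (rule integrable_continuous_real)
  ultimately have "((\<lambda>\<xi>. of_real (\<rho> \<xi>) * E \<xi> + of_real (\<rho>' \<xi>) * E \<xi> / (\<i> * of_real x) - of_real (\<rho>' \<xi>) * E \<xi> / (\<i> * of_real x)) has_integral 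
     (G R - G b - integral {b..R} (\<lambda>\<xi>. of_real (\<rho>' \<xi>) * E \<xi> / (\<i> * of_real x)))) {b..R}"
    by (intro has_integral_diff integrable_integral)
  then have eq: "integral {b..R} (\<lambda>\<xi>. of_real (\<rho> \<xi>) * E \<xi>) = G R - G b - integral {b..R} (\<lambda>\<xi>. of_real (\<rho>' \<xi>) * E \<xi> / (\<i> * of_real x))"
    by (simp add: integral_unique)
  have "((\<lambda>\<xi>. - \<rho>' \<xi> / \<bar>x\<bar>) has_integral (- \<rho> R / \<bar>x\<bar> - (- \<rho> b / \<bar>x\<bar>))) {b..R}"
    using DERIV_cdivide[OF DERIV_minus[OF d\<rho>]] by (intro fundamental_theorem_of_calculus b)
      (auto simp: has_real_derivative_iff_has_vector_derivative[symmetric])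
  note i3 = has_integral_integrable[OF this] integral_unique[OF this]
  have nI: "norm (integral {b..R} (\<lambda>\<xi>. of_real (\<rho>' \<xi>) * E \<xi> / (\<i> * of_real x))) \<le> integral {b..R} (\<lambda>\<xi>. - \<rho>' \<xi> / \<bar>x\<bar>)"
  proof (rule integral_norm_bound_integral[OF i2 i3(1)])
    fix \<xi> assume "\<xi> \<in> {b..R}"
    then have "\<rho>' \<xi> \<le> 0" using b \<eta> by (simp add: \<rho>'_def)
    then show "norm (of_real (\<rho>' \<xi>) * E \<xi> / (\<i> * of_real x)) \<le> - \<rho>' \<xi> / \<bar>x\<bar>"
      by (simp add: norm_mult norm_divide nE)
  qed
  have nG: "norm (G \<xi>) = \<rho> \<xi> / \<bar>x\<bar>" for \<xi>
  proof -
    have "0 \<le> \<rho> \<xi>" using \<eta> by (simp add: \<rho>_def)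
    then show ?thesis by (simp add: G_def norm_mult norm_divide nE)
  qed
  have "norm (integral {b..R} (\<lambda>\<xi>. of_real (\<rho> \<xi>) * E \<xi>)) \<le> \<rho> R / \<bar>x\<bar> + \<rho> b / \<bar>x\<bar> + (- \<rho> R / \<bar>x\<bar> - (- \<rho> b / \<bar>x\<bar>))"
    unfolding eq i3(2)[symmetric] using nI nG[of R] nG[of b] norm_diff_diff_le[of "G R" "G b" "integral {b..R} (\<lambda>\<xi>. of_real (\<rho>' \<xi>) * E \<xi> / (\<i> * of_real x))"]
    by linarith
  then show ?thesis unfolding E_def by (simp add: add_divide_distrib[symmetric] diff_divide_distrib[symmetric])
qed

text \<open>For x > 0 the exponential is at most 1 in modulus in the upper half-plane, so the
  contour closes there, and the residue at \<i> \<eta> yields the exponential.\<close>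

lemma lorentzian_symmetric_limit:
  fixes x \<eta> :: real
  assumes x: "x > 0" and \<eta>: "0 < \<eta>" and R: "R > 2 * \<eta>"
  shows "norm (integral {-R..R} (\<lambda>\<xi>. of_real (2 * \<eta> / (\<eta>\<^sup>2 + \<xi>\<^sup>2)) * exp (\<i> * of_real x * of_real \<xi>)) - of_real (2 * pi * exp (- (x * \<eta>))))
     \<le> 12 * \<eta> / R"
proof -
  define F where "F z = exp (\<i> * of_real x * z) * of_real (2 * \<eta>) / (z + \<i> * of_real \<eta>)" for z
  define p where "p = \<i> * complex_of_real \<eta>"
  \<comment> \<open>The bottom edge is the real axis itself, so the domain has to reach below it; it
    stops above the second pole at -\<i> \<eta>.\<close>
  define S where "S = {z. Im z > - \<eta>}"
  have S: "convex S" "open S" unfolding S_def by (auto simp: convex_halfspace_Im_gt open_halfspace_Im_gt)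
  have ne: "z + \<i> * of_real \<eta> \<noteq> 0" if "z \<in> S" for z
    using that by (auto simp: S_def complex_eq_iff)
  have F: "F holomorphic_on S"
    unfolding F_def using ne by (intro holomorphic_intros) auto
  have q: "F z / (z - p) = exp (\<i> * of_real x * z) * of_real (2 * \<eta>) / (z\<^sup>2 + of_real (\<eta>\<^sup>2))" for z
    by (simp add: F_def p_def algebra_simps power2_eq_square)
  define B where "B = 3 * \<eta> / R\<^sup>2"
  have bd: "cmod (F z / (z - p)) \<le> B" if "cmod z \<ge> R" "Im z \<ge> 0" for z
  proof -
    have "\<eta>\<^sup>2 \<le> (cmod z / 2)\<^sup>2" using that R \<eta> by (intro power_mono) auto
    moreover have "R\<^sup>2 \<le> (cmod z)\<^sup>2" using that R \<eta> by (intro power_mono) auto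
    ultimately have "R\<^sup>2 * (3/4) \<le> (cmod z)\<^sup>2 - \<eta>\<^sup>2" by (simp add: power_divide)
    also have "\<dots> \<le> cmod (z\<^sup>2 + of_real (\<eta>\<^sup>2))"
      using norm_diff_ineq[of "z\<^sup>2" "of_real (\<eta>\<^sup>2)"] by (simp add: norm_power)
    finally have d: "R\<^sup>2 * (3/4) \<le> cmod (z\<^sup>2 + of_real (\<eta>\<^sup>2))" .
    have "cmod (F z / (z - p)) = exp (- (x * Im z)) * (2 * \<eta>) / cmod (z\<^sup>2 + of_real (\<eta>\<^sup>2))"
      unfolding q using \<eta> by (simp add: norm_mult norm_divide)
    also have "\<dots> \<le> 1 * (2 * \<eta>) / (R\<^sup>2 * (3/4))"
      using d \<eta> x R that by (intro frac_le mult_mono) auto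
    also have "\<dots> \<le> B" using \<eta> R by (simp add: B_def field_simps)
    finally show ?thesis .
  qed
  have "norm (integral {-R..R} (\<lambda>\<xi>. F (Complex \<xi> 0) / (Complex \<xi> 0 - p)) - 2 * of_real pi * \<i> * F p)
           \<le> B * (2 * (R - 0) + (R - (-R)))"
  proof (rule Cauchy_rectangle_bound[OF S F])
    show "cbox (Complex (- R) 0) (Complex R R) \<subseteq> S" using \<eta> by (auto simp: S_def in_cbox_complex_iff)
    show "cmod (F (Complex (- R) y) / (Complex (- R) y - p)) \<le> B" if "y \<in> {0..R}" for y
      using that R \<eta> abs_Re_le_cmod[of "Complex (-R) y"] by (intro bd) auto
    show "cmod (F (Complex R y) / (Complex R y - p)) \<le> B" if "y \<in> {0..R}" for y
      using that R \<eta> abs_Re_le_cmod[of "Complex R y"] by (intro bd) auto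
    show "cmod (F (Complex y R) / (Complex y R - p)) \<le> B" if "y \<in> {-R..R}" for y
      using that R \<eta> abs_Im_le_cmod[of "Complex y R"] by (intro bd) auto
  qed (use R \<eta> in \<open>auto simp: p_def\<close>)
  also have "(\<lambda>\<xi>. F (Complex \<xi> 0) / (Complex \<xi> 0 - p)) = (\<lambda>\<xi>. of_real (2 * \<eta> / (\<eta>\<^sup>2 + \<xi>\<^sup>2)) * exp (\<i> * of_real x * of_real \<xi>))"
    unfolding q complex_of_real_def[symmetric] by (auto simp: add.commute mult.commute)
  also have "2 * of_real pi * \<i> * F p = of_real (2 * pi * exp (- (x * \<eta>)))"
  proof -
    have "\<i> * of_real x * p = of_real (- (x * \<eta>))" by (simp add: p_def complex_eq_iff)
    then have e: "exp (\<i> * of_real x * p) = of_real (exp (- (x * \<eta>)))" by (simp only: exp_of_real)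
    have ps: "p + \<i> * of_real \<eta> = 2 * \<i> * of_real \<eta>" by (simp add: p_def)
    have "2 * of_real pi * \<i> * F p = 2 * of_real pi * (\<i> * of_real (2 * \<eta>) / (2 * \<i> * of_real \<eta>)) * of_real (exp (- (x * \<eta>)))"
      unfolding F_def ps e by simp
    also have "\<i> * of_real (2 * \<eta>) / (2 * \<i> * of_real \<eta>) = 1" using \<eta> by simp
    finally show ?thesis by simp
  qed
  also have "B * (2 * (R - 0) + (R - (-R))) = 12 * \<eta> / R" using R \<eta> by (simp add: B_def power2_eq_square)
  finally show ?thesis .
qed

text \<open>The window may be asymmetric because a Henstock-Kurzweil integral over the line requires
  convergence along arbitrary large intervals. The error is kept as a multiple of \<rho> a + \<rho>
  b so that integration over \<eta> turns it into values of the symbol.\<close>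

lemma lorentzian_fourier_approx:
  fixes x a b \<eta> :: real
  assumes x: "x \<noteq> 0" and ab: "0 < a" "0 < b" and \<eta>: "0 < \<eta>"
  defines "\<rho> \<equiv> (\<lambda>\<xi>. 2 * \<eta> / (\<eta>\<^sup>2 + \<xi>\<^sup>2))"
  shows "norm (integral {-a..b} (\<lambda>\<xi>. of_real (\<rho> \<xi>) * exp (\<i> * of_real x * of_real \<xi>)) - of_real (2 * pi * exp (- (\<bar>x\<bar> * \<eta>))))
     \<le> 2 / \<bar>x\<bar> * (\<rho> a + \<rho> b)"
proof -
  have pos: "norm (integral {-a..b} (\<lambda>\<xi>. of_real (\<rho> \<xi>) * exp (\<i> * of_real x * of_real \<xi>)) - of_real (2 * pi * exp (- (x * \<eta>))))
     \<le> 2 / x * (\<rho> a + \<rho> b)" if x: "x > 0" for x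
  proof -
    define f where "f \<xi> = of_real (\<rho> \<xi>) * exp (\<i> * of_real x * of_real \<xi>)" for \<xi>
    have den: "\<eta>\<^sup>2 + \<xi>\<^sup>2 \<noteq> 0" for \<xi> using \<eta> by (metis add_nonneg_eq_0_iff less_irrefl power_eq_0_iff zero_le_power2)
    have int: "f integrable_on {u..v}" for u v
      unfolding f_def \<rho>_def using den by (intro integrable_continuous_real continuous_intros) auto
    have refl: "f (-\<xi>) = of_real (\<rho> \<xi>) * exp (\<i> * of_real (-x) * of_real \<xi>)" for \<xi>
      by (simp add: f_def \<rho>_def)
    have *: "norm (integral {-a..b} f - of_real (2 * pi * exp (- (x * \<eta>)))) \<le> 2 / x * (\<rho> a + \<rho> b) + 12 * \<eta> / R"
      if R: "R > 2 * \<eta>" "R \<ge> a" "R \<ge> b" for R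
    proof -
      have "integral {-R..R} f = integral {-R..-a} f + integral {-a..R} f"
        using ab R by (intro Henstock_Kurzweil_Integration.integral_combine[symmetric] int) auto
      also have "integral {-a..R} f = integral {-a..b} f + integral {b..R} f"
        using ab R by (intro Henstock_Kurzweil_Integration.integral_combine[symmetric] int) auto
      finally have s: "integral {-a..b} f = integral {-R..R} f - integral {-R..-a} f - integral {b..R} f" by simp
      have "norm (integral {b..R} f) \<le> 2 * \<rho> b / \<bar>x\<bar>"
        using lorentzian_tail[of x b R \<eta>] x ab R \<eta> unfolding f_def \<rho>_def by simp
      moreover have "norm (integral {-R..-a} f) \<le> 2 * \<rho> a / \<bar>x\<bar>"
      proof -
        have "integral {-R..-a} f = integral {a..R} (\<lambda>\<xi>. f (-\<xi>))"
          using Henstock_Kurzweil_Integration.integral_reflect_real[where f = f and a = "-R" and b = "-a"] by simp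
        then show ?thesis
          using lorentzian_tail[of "-x" a R \<eta>] x ab R \<eta> unfolding refl unfolding \<rho>_def by simp
      qed
      moreover have "norm (integral {-R..R} f - of_real (2 * pi * exp (- (x * \<eta>)))) \<le> 12 * \<eta> / R"
        using lorentzian_symmetric_limit[OF x \<eta> R(1)] unfolding f_def \<rho>_def .
      ultimately have "norm ((integral {-R..R} f - of_real (2 * pi * exp (- (x * \<eta>)))) - integral {-R..-a} f - integral {b..R} f)
          \<le> 12 * \<eta> / R + 2 * \<rho> a / \<bar>x\<bar> + 2 * \<rho> b / \<bar>x\<bar>"
        using norm_diff_diff_le[of "integral {-R..R} f - of_real (2 * pi * exp (- (x * \<eta>)))" "integral {-R..-a} f" "integral {b..R} f"]
        by linarith
      then show ?thesis unfolding s using x by (simp add: algebra_simps add_divide_distrib)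
    qed
    have "((\<lambda>R. 2 / x * (\<rho> a + \<rho> b) + 12 * \<eta> / R) \<longlongrightarrow> 2 / x * (\<rho> a + \<rho> b) + 0) at_top"
      by (intro tendsto_intros real_tendsto_divide_at_top[OF tendsto_const] filterlim_ident)
    moreover have "\<forall>\<^sub>F R in at_top. norm (integral {-a..b} f - of_real (2 * pi * exp (- (x * \<eta>)))) \<le> 2 / x * (\<rho> a + \<rho> b) + 12 * \<eta> / R"
      using eventually_gt_at_top[of "2 * \<eta>"] eventually_ge_at_top[of a] eventually_ge_at_top[of b]
      by eventually_elim (rule *)
    ultimately show ?thesis
      unfolding f_def[symmetric] by (intro tendsto_lowerbound[of _ "2 / x * (\<rho> a + \<rho> b)"]) auto
  qed
  show ?thesis
  proof (cases "x > 0")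
    case True
    then show ?thesis using pos[of x] by simp
  next
    case False
    define f where "f \<xi> = of_real (\<rho> \<xi>) * exp (\<i> * of_real (-x) * of_real \<xi>)" for \<xi>
    have "integral {-a..b} (\<lambda>\<xi>. of_real (\<rho> \<xi>) * exp (\<i> * of_real x * of_real \<xi>)) = integral {-a..b} (\<lambda>\<xi>. cnj (f \<xi>))"
      by (simp add: f_def exp_cnj)
    also have "\<dots> = cnj (integral {-a..b} f)" by (rule integral_cnj[symmetric])
    finally have "norm (integral {-a..b} (\<lambda>\<xi>. of_real (\<rho> \<xi>) * exp (\<i> * of_real x * of_real \<xi>)) - of_real (2 * pi * exp (- (\<bar>x\<bar> * \<eta>))))
       = norm (cnj (integral {-a..b} f - of_real (2 * pi * exp (- (\<bar>x\<bar> * \<eta>)))))" by simp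
    also have "\<dots> = norm (integral {-a..b} f - of_real (2 * pi * exp (- (\<bar>x\<bar> * \<eta>))))" by (rule complex_mod_cnj)
    finally show ?thesis using pos[of "-x"] False x unfolding f_def by simp
  qed
qed

section \<open>The kernel as a Laplace transform\<close>

lemma whitham_symbol_even: "whitham_symbol (- \<xi>) = whitham_symbol \<xi>"
  by (simp add: whitham_symbol_def)

lemma whitham_symbol_nonneg: "0 \<le> whitham_symbol \<xi>"
  by (cases "\<xi> > 0") (auto simp: whitham_symbol_def divide_nonpos_nonpos)

lemma whitham_symbol_measurable [measurable]: "whitham_symbol \<in> borel_measurable borel"
  unfolding whitham_symbol_def[abs_def] tanh_def sinh_def cosh_def by measurable

lemma whitham_symbol_le:
  assumes "0 < \<xi>" shows "whitham_symbol \<xi> \<le> \<xi> powr (-1/2)"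
proof -
  have "whitham_symbol \<xi> \<le> sqrt (1 / \<xi>)"
    using assms tanh_real_lt_1[of \<xi>] by (auto simp: whitham_symbol_def intro!: real_sqrt_le_mono divide_right_mono)
  also have "\<dots> = \<xi> powr (-1/2)"
    using powr_minus_divide[of \<xi> "1/2"] powr_half_sqrt[of \<xi>] assms by (simp add: real_sqrt_divide)
  finally show ?thesis .
qed

lemma whitham_symbol_tendsto_1: "(\<lambda>k. whitham_symbol (inverse (real (Suc k)))) \<longlonglongrightarrow> 1"
proof -
  have "((tanh :: real \<Rightarrow> real) has_field_derivative 1) (at 0)"
    by (auto intro!: derivative_eq_intros)
  then have "((\<lambda>h. (tanh (0 + h) - tanh 0) / h) \<longlongrightarrow> 1) (at (0::real))"
    unfolding DERIV_def .
  then have "((\<lambda>h::real. tanh h / h) \<longlongrightarrow> 1) (at 0)" by simp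
  then have "(\<lambda>k. tanh (inverse (real (Suc k))) / inverse (real (Suc k))) \<longlonglongrightarrow> 1"
    using LIMSEQ_inverse_real_of_nat unfolding tendsto_at_iff_sequentially comp_def by fastforce
  then have "(\<lambda>k. sqrt (tanh (inverse (real (Suc k))) / inverse (real (Suc k)))) \<longlonglongrightarrow> sqrt 1"
    by (rule tendsto_real_sqrt)
  then show ?thesis by (simp add: whitham_symbol_def)
qed

text \<open>At frequency 0 the pole \<i> \<xi> would fall on the contour, so this case comes from
  monotone convergence as the frequency decreases to 0.\<close>

lemma whitham_symbol_spectral_0:
  "has_bochner_integral lborel (\<lambda>\<eta>. whitham_density \<eta> * (2 / \<eta>)) pi"
proof (rule has_bochner_integral_monotone_convergence)
  define e where "e k = inverse (real (Suc k))" for k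
  have e: "0 < e k" "e (Suc k) \<le> e k" for k by (auto simp: e_def field_simps)
  define f where "f k \<eta> = whitham_density \<eta> * (2 * \<eta> / (\<eta>\<^sup>2 + (e k)\<^sup>2))" for k \<eta>
  note sp = whitham_symbol_spectral[OF e(1), folded f_def]
  show "integrable lborel (f k)" for k using sp[of k] by (simp add: has_bochner_integral_iff)
  have "(\<lambda>k. pi * whitham_symbol (e k)) \<longlonglongrightarrow> pi * 1"
    unfolding e_def by (intro tendsto_intros whitham_symbol_tendsto_1)
  then show "(\<lambda>k. integral\<^sup>L lborel (f k)) \<longlonglongrightarrow> pi"
    using sp by (simp add: has_bochner_integral_iff)
  have "f k \<eta> \<le> f (Suc k) \<eta>" for k \<eta>
  proof (cases "\<eta> > 0")
    case True
    have "(e (Suc k))\<^sup>2 \<le> (e k)\<^sup>2" using e[of k] e[of "Suc k"] by (intro power_mono) auto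
    then show ?thesis unfolding f_def using True e[of "Suc k"]
      by (intro mult_left_mono divide_left_mono) (auto intro!: mult_pos_pos add_pos_nonneg)
  qed (simp add: f_def whitham_density_def)
  then show "AE \<eta> in lborel. mono (\<lambda>k. f k \<eta>)"
    by (intro AE_I2 incseq_SucI)
  show "AE \<eta> in lborel. (\<lambda>k. f k \<eta>) \<longlonglongrightarrow> whitham_density \<eta> * (2 / \<eta>)"
  proof (intro AE_I2)
    fix \<eta>
    show "(\<lambda>k. f k \<eta>) \<longlonglongrightarrow> whitham_density \<eta> * (2 / \<eta>)"
    proof (cases "\<eta> > 0")
      case True
      have "e \<longlonglongrightarrow> 0" unfolding e_def by (rule LIMSEQ_inverse_real_of_nat)
      then have "(\<lambda>k. f k \<eta>) \<longlonglongrightarrow> whitham_density \<eta> * (2 * \<eta> / (\<eta>\<^sup>2 + 0\<^sup>2))"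
        unfolding f_def using True by (intro tendsto_intros) auto
      then show ?thesis using True by (simp add: power2_eq_square)
    qed (simp add: f_def whitham_density_def)
  qed
qed measurable

lemma whitham_symbol_spectral_all:
  "has_bochner_integral lborel (\<lambda>\<eta>. whitham_density \<eta> * (2 * \<eta> / (\<eta>\<^sup>2 + \<xi>\<^sup>2))) (pi * whitham_symbol \<xi>)"
proof (cases "\<xi> = 0")
  case True
  have "(\<lambda>\<eta>. whitham_density \<eta> * (2 * \<eta> / (\<eta>\<^sup>2 + \<xi>\<^sup>2))) = (\<lambda>\<eta>. whitham_density \<eta> * (2 / \<eta>))"
    using True by (auto simp: power2_eq_square)
  then show ?thesis using whitham_symbol_spectral_0 True by (simp add: whitham_symbol_def)
next
  case False
  have "whitham_symbol \<bar>\<xi>\<bar> = whitham_symbol \<xi>" by (auto simp: abs_if whitham_symbol_even)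
  then show ?thesis using whitham_symbol_spectral[of "\<bar>\<xi>\<bar>"] False by simp
qed

lemma whitham_symbol_le_1: "whitham_symbol \<xi> \<le> 1"
proof -
  have "(LINT \<eta>|lborel. whitham_density \<eta> * (2 * \<eta> / (\<eta>\<^sup>2 + \<xi>\<^sup>2))) \<le> (LINT \<eta>|lborel. whitham_density \<eta> * (2 / \<eta>))"
  proof (rule integral_mono)
    show "integrable lborel (\<lambda>\<eta>. whitham_density \<eta> * (2 * \<eta> / (\<eta>\<^sup>2 + \<xi>\<^sup>2)))" "integrable lborel (\<lambda>\<eta>. whitham_density \<eta> * (2 / \<eta>))"
      using whitham_symbol_spectral_all[of \<xi>] whitham_symbol_spectral_0 by (simp_all add: has_bochner_integral_iff)
    fix \<eta> show "whitham_density \<eta> * (2 * \<eta> / (\<eta>\<^sup>2 + \<xi>\<^sup>2)) \<le> whitham_density \<eta> * (2 / \<eta>)"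
    proof (cases "\<eta> > 0")
      case True
      have "2 * \<eta> / (\<eta>\<^sup>2 + \<xi>\<^sup>2) \<le> 2 * \<eta> / \<eta>\<^sup>2"
        using True by (intro divide_left_mono) (auto intro!: mult_pos_pos add_pos_nonneg)
      then show ?thesis using True by (intro mult_left_mono) (auto simp: power2_eq_square)
    qed (simp add: whitham_density_def)
  qed
  then show ?thesis
    using whitham_symbol_spectral_all[of \<xi>] whitham_symbol_spectral_0 by (simp add: has_bochner_integral_iff)
qed

section \<open>The inverse Fourier integral of the symbol\<close>

lemma exp_gt_self: "u < exp (u::real)"
  using exp_ge_add_one_self[of u] by linarith

lemma exp_minus_le: "u > 0 \<Longrightarrow> exp (- u) \<le> 1 / (u::real)"
  using exp_gt_self[of u] by (simp add: exp_minus field_simps)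

lemma exp_density_integrable:
  assumes "x > 0"
  shows "integrable lborel (\<lambda>\<eta>. whitham_density \<eta> * exp (- (x * \<eta>)))"
    "(LINT \<eta>|lborel. whitham_density \<eta> * exp (- (x * \<eta>))) \<le> pi / x"
proof -
  have i: "integrable lborel (\<lambda>\<eta>. whitham_density \<eta> * (2 / \<eta>) * (1 / x))"
    using whitham_symbol_spectral_0 by (intro integrable_mult_left) (simp add: has_bochner_integral_iff)
  have b: "whitham_density \<eta> * exp (- (x * \<eta>)) \<le> whitham_density \<eta> * (2 / \<eta>) * (1 / x)" for \<eta>
  proof (cases "\<eta> > 0")
    case True
    have "exp (- (x * \<eta>)) \<le> 1 / (x * \<eta>)" using True assms by (intro exp_minus_le) simp
    also have "\<dots> \<le> 2 / (x * \<eta>)" using True assms by (intro divide_right_mono) auto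
    finally have "whitham_density \<eta> * exp (- (x * \<eta>)) \<le> whitham_density \<eta> * (2 / (x * \<eta>))" by (intro mult_left_mono) auto
    then show ?thesis by (simp add: mult_ac)
  qed (simp add: whitham_density_def)
  show j: "integrable lborel (\<lambda>\<eta>. whitham_density \<eta> * exp (- (x * \<eta>)))"
  proof (rule Bochner_Integration.integrable_bound[OF i])
    show "AE \<eta> in lborel. norm (whitham_density \<eta> * exp (- (x * \<eta>))) \<le> norm (whitham_density \<eta> * (2 / \<eta>) * (1 / x))"
    proof (rule AE_I2)
      fix \<eta>
      have "norm (whitham_density \<eta> * exp (- (x * \<eta>))) = whitham_density \<eta> * exp (- (x * \<eta>))" by simp
      also note b
      also have "whitham_density \<eta> * (2 / \<eta>) * (1 / x) \<le> norm (whitham_density \<eta> * (2 / \<eta>) * (1 / x))"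
        unfolding real_norm_def by (rule abs_ge_self)
      finally show "norm (whitham_density \<eta> * exp (- (x * \<eta>))) \<le> norm (whitham_density \<eta> * (2 / \<eta>) * (1 / x))" .
    qed
  qed measurable
  have "(LINT \<eta>|lborel. whitham_density \<eta> * exp (- (x * \<eta>))) \<le> (LINT \<eta>|lborel. whitham_density \<eta> * (2 / \<eta>) * (1 / x))"
    by (intro integral_mono i j b)
  also have "\<dots> = (LINT \<eta>|lborel. whitham_density \<eta> * (2 / \<eta>)) * (1 / x)"
    by (rule integral_mult_left_zero)
  also have "\<dots> = pi / x"
    using has_bochner_integral_integral_eq[OF whitham_symbol_spectral_0] by simp
  finally show "(LINT \<eta>|lborel. whitham_density \<eta> * exp (- (x * \<eta>))) \<le> pi / x" .
qed

text \<open>On a finite window Fubini applies, as the symbol is at most 1. Each Lorentzian has a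
  transform exp (- \<eta> |x|) up to an error governed by the ends of the window, and by the
  spectral formula those errors add up to the symbol at a and b.\<close>

lemma fourier_symbol_approx:
  fixes x a b :: real
  assumes x: "x \<noteq> 0" and ab: "0 < a" "0 < b"
  defines "M \<equiv> (\<lambda>\<xi>. of_real (whitham_symbol \<xi>) * exp (\<i> * of_real x * of_real \<xi>))"
  shows "M integrable_on {-a..b}"
    and "norm (integral {-a..b} M - of_real (2 * (LINT \<eta>|lborel. whitham_density \<eta> * exp (- (\<bar>x\<bar> * \<eta>)))))
       \<le> 2 / \<bar>x\<bar> * (whitham_symbol a + whitham_symbol b)"
proof -
  define \<rho> where "\<rho> \<eta> \<xi> = 2 * \<eta> / (\<eta>\<^sup>2 + \<xi>\<^sup>2)" for \<eta> \<xi> :: real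
  define E where "E \<xi> = exp (\<i> * complex_of_real x * complex_of_real \<xi>)" for \<xi>
  define w where "w = whitham_density"
  have nE: "norm (E \<xi>) = 1" for \<xi> by (simp add: E_def norm_exp_eq_Re)
  have cE: "continuous_on A E" for A unfolding E_def by (intro continuous_intros)
  have mE [measurable]: "E \<in> borel_measurable borel" using cE by (intro borel_measurable_continuous_onI)
  have mw [measurable]: "w \<in> borel_measurable borel" by (simp add: w_def)
  define f where "f \<xi> \<eta> = indicator {-a..b} \<xi> *\<^sub>R (of_real (w \<eta> * \<rho> \<eta> \<xi>) * E \<xi>)" for \<xi> \<eta>
  have sp: "has_bochner_integral lborel (\<lambda>\<eta>. w \<eta> * \<rho> \<eta> \<xi>) (pi * whitham_symbol \<xi>)" for \<xi>
    unfolding w_def \<rho>_def by (rule whitham_symbol_spectral_all)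
  have w\<rho>: "0 \<le> w \<eta> * \<rho> \<eta> \<xi>" for \<eta> \<xi>
    by (cases "\<eta> > 0") (auto simp: w_def \<rho>_def whitham_density_def)
  have bm: "set_integrable lborel {-a..b} (\<lambda>\<xi>. whitham_symbol \<xi>)"
    unfolding set_integrable_def
    by (rule integrableI_bounded_set_indicator[where B = 1]) (use ab in \<open>auto simp: whitham_symbol_nonneg whitham_symbol_le_1 emeasure_lborel_Icc_eq\<close>)
  have f_meas [measurable]: "case_prod f \<in> borel_measurable (lborel \<Otimes>\<^sub>M lborel)"
    unfolding f_def \<rho>_def by measurable
  have inner: "(\<integral>\<eta>. f \<xi> \<eta> \<partial>lborel) = indicator {-a..b} \<xi> *\<^sub>R (of_real (pi * whitham_symbol \<xi>) * E \<xi>)" "integrable lborel (f \<xi>)" for \<xi>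
  proof -
    have "has_bochner_integral lborel (f \<xi>) (indicator {-a..b} \<xi> *\<^sub>R (of_real (pi * whitham_symbol \<xi>) * E \<xi>))"
      unfolding f_def by (intro has_bochner_integral_scaleR_right has_bochner_integral_mult_left has_bochner_integral_of_real sp)
    then show "(\<integral>\<eta>. f \<xi> \<eta> \<partial>lborel) = indicator {-a..b} \<xi> *\<^sub>R (of_real (pi * whitham_symbol \<xi>) * E \<xi>)" "integrable lborel (f \<xi>)"
      by (simp_all add: has_bochner_integral_iff)
  qed
  have nf: "(\<integral>\<eta>. norm (f \<xi> \<eta>) \<partial>lborel) = indicator {-a..b} \<xi> *\<^sub>R whitham_symbol \<xi> * pi" for \<xi>
  proof -
    have "norm (f \<xi> \<eta>) = indicator {-a..b} \<xi> * (w \<eta> * \<rho> \<eta> \<xi>)" for \<eta>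
      unfolding f_def norm_scaleR norm_mult[of _ "E \<xi>"] nE norm_of_real using abs_of_nonneg[OF w\<rho>[of \<eta> \<xi>]] by simp
    then show ?thesis using has_bochner_integral_integral_eq[OF sp[of \<xi>]] by (simp del: mult.assoc)
  qed
  have pair: "integrable (lborel \<Otimes>\<^sub>M lborel) (case_prod f)"
  proof (rule lborel_pair.Fubini_integrable[OF f_meas])
    show "integrable lborel (\<lambda>\<xi>. \<integral>\<eta>. norm (case_prod f (\<xi>, \<eta>)) \<partial>lborel)"
      using bm unfolding prod.case nf set_integrable_def by (intro integrable_mult_left)
    show "AE \<xi> in lborel. integrable lborel (\<lambda>\<eta>. case_prod f (\<xi>, \<eta>))" using inner(2) by simp
  qed
  have fub: "(\<integral>\<eta>. (\<integral>\<xi>. f \<xi> \<eta> \<partial>lborel) \<partial>lborel) = (\<integral>\<xi>. (\<integral>\<eta>. f \<xi> \<eta> \<partial>lborel) \<partial>lborel)"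
    by (rule lborel_pair.Fubini_integral[OF pair])
  have sM: "set_integrable lborel {-a..b} M"
  proof (rule set_integrable_bound[OF bm])
    show "set_borel_measurable lborel {- a..b} M" unfolding M_def set_borel_measurable_def by measurable
    show "AE x in lborel. x \<in> {- a..b} \<longrightarrow> cmod (M x) \<le> norm (whitham_symbol x)"
      unfolding M_def by (auto simp: norm_mult norm_exp_eq_Re)
  qed
  show "M integrable_on {-a..b}" by (rule set_borel_integral_eq_integral[OF sM])
  have r: "(\<integral>\<xi>. (\<integral>\<eta>. f \<xi> \<eta> \<partial>lborel) \<partial>lborel) = of_real pi * integral {-a..b} M"
    unfolding inner set_borel_integral_eq_integral(2)[OF sM, symmetric] set_lebesgue_integral_def
    unfolding integral_mult_right_zero[symmetric]
    by (intro Bochner_Integration.integral_cong) (auto simp: M_def E_def scaleR_conv_of_real)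
  define L where "L \<eta> = integral {-a..b} (\<lambda>\<xi>. of_real (\<rho> \<eta> \<xi>) * E \<xi>)" for \<eta>
  have l: "(\<integral>\<xi>. f \<xi> \<eta> \<partial>lborel) = of_real (w \<eta>) * L \<eta>" for \<eta>
  proof (cases "\<eta> > 0")
    case True
    have den: "\<eta>\<^sup>2 + \<xi>\<^sup>2 \<noteq> 0" for \<xi> using True by (metis add_nonneg_eq_0_iff less_irrefl power_eq_0_iff zero_le_power2)
    have "set_integrable lborel {-a..b} (\<lambda>\<xi>. of_real (\<rho> \<eta> \<xi>) * E \<xi>)"
      unfolding \<rho>_def using den by (intro borel_integrable_atLeastAtMost' continuous_intros cE) auto
    from set_borel_integral_eq_integral(2)[OF this]
    have "L \<eta> = (\<integral>\<xi>. indicator {-a..b} \<xi> *\<^sub>R (of_real (\<rho> \<eta> \<xi>) * E \<xi>) \<partial>lborel)"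
      unfolding L_def set_lebesgue_integral_def by simp
    then have "of_real (w \<eta>) * L \<eta> = (\<integral>\<xi>. of_real (w \<eta>) * (indicator {-a..b} \<xi> *\<^sub>R (of_real (\<rho> \<eta> \<xi>) * E \<xi>)) \<partial>lborel)"
      by (simp only: integral_mult_right_zero)
    also have "\<dots> = (\<integral>\<xi>. f \<xi> \<eta> \<partial>lborel)"
      unfolding f_def by (intro Bochner_Integration.integral_cong) (auto simp: scaleR_conv_of_real mult_ac)
    finally show ?thesis by simp
  qed (simp add: f_def w_def whitham_density_def)
  have wL: "integrable lborel (\<lambda>\<eta>. of_real (w \<eta>) * L \<eta>)"
    using lborel_pair.integrable_snd[OF pair] unfolding l[symmetric] by simp
  have we: "integrable lborel (\<lambda>\<eta>. w \<eta> * exp (- (\<bar>x\<bar> * \<eta>)))"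
    unfolding w_def using x by (intro exp_density_integrable) auto
  then have we': "integrable lborel (\<lambda>\<eta>. of_real (w \<eta>) * of_real (2 * pi * exp (- (\<bar>x\<bar> * \<eta>))) :: complex)"
  proof -
    have "integrable lborel (\<lambda>\<eta>. complex_of_real ((2 * pi) * (w \<eta> * exp (- (\<bar>x\<bar> * \<eta>)))))"
      by (intro integrable_of_real integrable_mult_right we)
    then show ?thesis by (simp add: mult_ac)
  qed
  have "of_real pi * integral {-a..b} M - of_real pi * of_real (2 * (LINT \<eta>|lborel. w \<eta> * exp (- (\<bar>x\<bar> * \<eta>))))
      = (\<integral>\<eta>. of_real (w \<eta>) * L \<eta> \<partial>lborel) - (\<integral>\<eta>. of_real (w \<eta>) * of_real (2 * pi * exp (- (\<bar>x\<bar> * \<eta>))) \<partial>lborel)"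
  proof -
    have "(\<integral>\<eta>. of_real (w \<eta>) * of_real (2 * pi * exp (- (\<bar>x\<bar> * \<eta>))) \<partial>lborel) = (\<integral>\<eta>. complex_of_real ((2 * pi) * (w \<eta> * exp (- (\<bar>x\<bar> * \<eta>)))) \<partial>lborel)"
      by (intro Bochner_Integration.integral_cong) auto
    also have "\<dots> = of_real (2 * pi * (LINT \<eta>|lborel. w \<eta> * exp (- (\<bar>x\<bar> * \<eta>))))"
      unfolding integral_complex_of_real integral_mult_right_zero ..
    finally show ?thesis using fub unfolding l r by (simp add: mult_ac)
  qed
  also have "\<dots> = (\<integral>\<eta>. of_real (w \<eta>) * L \<eta> - of_real (w \<eta>) * of_real (2 * pi * exp (- (\<bar>x\<bar> * \<eta>))) \<partial>lborel)"
    by (rule Bochner_Integration.integral_diff[symmetric, OF wL we'])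
  also have "norm \<dots> \<le> (\<integral>\<eta>. 2 / \<bar>x\<bar> * (w \<eta> * \<rho> \<eta> a + w \<eta> * \<rho> \<eta> b) \<partial>lborel)"
  proof (rule Bochner_Integration.integral_norm_bound_integral)
    show "integrable lborel (\<lambda>\<eta>. of_real (w \<eta>) * L \<eta> - of_real (w \<eta>) * of_real (2 * pi * exp (- (\<bar>x\<bar> * \<eta>))))"
      by (rule Bochner_Integration.integrable_diff[OF wL we'])
    show "integrable lborel (\<lambda>\<eta>. 2 / \<bar>x\<bar> * (w \<eta> * \<rho> \<eta> a + w \<eta> * \<rho> \<eta> b))"
      using sp[of a] sp[of b] by (intro integrable_mult_right Bochner_Integration.integrable_add) (auto simp: has_bochner_integral_iff)
    fix \<eta>
    show "norm (of_real (w \<eta>) * L \<eta> - of_real (w \<eta>) * of_real (2 * pi * exp (- (\<bar>x\<bar> * \<eta>)))) \<le> 2 / \<bar>x\<bar> * (w \<eta> * \<rho> \<eta> a + w \<eta> * \<rho> \<eta> b)"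
    proof (cases "\<eta> > 0")
      case True
      have "norm (L \<eta> - of_real (2 * pi * exp (- (\<bar>x\<bar> * \<eta>)))) \<le> 2 / \<bar>x\<bar> * (\<rho> \<eta> a + \<rho> \<eta> b)"
        unfolding L_def \<rho>_def E_def by (rule lorentzian_fourier_approx[OF x ab True])
      then have "w \<eta> * norm (L \<eta> - of_real (2 * pi * exp (- (\<bar>x\<bar> * \<eta>)))) \<le> w \<eta> * (2 / \<bar>x\<bar> * (\<rho> \<eta> a + \<rho> \<eta> b))"
        by (intro mult_left_mono) (auto simp: w_def)
      moreover have "norm (of_real (w \<eta>) * L \<eta> - of_real (w \<eta>) * of_real (2 * pi * exp (- (\<bar>x\<bar> * \<eta>)))) = w \<eta> * norm (L \<eta> - of_real (2 * pi * exp (- (\<bar>x\<bar> * \<eta>))))"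
        unfolding right_diff_distrib[symmetric] norm_mult by (simp add: w_def)
      ultimately show ?thesis by (simp add: algebra_simps)
    qed (simp add: w_def whitham_density_def)
  qed
  also have "\<dots> = 2 / \<bar>x\<bar> * (pi * whitham_symbol a + pi * whitham_symbol b)"
    using sp[of a] sp[of b] by (simp add: has_bochner_integral_iff)
  finally have "norm (of_real pi * (integral {-a..b} M - of_real (2 * (LINT \<eta>|lborel. w \<eta> * exp (- (\<bar>x\<bar> * \<eta>))))))
     \<le> pi * (2 / \<bar>x\<bar> * (whitham_symbol a + whitham_symbol b))"
    unfolding right_diff_distrib[symmetric] by (simp add: algebra_simps add_divide_distrib)
  then show "norm (integral {-a..b} M - of_real (2 * (LINT \<eta>|lborel. whitham_density \<eta> * exp (- (\<bar>x\<bar> * \<eta>)))))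
       \<le> 2 / \<bar>x\<bar> * (whitham_symbol a + whitham_symbol b)"
    unfolding w_def by (simp only: norm_mult norm_of_real abs_of_pos[OF pi_gt_zero] mult_le_cancel_left_pos[OF pi_gt_zero])
qed

lemma whitham_kernel_eq:
  assumes x: "x \<noteq> 0"
  shows "whitham_kernel x = (LINT \<eta>|lborel. whitham_density \<eta> * exp (- (\<bar>x\<bar> * \<eta>))) / pi"
proof -
  define J where "J = (LINT \<eta>|lborel. whitham_density \<eta> * exp (- (\<bar>x\<bar> * \<eta>)))"
  define M where "M = (\<lambda>\<xi>. of_real (whitham_symbol \<xi>) * exp (\<i> * complex_of_real x * complex_of_real \<xi>))"
  note ap = fourier_symbol_approx[OF x, folded M_def J_def]
  have "(M has_integral of_real (2 * J)) UNIV"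
    unfolding has_integral_alt'[of M] 
  proof (intro conjI allI impI)
    fix a b :: real
    have "M integrable_on {- (\<bar>a\<bar> + 1)..\<bar>b\<bar> + 1}" by (intro ap) auto
    then have "M integrable_on {a..b}" by (rule integrable_subinterval_real) auto
    then show "(\<lambda>x. if x \<in> UNIV then M x else 0) integrable_on cbox a b" by simp
  next
    fix e :: real assume e: "0 < e"
    \<comment> \<open>Chosen so that the symbol, at most B^(-1/2) beyond B, makes the error 4 / (|x|
      sqrt B) smaller than e.\<close>
    define B where "B = (4 / (\<bar>x\<bar> * e))\<^sup>2 + 1"
    have B: "B > 0" by (simp add: B_def add_nonneg_pos)
    have "4 / (\<bar>x\<bar> * e) < sqrt B" by (rule real_less_rsqrt) (simp add: B_def)
    then have Be: "4 / \<bar>x\<bar> * (1 / sqrt B) < e" using e x B by (simp add: field_simps)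
    show "\<exists>B>0. \<forall>a b. ball 0 B \<subseteq> cbox a b \<longrightarrow> norm (integral (cbox a b) (\<lambda>x. if x \<in> UNIV then M x else 0) - of_real (2 * J)) < e"
    proof (intro exI[of _ B] conjI allI impI)
      fix a b :: real assume "ball 0 B \<subseteq> cbox a b"
      \<comment> \<open>The endpoints -B and B are not in the open ball, but the interval is closed
        and so contains its closure.\<close>
      then have "closure (ball 0 B) \<subseteq> cbox a b" by (intro closure_minimal) auto
      then have "cball 0 B \<subseteq> {a..b}" using B by (simp add: closure_ball)
      moreover have "-B \<in> cball 0 B" "B \<in> cball 0 B" using B by auto
      ultimately have "-B \<in> {a..b}" "B \<in> {a..b}" by blast+
      then have ab: "a \<le> -B" "B \<le> b" by auto
      have m: "whitham_symbol c \<le> 1 / sqrt B" if "B \<le> c" for c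
      proof -
        have "whitham_symbol c \<le> c powr (-1/2)" using that B by (intro whitham_symbol_le) auto
        also have "\<dots> \<le> B powr (-1/2)" using that B by (intro powr_mono2') auto
        also have "\<dots> = 1 / sqrt B" using powr_minus_divide[of B "1/2"] powr_half_sqrt[of B] B by simp
        finally show ?thesis .
      qed
      have "norm (integral {-(-a)..b} M - of_real (2 * J)) \<le> 2 / \<bar>x\<bar> * (whitham_symbol (-a) + whitham_symbol b)"
        using ab B by (intro ap) auto
      also have "\<dots> \<le> 2 / \<bar>x\<bar> * (1 / sqrt B + 1 / sqrt B)"
        using ab by (intro mult_left_mono add_mono m) auto
      also have "\<dots> < e" using Be by simp
      finally show "norm (integral (cbox a b) (\<lambda>x. if x \<in> UNIV then M x else 0) - of_real (2 * J)) < e" by simp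
    qed (rule B)
  qed
  then have "whitham_kernel x = Re (1 / (2 * of_real pi) * of_real (2 * J))"
    unfolding whitham_kernel_def M_def by (simp add: integral_unique)
  also have "\<dots> = J / pi" by (simp add: Re_divide_of_real complex_eq_iff)
  finally show ?thesis by (simp add: J_def)
qed

section \<open>Positivity, monotonicity and convexity of the kernel\<close>

lemma whitham_kernel_even: "whitham_kernel (- x) = whitham_kernel x"
  by (cases "x = 0") (simp_all add: whitham_kernel_eq)

lemma whitham_kernel_abs: "whitham_kernel \<bar>x\<bar> = whitham_kernel x"
  by (simp add: abs_if whitham_kernel_even)

lemma whitham_kernel_measurable [measurable]: "whitham_kernel \<in> borel_measurable borel"
proof -
  have "whitham_kernel = (\<lambda>x. if x = 0 then whitham_kernel 0 else (LINT \<eta>|lborel. whitham_density \<eta> * exp (- (\<bar>x\<bar> * \<eta>))) / pi)"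
    by (auto simp: whitham_kernel_eq)
  moreover have "\<dots> \<in> borel_measurable borel" by measurable
  ultimately show ?thesis by simp
qed

text \<open>The density is strictly positive wherever the tangent is negative on the positive axis;
  the interval from pi/2 to pi already has positive measure.\<close>

lemma density_integral_pos:
  assumes int: "integrable lborel (\<lambda>\<eta>. whitham_density \<eta> * g \<eta>)" and g: "\<And>\<eta>. \<eta> > 0 \<Longrightarrow> g \<eta> > 0"
  shows "(LINT \<eta>|lborel. whitham_density \<eta> * g \<eta>) > 0"
proof -
  have nn: "0 \<le> whitham_density \<eta> * g \<eta>" for \<eta>
    using g[of \<eta>] by (cases "\<eta> > 0") (auto simp: whitham_density_def)
  then have "0 \<le> (LINT \<eta>|lborel. whitham_density \<eta> * g \<eta>)" by simp
  moreover have "(LINT \<eta>|lborel. whitham_density \<eta> * g \<eta>) \<noteq> 0"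
  proof
    assume "(LINT \<eta>|lborel. whitham_density \<eta> * g \<eta>) = 0"
    then have ae: "AE \<eta> in lborel. whitham_density \<eta> * g \<eta> = 0"
      using integral_nonneg_eq_0_iff_AE[OF int] nn by simp
    have ne: "whitham_density \<eta> * g \<eta> \<noteq> 0" if "\<eta> \<in> {pi/2<..<pi}" for \<eta>
    proof -
      have "\<eta> > 0" using that pi_gt_zero by (auto intro: less_trans[of 0 "pi/2"])
      moreover have "sin \<eta> > 0" using that \<open>\<eta> > 0\<close> by (intro sin_gt_zero) auto
      moreover have "cos \<eta> < 0" using that cos_monotone_0_pi[of "pi/2" \<eta>] by simp
      ultimately have "sin \<eta> / (cos \<eta> * \<eta>) < 0" by (intro divide_pos_neg mult_neg_pos)
      then show ?thesis using g[of \<eta>] \<open>\<eta> > 0\<close> by (auto simp: whitham_density_def tan_def max_def)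
    qed
    have "AE \<eta> in lborel. \<eta> \<notin> {pi/2<..<pi}"
      using ae by (rule AE_mp) (use ne in \<open>auto intro!: AE_I2\<close>)
    then have "{pi/2<..<pi} \<in> null_sets lborel" by (subst AE_iff_null_sets) auto
    then show False by (simp add: null_sets_def emeasure_lborel_Ioo)
  qed
  ultimately show ?thesis by simp
qed

lemma whitham_kernel_pos: "x \<noteq> 0 \<Longrightarrow> whitham_kernel x > 0"
  using density_integral_pos[OF exp_density_integrable(1)[of "\<bar>x\<bar>"]] by (simp add: whitham_kernel_eq)

lemma whitham_kernel_diff:
  assumes "0 < x" "0 < y"
  shows "integrable lborel (\<lambda>\<eta>. whitham_density \<eta> * (exp (- (x * \<eta>)) - exp (- (y * \<eta>))))"
    "whitham_kernel x - whitham_kernel y = (LINT \<eta>|lborel. whitham_density \<eta> * (exp (- (x * \<eta>)) - exp (- (y * \<eta>)))) / pi"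
  using assms exp_density_integrable(1)[of x] exp_density_integrable(1)[of y]
  by (simp_all add: whitham_kernel_eq right_diff_distrib diff_divide_distrib)

lemma whitham_kernel_strict_decreasing:
  assumes "0 < x" "x < y" shows "whitham_kernel y < whitham_kernel x"
proof -
  have "0 < whitham_kernel x - whitham_kernel y"
    using density_integral_pos[OF whitham_kernel_diff(1)[of x y]] assms
    by (subst whitham_kernel_diff(2)) (auto intro!: divide_pos_pos)
  then show ?thesis by simp
qed

lemma whitham_kernel_decreasing:
  "0 < x \<Longrightarrow> x \<le> y \<Longrightarrow> whitham_kernel y \<le> whitham_kernel x"
  using whitham_kernel_strict_decreasing[of x y] by (cases "x = y") auto

text \<open>Convexity is phrased as a comparison of two drops over the same length, the form in
  which values of the periodised kernel are paired. The drop of a single exponential from c to c + t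
  is exp (- c \<eta>) (1 - exp (- t \<eta>)), which decreases in c.\<close>

lemma whitham_kernel_convex:
  assumes "0 < a" "a \<le> b" "0 \<le> t"
  shows "whitham_kernel b - whitham_kernel (b + t) \<le> whitham_kernel a - whitham_kernel (a + t)"
proof -
  have "(LINT \<eta>|lborel. whitham_density \<eta> * (exp (- (b * \<eta>)) - exp (- ((b+t) * \<eta>))))
     \<le> (LINT \<eta>|lborel. whitham_density \<eta> * (exp (- (a * \<eta>)) - exp (- ((a+t) * \<eta>))))"
  proof (intro integral_mono whitham_kernel_diff)
    fix \<eta>
    show "whitham_density \<eta> * (exp (- (b * \<eta>)) - exp (- ((b+t) * \<eta>))) \<le> whitham_density \<eta> * (exp (- (a * \<eta>)) - exp (- ((a+t) * \<eta>)))"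
    proof (cases "\<eta> > 0")
      case True
      have "exp (- (c * \<eta>)) - exp (- ((c+t) * \<eta>)) = exp (- (c * \<eta>)) * (1 - exp (- (t * \<eta>)))" for c
        by (simp add: algebra_simps flip: exp_add)
      moreover have "exp (- (b * \<eta>)) * (1 - exp (- (t * \<eta>))) \<le> exp (- (a * \<eta>)) * (1 - exp (- (t * \<eta>)))"
        using True assms by (intro mult_right_mono) auto
      ultimately show ?thesis by (intro mult_left_mono) auto
    qed (simp add: whitham_density_def)
  qed (use assms in auto)
  then show ?thesis using assms by (simp add: whitham_kernel_diff divide_right_mono)
qed

section \<open>Derivative, size and total mass of the kernel\<close>

lemma moment_density_integrable:
  assumes "x > 0"
  shows "integrable lborel (\<lambda>\<eta>. whitham_density \<eta> * (\<eta> * exp (- (x * \<eta>))))"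
    "(LINT \<eta>|lborel. whitham_density \<eta> * (\<eta> * exp (- (x * \<eta>)))) \<le> pi * x powr (-3/2)"
proof -
  \<comment> \<open>Since exp u >= (1 + u^2) / 2 for u = x \<eta>, the integrand is dominated by the
    Lorentzian at the frequency 1/x, divided by x^2. Its integral is pi times the symbol at 1/x over
    x^2, hence at most pi x^(-3/2).\<close>
  define g where "g = (\<lambda>\<eta>. (1 / x\<^sup>2) * (whitham_density \<eta> * (2 * \<eta> / (\<eta>\<^sup>2 + (1/x)\<^sup>2))))"
  have gi: "has_bochner_integral lborel g ((1 / x\<^sup>2) * (pi * whitham_symbol (1/x)))"
    unfolding g_def by (intro has_bochner_integral_mult_right whitham_symbol_spectral_all)
  have b: "whitham_density \<eta> * (\<eta> * exp (- (x * \<eta>))) \<le> g \<eta>" for \<eta>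
  proof (cases "\<eta> > 0")
    case True
    define u where "u = x * \<eta>"
    have u: "u > 0" using True assms by (simp add: u_def)
    have "1 + u + u\<^sup>2 / 2 \<le> exp u" using exp_lower_Taylor_quadratic[of u] u by simp
    then have "(1 + u\<^sup>2) / 2 \<le> exp u" using u unfolding add_divide_distrib by linarith
    then have "exp (- u) \<le> 2 / (1 + u\<^sup>2)" using u by (simp add: exp_minus field_simps add_pos_pos)
    then have "\<eta> * exp (- u) \<le> \<eta> * (2 / (1 + u\<^sup>2))" using True by (intro mult_left_mono) auto
    also have "\<dots> = (1 / x\<^sup>2) * (2 * \<eta> / (\<eta>\<^sup>2 + (1/x)\<^sup>2))"
    proof -
      have "x\<^sup>2 * (\<eta>\<^sup>2 + (1/x)\<^sup>2) = 1 + u\<^sup>2"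
        using assms by (simp add: u_def power_mult_distrib power_divide distrib_left)
      then show ?thesis by (simp add: mult.commute)
    qed
    finally have "whitham_density \<eta> * (\<eta> * exp (- u)) \<le> whitham_density \<eta> * ((1 / x\<^sup>2) * (2 * \<eta> / (\<eta>\<^sup>2 + (1/x)\<^sup>2)))"
      by (intro mult_left_mono) auto
    then show ?thesis by (simp add: u_def g_def mult_ac)
  qed (simp add: g_def whitham_density_def)
  have nn: "0 \<le> whitham_density \<eta> * (\<eta> * exp (- (x * \<eta>)))" for \<eta>
    by (cases "\<eta> > 0") (auto simp: whitham_density_def)
  show i: "integrable lborel (\<lambda>\<eta>. whitham_density \<eta> * (\<eta> * exp (- (x * \<eta>))))"
  proof (rule Bochner_Integration.integrable_bound)
    show "integrable lborel g" using gi by (rule integrable.intros)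
    show "AE \<eta> in lborel. norm (whitham_density \<eta> * (\<eta> * exp (- (x * \<eta>)))) \<le> norm (g \<eta>)"
    proof (rule AE_I2)
      fix \<eta> show "norm (whitham_density \<eta> * (\<eta> * exp (- (x * \<eta>)))) \<le> norm (g \<eta>)"
        using nn[of \<eta>] b[of \<eta>] unfolding real_norm_def by linarith
    qed
  qed measurable
  have "(LINT \<eta>|lborel. whitham_density \<eta> * (\<eta> * exp (- (x * \<eta>)))) \<le> integral\<^sup>L lborel g"
    by (intro integral_mono i b integrable.intros[OF gi])
  also have "\<dots> = (1 / x\<^sup>2) * (pi * whitham_symbol (1/x))" by (rule has_bochner_integral_integral_eq[OF gi])
  also have "\<dots> \<le> (1 / x\<^sup>2) * (pi * (1/x) powr (-1/2))"
    using assms by (intro mult_left_mono whitham_symbol_le) auto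
  also have "\<dots> = pi * (x powr (-2) * x powr (1/2))"
  proof -
    have "(1/x) powr (-1/2) = x powr (1/2)" using assms by (simp add: powr_def ln_div)
    moreover have "1 / x\<^sup>2 = x powr (-2)"
      using assms powr_minus_divide[of x 2] powr_realpow[of x 2] by simp
    ultimately show ?thesis by simp
  qed
  also have "x powr (-2) * x powr (1/2) = x powr (-3/2)" by (simp flip: powr_add)
  finally show "(LINT \<eta>|lborel. whitham_density \<eta> * (\<eta> * exp (- (x * \<eta>)))) \<le> pi * x powr (-3/2)" .
qed

lemma exp_diff_le:
  fixes \<eta> :: real
  assumes "c \<le> u" "c \<le> v" "0 \<le> \<eta>"
  shows "\<bar>exp (- (u * \<eta>)) - exp (- (v * \<eta>))\<bar> \<le> \<bar>u - v\<bar> * (\<eta> * exp (- (c * \<eta>)))"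
proof -
  have *: "\<bar>exp (- (u * \<eta>)) - exp (- (v * \<eta>))\<bar> \<le> \<bar>u - v\<bar> * (\<eta> * exp (- (c * \<eta>)))" if "c \<le> u" "u \<le> v" for u v
  proof -
    have "u * \<eta> \<le> v * \<eta>" using that assms by (intro mult_right_mono) auto
    then have "\<bar>exp (- (u * \<eta>)) - exp (- (v * \<eta>))\<bar> = exp (- (u * \<eta>)) - exp (- (v * \<eta>))" by simp
    also have "\<dots> = exp (- (u * \<eta>)) * (1 - exp (- ((v - u) * \<eta>)))" by (simp add: algebra_simps flip: exp_add)
    also have "\<dots> \<le> exp (- (c * \<eta>)) * ((v - u) * \<eta>)"
    proof (intro mult_mono)
      show "1 - exp (- ((v - u) * \<eta>)) \<le> (v - u) * \<eta>" using exp_ge_add_one_self[of "- ((v - u) * \<eta>)"] by linarith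
      show "0 \<le> 1 - exp (- ((v - u) * \<eta>))" using that assms by simp
    qed (use that assms in \<open>auto intro: mult_right_mono\<close>)
    finally show ?thesis using that by (simp add: mult_ac)
  qed
  show ?thesis using *[of u v] *[of v u] assms by (cases "u \<le> v") (auto simp: abs_minus_commute)
qed


lemma whitham_kernel_deriv:
  assumes x: "x > 0"
  shows "(whitham_kernel has_real_derivative - (LINT \<eta>|lborel. whitham_density \<eta> * (\<eta> * exp (- (x * \<eta>)))) / pi) (at x)"
proof -
  define w where "w = whitham_density"
  define q where "q h \<eta> = (exp (- ((x + h) * \<eta>)) - exp (- (x * \<eta>))) / h" for h \<eta>
  have lim: "(\<lambda>n. (whitham_kernel (x + h n) - whitham_kernel x) / h n) \<longlonglongrightarrow> - (LINT \<eta>|lborel. w \<eta> * (\<eta> * exp (- (x * \<eta>)))) / pi"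
    if h: "h \<longlonglongrightarrow> 0" "\<And>n. h n \<noteq> 0" "\<And>n. \<bar>h n\<bar> \<le> x / 2" for h
  proof -
    have "(\<lambda>n. LINT \<eta>|lborel. w \<eta> * q (h n) \<eta>) \<longlonglongrightarrow> (LINT \<eta>|lborel. w \<eta> * (- \<eta> * exp (- (x * \<eta>))))"
    proof (rule integral_dominated_convergence)
      \<comment> \<open>For |h n| <= x/2 all points involved are at least x/2, so this rate of decay
        serves every difference quotient.\<close>
      show "integrable lborel (\<lambda>\<eta>. w \<eta> * (\<eta> * exp (- (x / 2 * \<eta>))))"
        unfolding w_def using x by (intro moment_density_integrable) auto
      show "AE \<eta> in lborel. (\<lambda>n. w \<eta> * q (h n) \<eta>) \<longlonglongrightarrow> w \<eta> * (- \<eta> * exp (- (x * \<eta>)))"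
      proof (intro AE_I2 tendsto_intros)
        fix \<eta>
        have "((\<lambda>y. exp (- (y * \<eta>))) has_real_derivative (- \<eta> * exp (- (x * \<eta>)))) (at x)"
          by (auto intro!: derivative_eq_intros)
        then have "((\<lambda>h. q h \<eta>) \<longlongrightarrow> - \<eta> * exp (- (x * \<eta>))) (at 0)"
          unfolding DERIV_def q_def .
        then show "(\<lambda>n. q (h n) \<eta>) \<longlonglongrightarrow> - \<eta> * exp (- (x * \<eta>))"
          using h(1,2) unfolding tendsto_at_iff_sequentially comp_def by simp
      qed
      show "AE \<eta> in lborel. norm (w \<eta> * q (h n) \<eta>) \<le> w \<eta> * (\<eta> * exp (- (x / 2 * \<eta>)))" for n
      proof (rule AE_I2)
        fix \<eta>
        show "norm (w \<eta> * q (h n) \<eta>) \<le> w \<eta> * (\<eta> * exp (- (x / 2 * \<eta>)))"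
        proof (cases "\<eta> > 0")
          case True
          have "\<bar>exp (- ((x + h n) * \<eta>)) - exp (- (x * \<eta>))\<bar> \<le> \<bar>x + h n - x\<bar> * (\<eta> * exp (- (x / 2 * \<eta>)))"
            using h(3)[of n] x True by (intro exp_diff_le) (auto simp: abs_le_iff)
          then have "\<bar>q (h n) \<eta>\<bar> \<le> \<eta> * exp (- (x / 2 * \<eta>))"
            using h(2)[of n] by (simp add: q_def abs_divide divide_le_eq mult.commute)
          then show ?thesis by (simp add: w_def abs_mult mult_left_mono)
        qed (simp add: w_def whitham_density_def)
      qed
    qed (auto simp: w_def q_def)
    then have "(\<lambda>n. (LINT \<eta>|lborel. w \<eta> * q (h n) \<eta>) / pi) \<longlonglongrightarrow> (LINT \<eta>|lborel. w \<eta> * (- \<eta> * exp (- (x * \<eta>)))) / pi"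
      by (intro tendsto_divide) auto
    moreover have "(LINT \<eta>|lborel. w \<eta> * q (h n) \<eta>) / pi = (whitham_kernel (x + h n) - whitham_kernel x) / h n" for n
    proof -
      have "0 < x + h n" using h(3)[of n] x by (auto simp: abs_le_iff)
      note d = whitham_kernel_diff(2)[OF this x]
      have "(LINT \<eta>|lborel. w \<eta> * q (h n) \<eta>) = (LINT \<eta>|lborel. w \<eta> * (exp (- ((x + h n) * \<eta>)) - exp (- (x * \<eta>))) / h n)"
        by (simp add: q_def)
      then show ?thesis unfolding d by (simp add: w_def)
    qed
    moreover have "(LINT \<eta>|lborel. w \<eta> * (- \<eta> * exp (- (x * \<eta>)))) = - (LINT \<eta>|lborel. w \<eta> * (\<eta> * exp (- (x * \<eta>))))"
      unfolding Bochner_Integration.integral_minus[symmetric] by simp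
    ultimately show ?thesis by simp
  qed
  show ?thesis
    unfolding DERIV_def tendsto_at_iff_sequentially comp_def
  proof (intro allI impI)
    fix h :: "nat \<Rightarrow> real" assume h: "\<forall>i. h i \<in> UNIV - {0}" "h \<longlonglongrightarrow> 0"
    then have "\<forall>\<^sub>F n in sequentially. dist (h n) 0 < x / 2" using x by (intro tendstoD) auto
    then obtain N where N': "\<forall>n\<ge>N. dist (h n) 0 < x / 2" unfolding eventually_sequentially by blast
    have N: "\<bar>h n\<bar> \<le> x / 2" if "n \<ge> N" for n using N' that by (auto simp: less_imp_le)
    have "(\<lambda>n. (whitham_kernel (x + h (n + N)) - whitham_kernel x) / h (n + N)) \<longlonglongrightarrow> - (LINT \<eta>|lborel. w \<eta> * (\<eta> * exp (- (x * \<eta>)))) / pi"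
      using h N by (intro lim LIMSEQ_ignore_initial_segment) auto
    then show "(\<lambda>n. (whitham_kernel (x + h n) - whitham_kernel x) / h n) \<longlonglongrightarrow> - (LINT \<eta>|lborel. whitham_density \<eta> * (\<eta> * exp (- (x * \<eta>)))) / pi"
      unfolding w_def by (rule LIMSEQ_offset)
  qed
qed

lemma whitham_kernel_deriv_bound:
  assumes "x > 0"
  shows "\<bar>deriv whitham_kernel x\<bar> \<le> x powr (-3/2)" "(whitham_kernel has_real_derivative deriv whitham_kernel x) (at x)"
proof -
  have d: "deriv whitham_kernel x = - (LINT \<eta>|lborel. whitham_density \<eta> * (\<eta> * exp (- (x * \<eta>)))) / pi"
    by (rule DERIV_imp_deriv[OF whitham_kernel_deriv[OF assms]])
  have "0 \<le> whitham_density \<eta> * (\<eta> * exp (- (x * \<eta>)))" for \<eta>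
    by (cases "\<eta> > 0") (auto simp: whitham_density_def)
  then have "0 \<le> (LINT \<eta>|lborel. whitham_density \<eta> * (\<eta> * exp (- (x * \<eta>))))" by simp
  then show "\<bar>deriv whitham_kernel x\<bar> \<le> x powr (-3/2)"
    unfolding d using moment_density_integrable(2)[OF assms] by (simp add: abs_divide field_simps)
  show "(whitham_kernel has_real_derivative deriv whitham_kernel x) (at x)"
    unfolding d by (rule whitham_kernel_deriv[OF assms])
qed

text \<open>The derivative of 2 x^(-1/2) is - x^(-3/2), so the derivative bound makes the kernel
  minus this function nondecreasing; at infinity the difference is at most 1/y, so it can nowhere be
  positive.\<close>

lemma whitham_kernel_le:
  assumes "x > 0" shows "whitham_kernel x \<le> 2 * x powr (-1/2)"
proof -
  define u where "u = (\<lambda>x. whitham_kernel x - 2 * x powr (-1/2))"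
  have mono: "u x \<le> u y" if "x \<le> y" for y
  proof (rule DERIV_nonneg_imp_nondecreasing[OF that])
    fix z assume z: "x \<le> z" "z \<le> y"
    then have z0: "z > 0" using assms by simp
    have "(u has_real_derivative deriv whitham_kernel z + z powr (-3/2)) (at z)"
      unfolding u_def using z0 whitham_kernel_deriv_bound(2)[OF z0] by (auto intro!: derivative_eq_intros)
    moreover have "deriv whitham_kernel z + z powr (-3/2) \<ge> 0"
      using whitham_kernel_deriv_bound(1)[OF z0] by (simp add: abs_le_iff)
    ultimately show "\<exists>d. DERIV u z :> d \<and> d \<ge> 0" by blast
  qed
  have "u x \<le> 1 / y" if "x \<le> y" for y
  proof -
    have "y > 0" using that assms by simp
    then have "whitham_kernel y \<le> 1 / y"
      using exp_density_integrable(2)[of y] by (simp add: whitham_kernel_eq field_simps)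
    moreover have "0 \<le> y powr (-1/2)" by simp
    ultimately have "u y \<le> 1 / y" unfolding u_def by linarith
    then show ?thesis using mono[OF that] by simp
  qed
  then have "\<forall>\<^sub>F y in at_top. u x \<le> 1 / y" using eventually_ge_at_top[of x] by (rule eventually_mono[rotated])
  moreover have "((\<lambda>y::real. 1 / y) \<longlongrightarrow> 0) at_top" by (intro real_tendsto_divide_at_top[OF tendsto_const] filterlim_ident)
  ultimately have "u x \<le> 0" by (intro tendsto_lowerbound) auto
  then show ?thesis by (simp add: u_def)
qed

lemma nn_integral_exp_abs:
  assumes "\<eta> > 0"
  shows "(\<integral>\<^sup>+x. ennreal (exp (- (\<bar>x\<bar> * \<eta>))) \<partial>lborel) = ennreal (2 / \<eta>)"
proof -
  have p: "(\<integral>\<^sup>+x. ennreal (exp (- (\<bar>x\<bar> * \<eta>))) * indicator {0..} x \<partial>lborel) = ennreal (1 / \<eta>)"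
  proof (rule nn_integral_has_integral_lebesgue')
    have "((\<lambda>x. exp (- \<eta> * x)) has_integral exp (- \<eta> * 0) / \<eta>) {0..}" by (rule has_integral_exp_minus_to_infinity[OF assms])
    then have "((\<lambda>x. exp (- \<eta> * x)) has_integral 1 / \<eta>) {0..}" by simp
    then show "((\<lambda>x. exp (- (\<bar>x\<bar> * \<eta>))) has_integral 1 / \<eta>) {0..}"
      by (rule has_integral_eq[rotated]) (auto simp: mult.commute)
  qed auto
  have "(\<integral>\<^sup>+x. ennreal (exp (- (\<bar>x\<bar> * \<eta>))) * indicator {..0} x \<partial>lborel) = 
     ennreal \<bar>-1\<bar> * (\<integral>\<^sup>+x. ennreal (exp (- (\<bar>0 + (-1) * x\<bar> * \<eta>))) * indicator {..0} (0 + (-1) * x) \<partial>lborel)"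
    by (rule nn_integral_real_affine) auto
  also have "\<dots> = (\<integral>\<^sup>+x. ennreal (exp (- (\<bar>x\<bar> * \<eta>))) * indicator {0..} x \<partial>lborel)"
    by (auto intro!: nn_integral_cong simp: indicator_def)
  finally have n: "(\<integral>\<^sup>+x. ennreal (exp (- (\<bar>x\<bar> * \<eta>))) * indicator {..0} x \<partial>lborel) = ennreal (1 / \<eta>)" unfolding p .
  have "(\<integral>\<^sup>+x. ennreal (exp (- (\<bar>x\<bar> * \<eta>))) \<partial>lborel) = 
    (\<integral>\<^sup>+x. ennreal (exp (- (\<bar>x\<bar> * \<eta>))) * indicator {0..} x + ennreal (exp (- (\<bar>x\<bar> * \<eta>))) * indicator {..0} x \<partial>lborel)"
    by (rule nn_integral_cong_AE) (use AE_lborel_singleton[of 0] in \<open>eventually_elim, auto simp: indicator_def\<close>)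
  also have "\<dots> = ennreal (1 / \<eta>) + ennreal (1 / \<eta>)"
    by (subst nn_integral_add) (auto simp: p n)
  also have "\<dots> = ennreal (2 / \<eta>)" using assms by (simp flip: ennreal_plus)
  finally show ?thesis .
qed

text \<open>By Tonelli each exponential contributes 2/\<eta>, so the total mass is the spectral
  formula at frequency 0, where the symbol is 1.\<close>

lemma whitham_kernel_integral: "has_bochner_integral lborel whitham_kernel 1"
proof (rule has_bochner_integral_nn_integral)
  have ae: "AE x in lborel. x \<noteq> (0::real)" by (rule AE_lborel_singleton)
  show "AE x in lborel. 0 \<le> whitham_kernel x" using ae by eventually_elim (auto simp: whitham_kernel_pos less_imp_le)
  have "(\<integral>\<^sup>+x. ennreal (whitham_kernel x) \<partial>lborel) = (\<integral>\<^sup>+x. (\<integral>\<^sup>+\<eta>. ennreal (whitham_density \<eta> * exp (- (\<bar>x\<bar> * \<eta>)) / pi) \<partial>lborel) \<partial>lborel)"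
  proof (rule nn_integral_cong_AE, use ae in eventually_elim)
    fix x :: real assume x: "x \<noteq> 0"
    have "integrable lborel (\<lambda>\<eta>. whitham_density \<eta> * exp (- (\<bar>x\<bar> * \<eta>)) / pi)"
      using exp_density_integrable(1)[of "\<bar>x\<bar>"] x by (intro integrable_divide) auto
    then have "(\<integral>\<^sup>+\<eta>. ennreal (whitham_density \<eta> * exp (- (\<bar>x\<bar> * \<eta>)) / pi) \<partial>lborel) = ennreal (LINT \<eta>|lborel. whitham_density \<eta> * exp (- (\<bar>x\<bar> * \<eta>)) / pi)"
      by (intro nn_integral_eq_integral) auto
    then show "ennreal (whitham_kernel x) = (\<integral>\<^sup>+\<eta>. ennreal (whitham_density \<eta> * exp (- (\<bar>x\<bar> * \<eta>)) / pi) \<partial>lborel)"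
      using x by (simp add: whitham_kernel_eq)
  qed
  also have "\<dots> = (\<integral>\<^sup>+\<eta>. (\<integral>\<^sup>+x. ennreal (whitham_density \<eta> * exp (- (\<bar>x\<bar> * \<eta>)) / pi) \<partial>lborel) \<partial>lborel)"
    by (rule lborel_pair.Fubini') measurable
  also have "\<dots> = (\<integral>\<^sup>+\<eta>. ennreal (whitham_density \<eta> * (2 / \<eta>) / pi) \<partial>lborel)"
  proof (rule nn_integral_cong)
    fix \<eta>
    show "(\<integral>\<^sup>+x. ennreal (whitham_density \<eta> * exp (- (\<bar>x\<bar> * \<eta>)) / pi) \<partial>lborel) = ennreal (whitham_density \<eta> * (2 / \<eta>) / pi)"
    proof (cases "\<eta> > 0")
      case True
      have "(\<integral>\<^sup>+x. ennreal (whitham_density \<eta> * exp (- (\<bar>x\<bar> * \<eta>)) / pi) \<partial>lborel)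
         = (\<integral>\<^sup>+x. ennreal (whitham_density \<eta> / pi) * ennreal (exp (- (\<bar>x\<bar> * \<eta>))) \<partial>lborel)"
        by (intro nn_integral_cong) (simp flip: ennreal_mult)
      also have "\<dots> = ennreal (whitham_density \<eta> / pi) * ennreal (2 / \<eta>)"
        by (subst nn_integral_cmult) (auto simp: nn_integral_exp_abs[OF True])
      also have "\<dots> = ennreal (whitham_density \<eta> * (2 / \<eta>) / pi)" using True by (simp flip: ennreal_mult)
      finally show ?thesis .
    qed (simp add: whitham_density_def)
  qed
  also have "\<dots> = ennreal (LINT \<eta>|lborel. whitham_density \<eta> * (2 / \<eta>) / pi)"
  proof (rule nn_integral_eq_integral)
    show "integrable lborel (\<lambda>\<eta>. whitham_density \<eta> * (2 / \<eta>) / pi)"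
      by (intro integrable_divide integrable.intros[OF whitham_symbol_spectral_0])
    have "0 \<le> whitham_density \<eta> * (2 / \<eta>) / pi" for \<eta> by (cases "\<eta> > 0") (auto simp: whitham_density_def)
    then show "AE \<eta> in lborel. 0 \<le> whitham_density \<eta> * (2 / \<eta>) / pi" by simp
  qed
  also have "(LINT \<eta>|lborel. whitham_density \<eta> * (2 / \<eta>) / pi) = 1"
    unfolding integral_divide_zero has_bochner_integral_integral_eq[OF whitham_symbol_spectral_0] by simp
  finally show "(\<integral>\<^sup>+x. ennreal (whitham_kernel x) \<partial>lborel) = ennreal 1" .
qed auto

section \<open>Regularity of the convolution operator\<close>

lemma nn_integral_even:
  fixes g :: "real \<Rightarrow> ennreal"
  assumes [measurable]: "g \<in> borel_measurable borel" and even: "\<And>x. g (- x) = g x"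
  shows "(\<integral>\<^sup>+x. g x \<partial>lborel) = 2 * (\<integral>\<^sup>+x. g x * indicator {0..} x \<partial>lborel)"
proof -
  have "(\<integral>\<^sup>+x. g x * indicator {..0} x \<partial>lborel) = 
     ennreal \<bar>-1\<bar> * (\<integral>\<^sup>+x. g (0 + (-1) * x) * indicator {..0} (0 + (-1) * x) \<partial>lborel)"
    by (rule nn_integral_real_affine) auto
  also have "\<dots> = (\<integral>\<^sup>+x. g x * indicator {0..} x \<partial>lborel)"
    by (auto intro!: nn_integral_cong simp: indicator_def even)
  finally have n: "(\<integral>\<^sup>+x. g x * indicator {..0} x \<partial>lborel) = (\<integral>\<^sup>+x. g x * indicator {0..} x \<partial>lborel)" .
  have "(\<integral>\<^sup>+x. g x \<partial>lborel) = (\<integral>\<^sup>+x. g x * indicator {0..} x + g x * indicator {..0} x \<partial>lborel)"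
    by (rule nn_integral_cong_AE) (use AE_lborel_singleton[of 0] in \<open>eventually_elim, auto simp: indicator_def\<close>)
  also have "\<dots> = 2 * (\<integral>\<^sup>+x. g x * indicator {0..} x \<partial>lborel)"
    by (subst nn_integral_add) (auto simp: n mult_2)
  finally show ?thesis .
qed

lemma nn_integral_abs_powr_near:
  fixes s c :: real
  assumes "s > -1" "c > 0"
  shows "(\<integral>\<^sup>+t. ennreal (\<bar>t\<bar> powr s) * indicator {t. \<bar>t\<bar> \<le> c} t \<partial>lborel) = ennreal (2 * (c powr (s + 1) / (s + 1)))"
proof -
  have "(\<integral>\<^sup>+t. ennreal (\<bar>t\<bar> powr s) * indicator {0..c} t \<partial>lborel) = ennreal (c powr (s + 1) / (s + 1))"
    using assms has_integral_powr_from_0[of s c]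
    by (intro nn_integral_has_integral_lebesgue') (auto intro: has_integral_eq[rotated])
  moreover have "(\<integral>\<^sup>+t. ennreal (\<bar>t\<bar> powr s) * indicator {t. \<bar>t\<bar> \<le> c} t \<partial>lborel)
     = 2 * (\<integral>\<^sup>+t. ennreal (\<bar>t\<bar> powr s) * indicator {t. \<bar>t\<bar> \<le> c} t * indicator {0..} t \<partial>lborel)"
    by (rule nn_integral_even) (auto simp: indicator_def)
  moreover have "(\<integral>\<^sup>+t. ennreal (\<bar>t\<bar> powr s) * indicator {t. \<bar>t\<bar> \<le> c} t * indicator {0..} t \<partial>lborel)
     = (\<integral>\<^sup>+t. ennreal (\<bar>t\<bar> powr s) * indicator {0..c} t \<partial>lborel)"
    by (intro nn_integral_cong) (auto simp: indicator_def)
  ultimately have "(\<integral>\<^sup>+t. ennreal (\<bar>t\<bar> powr s) * indicator {t. \<bar>t\<bar> \<le> c} t \<partial>lborel) = 2 * ennreal (c powr (s + 1) / (s + 1))"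
    by simp
  also have "\<dots> = ennreal (2 * (c powr (s + 1) / (s + 1)))" using assms by (subst ennreal_mult) auto
  finally show ?thesis .
qed

lemma nn_integral_abs_powr_far:
  fixes s c :: real
  assumes "s < -1" "c > 0"
  shows "(\<integral>\<^sup>+t. ennreal (\<bar>t\<bar> powr s) * indicator {t. c < \<bar>t\<bar>} t \<partial>lborel) \<le> ennreal (2 * (- (c powr (s + 1)) / (s + 1)))"
proof -
  have nn: "0 \<le> - (c powr (s + 1)) / (s + 1)" using assms by (intro divide_nonpos_neg) auto
  have e: "(\<integral>\<^sup>+t. ennreal (\<bar>t\<bar> powr s) * indicator {c..} t \<partial>lborel) = ennreal (- (c powr (s + 1)) / (s + 1))"
    using assms has_integral_powr_to_inf[of s c]
    by (intro nn_integral_has_integral_lebesgue') (auto intro: has_integral_eq[rotated])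
  have "(\<integral>\<^sup>+t. ennreal (\<bar>t\<bar> powr s) * indicator {t. c < \<bar>t\<bar>} t \<partial>lborel) 
     = 2 * (\<integral>\<^sup>+t. ennreal (\<bar>t\<bar> powr s) * indicator {t. c < \<bar>t\<bar>} t * indicator {0..} t \<partial>lborel)"
    by (rule nn_integral_even) (auto simp: indicator_def)
  also have "\<dots> \<le> 2 * (\<integral>\<^sup>+t. ennreal (\<bar>t\<bar> powr s) * indicator {c..} t \<partial>lborel)"
    by (intro mult_left_mono nn_integral_mono) (auto simp: indicator_def)
  also have "\<dots> = ennreal (2 * (- (c powr (s + 1)) / (s + 1)))"
    unfolding e using nn by (subst ennreal_mult) auto
  finally show ?thesis .
qed

section \<open>Increments of the kernel near and far from its singularity\<close>

lemma whitham_kernel_le_abs: "t \<noteq> 0 \<Longrightarrow> whitham_kernel t \<le> 2 * \<bar>t\<bar> powr (-1/2)"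
  using whitham_kernel_le[of "\<bar>t\<bar>"] by (simp add: whitham_kernel_abs)

lemma whitham_kernel_deriv_nonzero:
  assumes "t \<noteq> 0"
  shows "(whitham_kernel has_real_derivative deriv whitham_kernel t) (at t)" "\<bar>deriv whitham_kernel t\<bar> \<le> \<bar>t\<bar> powr (-3/2)"
proof -
  have "(whitham_kernel has_real_derivative deriv whitham_kernel t) (at t) \<and> \<bar>deriv whitham_kernel t\<bar> \<le> \<bar>t\<bar> powr (-3/2)"
  proof (cases "t > 0")
    case True
    then show ?thesis using whitham_kernel_deriv_bound[of t] by simp
  next
    case False
    then have t: "-t > 0" using assms by simp
    have "((\<lambda>s. whitham_kernel (- s)) has_real_derivative deriv whitham_kernel (- t) * (-1)) (at t)"
      by (rule DERIV_chain2[where f = whitham_kernel and g = uminus, OF whitham_kernel_deriv_bound(2)[OF t]]) (auto intro!: derivative_eq_intros)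
    then have d: "(whitham_kernel has_real_derivative - deriv whitham_kernel (- t)) (at t)"
      by (simp add: whitham_kernel_even)
    then have "deriv whitham_kernel t = - deriv whitham_kernel (- t)" by (rule DERIV_imp_deriv)
    then show ?thesis using d whitham_kernel_deriv_bound(1)[OF t] t by simp
  qed
  then show "(whitham_kernel has_real_derivative deriv whitham_kernel t) (at t)" "\<bar>deriv whitham_kernel t\<bar> \<le> \<bar>t\<bar> powr (-3/2)"
    by auto
qed

text \<open>The segment from t to t + h keeps a distance of at least |t|/2 from the singularity,
  whence the factor 2^(3/2) in the derivative bound.\<close>

lemma whitham_kernel_increment_far:
  assumes "2 * \<bar>h\<bar> < \<bar>t\<bar>"
  shows "\<bar>whitham_kernel (t + h) - whitham_kernel t\<bar> \<le> \<bar>h\<bar> * (2 powr (3/2) * \<bar>t\<bar> powr (-3/2))"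
proof -
  have "norm (whitham_kernel (t + h) - whitham_kernel t) \<le> (2 powr (3/2) * \<bar>t\<bar> powr (-3/2)) * norm (t + h - t)"
  proof (rule field_differentiable_bound[where S = "closed_segment t (t + h)" and f' = "deriv whitham_kernel"])
    fix s assume "s \<in> closed_segment t (t + h)"
    then have s: "\<bar>s\<bar> \<ge> \<bar>t\<bar> / 2" using assms by (auto simp: closed_segment_eq_real_ivl split: if_splits)
    then have s0: "s \<noteq> 0" using assms by auto
    show "(whitham_kernel has_field_derivative deriv whitham_kernel s) (at s within closed_segment t (t + h))"
      using whitham_kernel_deriv_nonzero(1)[OF s0] by (rule has_field_derivative_at_within)
    have "\<bar>deriv whitham_kernel s\<bar> \<le> \<bar>s\<bar> powr (-3/2)" by (rule whitham_kernel_deriv_nonzero(2)[OF s0])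
    also have "\<dots> \<le> (\<bar>t\<bar> / 2) powr (-3/2)" using s assms by (intro powr_mono2') auto
    also have "\<dots> = 2 powr (3/2) * \<bar>t\<bar> powr (-3/2)"
    proof -
      have "t \<noteq> 0" using assms by auto
      then have "(\<bar>t\<bar> / 2) powr (-3/2) = exp (ln 2 * (3/2)) * exp (-3/2 * ln \<bar>t\<bar>)"
        by (simp add: powr_def ln_div algebra_simps flip: exp_add)
      then show ?thesis using \<open>t \<noteq> 0\<close> by (simp add: powr_def mult.commute)
    qed
    finally show "norm (deriv whitham_kernel s) \<le> 2 powr (3/2) * \<bar>t\<bar> powr (-3/2)" by simp
  qed auto
  then show ?thesis by (simp add: mult.commute)
qed

text \<open>Here the difference brings no cancellation: both kernel values are bounded separately by
  inverse square roots, with |t| and |t + h| at most 3 |h|. The 32 is 2 * 8 * sqrt 3 with sqrt 3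
  rounded up to 2.\<close>

lemma whitham_kernel_increment_near:
  fixes \<beta> h :: real
  assumes "0 \<le> \<beta>" "h \<noteq> 0"
  shows "(\<integral>\<^sup>+t. ennreal (\<bar>whitham_kernel (t + h) - whitham_kernel t\<bar> * \<bar>t\<bar> powr \<beta>) * indicator {t. \<bar>t\<bar> \<le> 2 * \<bar>h\<bar>} t \<partial>lborel)
      \<le> ennreal (2 powr \<beta> * 32 * \<bar>h\<bar> powr (\<beta> + 1/2))"
proof -
  define r where "r = \<bar>h\<bar>"
  have r: "r > 0" using assms by (simp add: r_def)
  define I where "I = (\<integral>\<^sup>+t. ennreal (\<bar>t\<bar> powr (-1/2)) * indicator {t. \<bar>t\<bar> \<le> 3 * r} t \<partial>lborel)"
  have I: "I = ennreal (4 * (3 * r) powr (1/2))"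
    unfolding I_def using nn_integral_abs_powr_near[of "-1/2" "3 * r"] r by simp
  have I': "(\<integral>\<^sup>+t. ennreal (\<bar>t + h\<bar> powr (-1/2)) * indicator {t. \<bar>t + h\<bar> \<le> 3 * r} t \<partial>lborel) = I"
    unfolding I_def
    using nn_integral_real_affine[of "\<lambda>t. ennreal (\<bar>t\<bar> powr (-1/2)) * indicator {t. \<bar>t\<bar> \<le> 3 * r} t" 1 h]
    by (simp add: add.commute indicator_def)
  define c where "c = 2 * (2 * r) powr \<beta>"
  have c: "c \<ge> 0" by (simp add: c_def)
  have ae: "AE t in lborel. t \<noteq> 0 \<and> t \<noteq> - h"
    using AE_lborel_singleton[of 0] AE_lborel_singleton[of "-h"] by eventually_elim auto
  have "(\<integral>\<^sup>+t. ennreal (\<bar>whitham_kernel (t + h) - whitham_kernel t\<bar> * \<bar>t\<bar> powr \<beta>) * indicator {t. \<bar>t\<bar> \<le> 2 * \<bar>h\<bar>} t \<partial>lborel)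
    \<le> (\<integral>\<^sup>+t. ennreal c * (ennreal (\<bar>t + h\<bar> powr (-1/2)) * indicator {t. \<bar>t + h\<bar> \<le> 3 * r} t + ennreal (\<bar>t\<bar> powr (-1/2)) * indicator {t. \<bar>t\<bar> \<le> 3 * r} t) \<partial>lborel)"
  proof (rule nn_integral_mono_AE, use ae in eventually_elim)
    fix t assume t: "t \<noteq> 0 \<and> t \<noteq> - h"
    show "ennreal (\<bar>whitham_kernel (t + h) - whitham_kernel t\<bar> * \<bar>t\<bar> powr \<beta>) * indicator {t. \<bar>t\<bar> \<le> 2 * \<bar>h\<bar>} t
      \<le> ennreal c * (ennreal (\<bar>t + h\<bar> powr (-1/2)) * indicator {t. \<bar>t + h\<bar> \<le> 3 * r} t + ennreal (\<bar>t\<bar> powr (-1/2)) * indicator {t. \<bar>t\<bar> \<le> 3 * r} t)"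
    proof (cases "\<bar>t\<bar> \<le> 2 * \<bar>h\<bar>")
      case True
      have th: "t + h \<noteq> 0" using t by auto
      have "\<bar>whitham_kernel (t + h) - whitham_kernel t\<bar> \<le> whitham_kernel (t + h) + whitham_kernel t"
        using whitham_kernel_pos[of t] whitham_kernel_pos[OF th] t by (auto simp: abs_le_iff)
      also have "\<dots> \<le> 2 * \<bar>t + h\<bar> powr (-1/2) + 2 * \<bar>t\<bar> powr (-1/2)"
        using t th by (intro add_mono whitham_kernel_le_abs) auto
      finally have "\<bar>whitham_kernel (t + h) - whitham_kernel t\<bar> * \<bar>t\<bar> powr \<beta> \<le> (2 * \<bar>t + h\<bar> powr (-1/2) + 2 * \<bar>t\<bar> powr (-1/2)) * (2 * r) powr \<beta>"
        using True assms by (intro mult_mono powr_mono2) (auto simp: r_def)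
      also have "\<dots> = c * (\<bar>t + h\<bar> powr (-1/2) + \<bar>t\<bar> powr (-1/2))" by (simp add: c_def algebra_simps)
      finally have "ennreal (\<bar>whitham_kernel (t + h) - whitham_kernel t\<bar> * \<bar>t\<bar> powr \<beta>) \<le> ennreal (c * (\<bar>t + h\<bar> powr (-1/2) + \<bar>t\<bar> powr (-1/2)))"
        by (rule ennreal_leI)
      also have "\<dots> = ennreal c * (ennreal (\<bar>t + h\<bar> powr (-1/2)) + ennreal (\<bar>t\<bar> powr (-1/2)))"
        using c by (simp add: ennreal_mult ennreal_plus)
      finally show ?thesis using True by (auto simp: indicator_def r_def)
    qed (simp add: indicator_def)
  qed
  also have "\<dots> = ennreal c * (\<integral>\<^sup>+t. (ennreal (\<bar>t + h\<bar> powr (-1/2)) * indicator {t. \<bar>t + h\<bar> \<le> 3 * r} t + ennreal (\<bar>t\<bar> powr (-1/2)) * indicator {t. \<bar>t\<bar> \<le> 3 * r} t) \<partial>lborel)"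
    by (rule nn_integral_cmult) measurable
  also have "(\<integral>\<^sup>+t. (ennreal (\<bar>t + h\<bar> powr (-1/2)) * indicator {t. \<bar>t + h\<bar> \<le> 3 * r} t + ennreal (\<bar>t\<bar> powr (-1/2)) * indicator {t. \<bar>t\<bar> \<le> 3 * r} t) \<partial>lborel)
     = (\<integral>\<^sup>+t. (ennreal (\<bar>t + h\<bar> powr (-1/2)) * indicator {t. \<bar>t + h\<bar> \<le> 3 * r} t) \<partial>lborel) + (\<integral>\<^sup>+t. (ennreal (\<bar>t\<bar> powr (-1/2)) * indicator {t. \<bar>t\<bar> \<le> 3 * r} t) \<partial>lborel)"
    by (rule nn_integral_add) measurable
  also have "\<dots> = I + I" unfolding I' I_def[symmetric] ..
  also have "I + I = ennreal (8 * (3 * r) powr (1/2))"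
    unfolding I by (subst ennreal_plus[symmetric]) auto
  also have "ennreal c * ennreal (8 * (3 * r) powr (1/2)) = ennreal (c * (8 * (3 * r) powr (1/2)))"
    using c by (subst ennreal_mult) auto
  also have "c * (8 * (3 * r) powr (1/2)) \<le> 2 powr \<beta> * 32 * r powr (\<beta> + 1/2)"
  proof -
    have "sqrt 3 \<le> 2" by (rule real_le_lsqrt) auto
    then have "(3 * r) powr (1/2) \<le> 2 * r powr (1/2)"
      using r by (simp add: powr_half_sqrt real_sqrt_mult mult_right_mono)
    then have "c * (8 * (3 * r) powr (1/2)) \<le> c * (8 * (2 * r powr (1/2)))"
      using c by (intro mult_left_mono) auto
    also have "\<dots> = 2 powr \<beta> * 32 * (r powr \<beta> * r powr (1/2))" using r by (simp add: c_def powr_mult)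
    also have "\<dots> = 2 powr \<beta> * 32 * r powr (\<beta> + 1/2)" by (simp add: powr_add)
    finally show ?thesis .
  qed
  finally show ?thesis unfolding r_def by (simp add: ennreal_leI)
qed

text \<open>The weight stands for a Hoelder modulus of the function to be convolved. The far part
  integrates |h| |t|^(\<beta> - 3/2) over |t| > 2 |h|; convergence at infinity needs \<beta> < 1/2
  and produces the factor 1 / (1/2 - \<beta>).\<close>

lemma whitham_kernel_increment_weighted:
  fixes \<beta> h :: real
  assumes "0 \<le> \<beta>" "\<beta> < 1/2" "h \<noteq> 0"
  shows "(\<integral>\<^sup>+t. ennreal (\<bar>whitham_kernel (t + h) - whitham_kernel t\<bar> * \<bar>t\<bar> powr \<beta>) \<partial>lborel)
      \<le> ennreal ((64 + 8 / (1/2 - \<beta>)) * \<bar>h\<bar> powr (\<beta> + 1/2))"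
proof -
  define r where "r = \<bar>h\<bar>"
  have r: "r > 0" using assms by (simp add: r_def)
  define F where "F t = \<bar>whitham_kernel (t + h) - whitham_kernel t\<bar> * \<bar>t\<bar> powr \<beta>" for t
  have [measurable]: "F \<in> borel_measurable borel" unfolding F_def by measurable
  have "(\<integral>\<^sup>+t. ennreal (F t) \<partial>lborel) = (\<integral>\<^sup>+t. ennreal (F t) * indicator {t. \<bar>t\<bar> \<le> 2 * \<bar>h\<bar>} t + ennreal (F t) * indicator {t. 2 * \<bar>h\<bar> < \<bar>t\<bar>} t \<partial>lborel)"
    by (intro nn_integral_cong) (auto simp: indicator_def)
  also have "\<dots> = (\<integral>\<^sup>+t. ennreal (F t) * indicator {t. \<bar>t\<bar> \<le> 2 * \<bar>h\<bar>} t \<partial>lborel) + (\<integral>\<^sup>+t. ennreal (F t) * indicator {t. 2 * \<bar>h\<bar> < \<bar>t\<bar>} t \<partial>lborel)"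
    by (rule nn_integral_add) auto
  also have "\<dots> \<le> ennreal (64 * r powr (\<beta> + 1/2)) + ennreal (8 / (1/2 - \<beta>) * r powr (\<beta> + 1/2))"
  proof (rule add_mono)
    have "2 powr \<beta> * 32 \<le> 64" using powr_mono[of \<beta> 1 2] assms by simp
    then have "2 powr \<beta> * 32 * r powr (\<beta> + 1/2) \<le> 64 * r powr (\<beta> + 1/2)" by (intro mult_right_mono) auto
    then show "(\<integral>\<^sup>+t. ennreal (F t) * indicator {t. \<bar>t\<bar> \<le> 2 * \<bar>h\<bar>} t \<partial>lborel) \<le> ennreal (64 * r powr (\<beta> + 1/2))"
      using whitham_kernel_increment_near[OF assms(1,3)] unfolding F_def r_def by (meson ennreal_leI order_trans)
    define c where "c = r * 2 powr (3/2)"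
    have c: "c \<ge> 0" using r by (simp add: c_def)
    have "(\<integral>\<^sup>+t. ennreal (F t) * indicator {t. 2 * \<bar>h\<bar> < \<bar>t\<bar>} t \<partial>lborel) \<le> (\<integral>\<^sup>+t. ennreal c * (ennreal (\<bar>t\<bar> powr (\<beta> - 3/2)) * indicator {t. 2 * r < \<bar>t\<bar>} t) \<partial>lborel)"
    proof (rule nn_integral_mono)
      fix t
      show "ennreal (F t) * indicator {t. 2 * \<bar>h\<bar> < \<bar>t\<bar>} t \<le> ennreal c * (ennreal (\<bar>t\<bar> powr (\<beta> - 3/2)) * indicator {t. 2 * r < \<bar>t\<bar>} t)"
      proof (cases "2 * \<bar>h\<bar> < \<bar>t\<bar>")
        case True
        have "F t \<le> (\<bar>h\<bar> * (2 powr (3/2) * \<bar>t\<bar> powr (-3/2))) * \<bar>t\<bar> powr \<beta>"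
          unfolding F_def by (intro mult_right_mono whitham_kernel_increment_far True) auto
        also have "\<dots> = c * (\<bar>t\<bar> powr (-3/2) * \<bar>t\<bar> powr \<beta>)" by (simp add: c_def r_def)
        also have "\<bar>t\<bar> powr (-3/2) * \<bar>t\<bar> powr \<beta> = \<bar>t\<bar> powr (\<beta> - 3/2)" by (simp flip: powr_add)
        finally have "ennreal (F t) \<le> ennreal c * ennreal (\<bar>t\<bar> powr (\<beta> - 3/2))"
          using c by (simp add: ennreal_leI flip: ennreal_mult)
        then show ?thesis using True by (simp add: indicator_def r_def)
      qed (simp add: indicator_def r_def)
    qed
    also have "\<dots> = ennreal c * (\<integral>\<^sup>+t. (ennreal (\<bar>t\<bar> powr (\<beta> - 3/2)) * indicator {t. 2 * r < \<bar>t\<bar>} t) \<partial>lborel)"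
      by (rule nn_integral_cmult) auto
    also have "\<dots> \<le> ennreal c * ennreal (2 * (- ((2 * r) powr (\<beta> - 3/2 + 1)) / (\<beta> - 3/2 + 1)))"
      using assms r by (intro mult_left_mono nn_integral_abs_powr_far) auto
    also have "- ((2 * r) powr (\<beta> - 3/2 + 1)) / (\<beta> - 3/2 + 1) = (2 * r) powr (\<beta> - 1/2) / (1/2 - \<beta>)"
    proof -
      have "\<beta> - 3/2 + 1 = \<beta> - 1/2" "- (1/2 - \<beta>) = \<beta> - 1/2" by simp_all
      then show ?thesis using minus_divide_divide[of "(2 * r) powr (\<beta> - 1/2)" "1/2 - \<beta>"] by (simp only:)
    qed
    also have "ennreal c * ennreal (2 * ((2 * r) powr (\<beta> - 1/2) / (1/2 - \<beta>))) = ennreal (c * (2 * ((2 * r) powr (\<beta> - 1/2) / (1/2 - \<beta>))))"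
      using c assms by (subst ennreal_mult) auto
    also have "\<dots> \<le> ennreal (8 / (1/2 - \<beta>) * r powr (\<beta> + 1/2))"
    proof (rule ennreal_leI)
      have "c * (2 * ((2 * r) powr (\<beta> - 1/2) / (1/2 - \<beta>))) = 2 * (2 powr (3/2) * 2 powr (\<beta> - 1/2)) * (r powr 1 * r powr (\<beta> - 1/2)) / (1/2 - \<beta>)"
        using r by (simp add: c_def powr_mult)
      also have "2 powr (3/2) * 2 powr (\<beta> - 1/2) = 2 powr (\<beta> + 1)" by (simp add: add.commute flip: powr_add)
      also have "r powr 1 * r powr (\<beta> - 1/2) = r powr (\<beta> + 1/2)"
          unfolding powr_add[symmetric] by (rule arg_cong[where f = "\<lambda>e. r powr e"]) simp
      also have "2 * 2 powr (\<beta> + 1) * r powr (\<beta> + 1/2) / (1/2 - \<beta>) \<le> 8 * r powr (\<beta> + 1/2) / (1/2 - \<beta>)"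
        using powr_mono[of "\<beta> + 1" 2 2] assms by (intro divide_right_mono mult_right_mono) auto
      finally show "c * (2 * ((2 * r) powr (\<beta> - 1/2) / (1/2 - \<beta>))) \<le> 8 / (1/2 - \<beta>) * r powr (\<beta> + 1/2)" by simp
    qed
    finally show "(\<integral>\<^sup>+t. ennreal (F t) * indicator {t. 2 * \<bar>h\<bar> < \<bar>t\<bar>} t \<partial>lborel) \<le> ennreal (8 / (1/2 - \<beta>) * r powr (\<beta> + 1/2))" .
  qed
  also have "\<dots> = ennreal ((64 + 8 / (1/2 - \<beta>)) * r powr (\<beta> + 1/2))"
    using assms by (simp add: distrib_right flip: ennreal_plus)
  finally show ?thesis by (simp add: F_def r_def)
qed

section \<open>Gain of half a derivative under convolution\<close>

lemma whitham_kernel_integrable: "integrable lborel whitham_kernel" "integral\<^sup>L lborel whitham_kernel = 1"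
  using whitham_kernel_integral by (simp_all add: has_bochner_integral_iff)

lemma whitham_kernel_shift:
  "integrable lborel (\<lambda>t. whitham_kernel (t + h))" "(LINT t|lborel. whitham_kernel (t + h)) = 1"
proof -
  show "integrable lborel (\<lambda>t. whitham_kernel (t + h))"
    using lborel_integrable_real_affine[OF whitham_kernel_integrable(1), of 1 h] by (simp add: add.commute)
  show "(LINT t|lborel. whitham_kernel (t + h)) = 1"
    using lborel_integral_real_affine[of 1 whitham_kernel h] whitham_kernel_integrable by (simp add: add.commute)
qed

lemma integrable_mult_bounded:
  fixes k g :: "real \<Rightarrow> real"
  assumes k: "integrable lborel k" and [measurable]: "g \<in> borel_measurable borel" and M: "\<And>t. \<bar>g t\<bar> \<le> M"
  shows "integrable lborel (\<lambda>t. k t * g t)"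
proof (rule Bochner_Integration.integrable_bound)
  show "integrable lborel (\<lambda>t. M * k t)" using k by simp
  have [measurable]: "k \<in> borel_measurable borel" using k by auto
  show "(\<lambda>t. k t * g t) \<in> borel_measurable lborel" by measurable
  have "\<bar>g t\<bar> * \<bar>k t\<bar> \<le> \<bar>M\<bar> * \<bar>k t\<bar>" for t using M[of t] by (intro mult_right_mono) auto
  then show "AE t in lborel. norm (k t * g t) \<le> norm (M * k t)"
    by (intro AE_I2) (simp add: abs_mult mult.commute)
qed

lemma whitham_op_eq: "whitham_op f x = (LINT t|lborel. whitham_kernel t * f (x - t))"
  unfolding whitham_op_def
  using lborel_integral_real_affine[of "-1" "\<lambda>y. whitham_kernel (x - y) * f y" x] by simp

text \<open>The increment of the kernel has total mass zero, so the constant f z may be subtracted.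
  This is how the oscillation of f around z enters.\<close>

lemma whitham_op_increment:
  assumes [measurable]: "f \<in> borel_measurable borel" and M: "\<And>t. \<bar>f t\<bar> \<le> M"
  shows "whitham_op f (z + h) - whitham_op f z = (LINT t|lborel. (whitham_kernel (t + h) - whitham_kernel t) * (f (z - t) - f z))"
    "integrable lborel (\<lambda>t. (whitham_kernel (t + h) - whitham_kernel t) * (f (z - t) - f z))"
proof -
  have i1: "integrable lborel (\<lambda>t. whitham_kernel (t + h) * f (z - t))"
    by (rule integrable_mult_bounded[OF whitham_kernel_shift(1), of _ M]) (auto simp: M)
  have i2: "integrable lborel (\<lambda>t. whitham_kernel t * f (z - t))"
    by (rule integrable_mult_bounded[OF whitham_kernel_integrable(1), of _ M]) (auto simp: M)
  have i3: "integrable lborel (\<lambda>t. whitham_kernel (t + h) * f z)" "integrable lborel (\<lambda>t. whitham_kernel t * f z)"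
    using whitham_kernel_shift whitham_kernel_integrable by auto
  have e: "(\<lambda>t. (whitham_kernel (t + h) - whitham_kernel t) * (f (z - t) - f z)) =
     (\<lambda>t. (whitham_kernel (t + h) * f (z - t) - whitham_kernel t * f (z - t)) - (whitham_kernel (t + h) * f z - whitham_kernel t * f z))"
    by (auto simp: algebra_simps)
  show "integrable lborel (\<lambda>t. (whitham_kernel (t + h) - whitham_kernel t) * (f (z - t) - f z))"
    unfolding e by (intro Bochner_Integration.integrable_diff i1 i2 i3)
  have "whitham_op f (z + h) = (LINT t|lborel. whitham_kernel (t + h) * f (z - t))"
    unfolding whitham_op_eq
    using lborel_integral_real_affine[of 1 "\<lambda>s. whitham_kernel s * f (z + h - s)" h] by (simp add: add.commute)
  moreover have "(LINT t|lborel. (whitham_kernel (t + h) - whitham_kernel t) * (f (z - t) - f z)) =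
     ((LINT t|lborel. whitham_kernel (t + h) * f (z - t)) - (LINT t|lborel. whitham_kernel t * f (z - t)))
     - ((LINT t|lborel. whitham_kernel (t + h) * f z) - (LINT t|lborel. whitham_kernel t * f z))"
    unfolding e by (simp only: Bochner_Integration.integral_diff Bochner_Integration.integrable_diff i1 i2 i3)
  ultimately show "whitham_op f (z + h) - whitham_op f z = (LINT t|lborel. (whitham_kernel (t + h) - whitham_kernel t) * (f (z - t) - f z))"
    using whitham_kernel_shift whitham_kernel_integrable by (simp add: whitham_op_eq)
qed

lemma abs_integral_le_nn_integral:
  fixes F :: "real \<Rightarrow> real"
  assumes "integrable lborel F" and "(\<integral>\<^sup>+t. ennreal \<bar>F t\<bar> \<partial>lborel) \<le> ennreal C" "0 \<le> C"
  shows "\<bar>integral\<^sup>L lborel F\<bar> \<le> C"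
proof -
  have "ennreal \<bar>integral\<^sup>L lborel F\<bar> \<le> ennreal (LINT t|lborel. \<bar>F t\<bar>)"
    using integral_norm_bound[of lborel F] by (intro ennreal_leI) simp
  also have "\<dots> = (\<integral>\<^sup>+t. ennreal \<bar>F t\<bar> \<partial>lborel)"
    using assms by (intro nn_integral_eq_integral[symmetric]) auto
  also note assms(2)
  finally show ?thesis using assms by simp
qed

text \<open>The modulus of f is required at the single point z, not uniformly. This allows
  regularity to be improved at one point while the crest may be rough.\<close>

lemma whitham_op_hoelder_gain:
  fixes \<beta> A h :: real
  assumes f: "f \<in> borel_measurable borel" "\<And>t. \<bar>f t\<bar> \<le> M"
    and \<beta>: "0 \<le> \<beta>" "\<beta> < 1/2" and A: "\<And>t. \<bar>f (z - t) - f z\<bar> \<le> A * \<bar>t\<bar> powr \<beta>"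
  shows "\<bar>whitham_op f (z + h) - whitham_op f z\<bar> \<le> (64 + 8 / (1/2 - \<beta>)) * A * \<bar>h\<bar> powr (\<beta> + 1/2)"
proof (cases "h = 0")
  case False
  have A0: "A \<ge> 0" using A[of 1] by (simp add: order_trans[OF abs_ge_zero])
  define C where "C = (64 + 8 / (1/2 - \<beta>)) * \<bar>h\<bar> powr (\<beta> + 1/2)"
  have C0: "C \<ge> 0" using \<beta> by (simp add: C_def)
  have "\<bar>LINT t|lborel. (whitham_kernel (t + h) - whitham_kernel t) * (f (z - t) - f z)\<bar> \<le> A * C"
  proof (rule abs_integral_le_nn_integral[OF whitham_op_increment(2)[OF f]])
    have "(\<integral>\<^sup>+t. ennreal \<bar>(whitham_kernel (t + h) - whitham_kernel t) * (f (z - t) - f z)\<bar> \<partial>lborel)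
      \<le> (\<integral>\<^sup>+t. ennreal A * ennreal (\<bar>whitham_kernel (t + h) - whitham_kernel t\<bar> * \<bar>t\<bar> powr \<beta>) \<partial>lborel)"
    proof (rule nn_integral_mono)
      fix t
      have "\<bar>(whitham_kernel (t + h) - whitham_kernel t) * (f (z - t) - f z)\<bar> \<le> \<bar>whitham_kernel (t + h) - whitham_kernel t\<bar> * (A * \<bar>t\<bar> powr \<beta>)"
        unfolding abs_mult by (intro mult_left_mono A) auto
      then show "ennreal \<bar>(whitham_kernel (t + h) - whitham_kernel t) * (f (z - t) - f z)\<bar> \<le> ennreal A * ennreal (\<bar>whitham_kernel (t + h) - whitham_kernel t\<bar> * \<bar>t\<bar> powr \<beta>)"
        using A0 by (subst ennreal_mult[symmetric]) (auto intro!: ennreal_leI simp: mult_ac)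
    qed
    also have "\<dots> = ennreal A * (\<integral>\<^sup>+t. ennreal (\<bar>whitham_kernel (t + h) - whitham_kernel t\<bar> * \<bar>t\<bar> powr \<beta>) \<partial>lborel)"
      by (rule nn_integral_cmult) measurable
    also have "\<dots> \<le> ennreal A * ennreal C"
      unfolding C_def by (intro mult_left_mono whitham_kernel_increment_weighted \<beta> False) auto
    also have "\<dots> = ennreal (A * C)" using A0 C0 by (simp add: ennreal_mult)
    finally show "(\<integral>\<^sup>+t. ennreal \<bar>(whitham_kernel (t + h) - whitham_kernel t) * (f (z - t) - f z)\<bar> \<partial>lborel) \<le> ennreal (A * C)" .
  qed (use A0 C0 in auto)
  then show ?thesis unfolding whitham_op_increment(1)[OF f] by (simp add: C_def mult_ac)
qed simp

text \<open>Boundedness is the case \<beta> = 0 with constant 2 M; then 160 = 2 (64 + 8 / (1/2)).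
  The point t = 0 is separate because 0 powr 0 is 0.\<close>

lemma whitham_op_hoelder_half:
  assumes f: "f \<in> borel_measurable borel" "\<And>t. \<bar>f t\<bar> \<le> M"
  shows "\<bar>whitham_op f x - whitham_op f y\<bar> \<le> 160 * M * \<bar>x - y\<bar> powr (1/2)"
proof -
  have "\<bar>f (y - t) - f y\<bar> \<le> 2 * M * \<bar>t\<bar> powr 0" for t
    using f(2)[of "y - t"] f(2)[of y] by (cases "t = 0") auto
  from whitham_op_hoelder_gain[OF f _ _ this, of "x - y"] show ?thesis by simp
qed

text \<open>Dominates |t|^(-3/2) |f (z - t) - f z|: near 0 a Hoelder bound with exponent 3/4 leaves
  |t|^(-3/4), and away from 0 the bound 2 M for the difference is enough.\<close>

definition diff_majorant :: "real \<Rightarrow> real \<Rightarrow> real \<Rightarrow> real" where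
  "diff_majorant A M t = A * (\<bar>t\<bar> powr (-3/4) * indicator {t. \<bar>t\<bar> \<le> 1} t) + 2 * M * (\<bar>t\<bar> powr (-3/2) * indicator {t. 1 < \<bar>t\<bar>} t)"

lemma diff_majorant:
  assumes "0 \<le> A" "0 \<le> M"
  shows "integrable lborel (diff_majorant A M)" "integral\<^sup>L lborel (diff_majorant A M) \<le> 8 * A + 8 * M"
proof -
  have nn: "0 \<le> diff_majorant A M t" for t using assms by (simp add: diff_majorant_def)
  have [measurable]: "diff_majorant A M \<in> borel_measurable borel" unfolding diff_majorant_def[abs_def] by measurable
  have "(\<integral>\<^sup>+t. ennreal (diff_majorant A M t) \<partial>lborel)
     = (\<integral>\<^sup>+t. ennreal A * (ennreal (\<bar>t\<bar> powr (-3/4)) * indicator {t. \<bar>t\<bar> \<le> 1} t) + ennreal (2 * M) * (ennreal (\<bar>t\<bar> powr (-3/2)) * indicator {t. 1 < \<bar>t\<bar>} t) \<partial>lborel)"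
    using assms by (intro nn_integral_cong) (auto simp: diff_majorant_def indicator_def ennreal_mult)
  also have "\<dots> = (\<integral>\<^sup>+t. ennreal A * (ennreal (\<bar>t\<bar> powr (-3/4)) * indicator {t. \<bar>t\<bar> \<le> 1} t) \<partial>lborel) + (\<integral>\<^sup>+t. ennreal (2 * M) * (ennreal (\<bar>t\<bar> powr (-3/2)) * indicator {t. 1 < \<bar>t\<bar>} t) \<partial>lborel)"
    by (rule nn_integral_add) measurable
  also have "(\<integral>\<^sup>+t. ennreal A * (ennreal (\<bar>t\<bar> powr (-3/4)) * indicator {t. \<bar>t\<bar> \<le> 1} t) \<partial>lborel) = ennreal A * (\<integral>\<^sup>+t. (ennreal (\<bar>t\<bar> powr (-3/4)) * indicator {t. \<bar>t\<bar> \<le> 1} t) \<partial>lborel)"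
    by (rule nn_integral_cmult) measurable
  also have "(\<integral>\<^sup>+t. (ennreal (\<bar>t\<bar> powr (-3/4)) * indicator {t. \<bar>t\<bar> \<le> 1} t) \<partial>lborel) = ennreal 8"
    using nn_integral_abs_powr_near[of "-3/4" 1] by simp
  also have "(\<integral>\<^sup>+t. ennreal (2 * M) * (ennreal (\<bar>t\<bar> powr (-3/2)) * indicator {t. 1 < \<bar>t\<bar>} t) \<partial>lborel) = ennreal (2 * M) * (\<integral>\<^sup>+t. (ennreal (\<bar>t\<bar> powr (-3/2)) * indicator {t. 1 < \<bar>t\<bar>} t) \<partial>lborel)"
    by (rule nn_integral_cmult) measurable
  also have "ennreal A * ennreal 8 + ennreal (2 * M) * (\<integral>\<^sup>+t. (ennreal (\<bar>t\<bar> powr (-3/2)) * indicator {t. 1 < \<bar>t\<bar>} t) \<partial>lborel) \<le> ennreal A * ennreal 8 + ennreal (2 * M) * ennreal 4"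
    using nn_integral_abs_powr_far[of "-3/2" 1] by (intro add_left_mono mult_left_mono) auto
  also have "\<dots> = ennreal (A * 8) + ennreal (2 * M * 4)"
    using assms by (subst (1 2) ennreal_mult) auto
  also have "\<dots> = ennreal (8 * A + 8 * M)"
    using assms by (subst ennreal_plus[symmetric]) (auto simp: mult.commute)
  finally have le: "(\<integral>\<^sup>+t. ennreal (diff_majorant A M t) \<partial>lborel) \<le> ennreal (8 * A + 8 * M)" .
  show i: "integrable lborel (diff_majorant A M)"
    by (rule integrableI_nonneg) (use nn le in \<open>auto simp: less_top[symmetric] top_unique\<close>)
  show "integral\<^sup>L lborel (diff_majorant A M) \<le> 8 * A + 8 * M"
    using abs_integral_le_nn_integral[OF i, of "8 * A + 8 * M"] le nn assms by simp
qed

text \<open>The derivative is the integral of K'(t) (f (z - t) - f z), absolutely convergent since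
  3/4 > 1/2. In the difference quotient the zone |t| <= 2 |h|, where the kernel may not be
  differentiated, contributes only order |h|^(1/4); outside it dominated convergence
  applies.\<close>

lemma whitham_op_differentiable:
  assumes f: "f \<in> borel_measurable borel" "\<And>t. \<bar>f t\<bar> \<le> M"
    and A: "\<And>t. \<bar>f (z - t) - f z\<bar> \<le> A * \<bar>t\<bar> powr (3/4)"
  shows "\<exists>D. (whitham_op f has_real_derivative D) (at z) \<and> \<bar>D\<bar> \<le> 8 * A + 8 * M"
proof -
  have [measurable]: "f \<in> borel_measurable borel" by fact
  have A0: "A \<ge> 0" using A[of 1] by (simp add: order_trans[OF abs_ge_zero])
  have M0: "M \<ge> 0" using f(2)[of 0] by linarith
  define G where "G t = f (z - t) - f z" for t
  have [measurable]: "G \<in> borel_measurable borel" unfolding G_def by measurable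
  have G: "\<bar>t\<bar> powr (-3/2) * \<bar>G t\<bar> \<le> diff_majorant A M t" for t
  proof (cases "\<bar>t\<bar> \<le> 1")
    case True
    have "\<bar>t\<bar> powr (-3/2) * \<bar>G t\<bar> \<le> \<bar>t\<bar> powr (-3/2) * (A * \<bar>t\<bar> powr (3/4))"
      unfolding G_def by (intro mult_left_mono A) auto
    also have "\<dots> = A * (\<bar>t\<bar> powr (-3/2) * \<bar>t\<bar> powr (3/4))" by simp
    also have "\<bar>t\<bar> powr (-3/2) * \<bar>t\<bar> powr (3/4) = \<bar>t\<bar> powr (-3/4)" by (simp flip: powr_add)
    finally show ?thesis using True by (simp add: diff_majorant_def)
  next
    case False
    have "\<bar>G t\<bar> \<le> 2 * M" unfolding G_def using f(2)[of "z - t"] f(2)[of z] by linarith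
    then have "\<bar>t\<bar> powr (-3/2) * \<bar>G t\<bar> \<le> \<bar>t\<bar> powr (-3/2) * (2 * M)" by (intro mult_left_mono) auto
    then show ?thesis using False by (simp add: diff_majorant_def mult_ac)
  qed
  \<comment> \<open>The kernel has no usable derivative at 0, so the value there is set by
    hand.\<close>
  define W where "W t = (if t = 0 then 0 else deriv whitham_kernel t) * G t" for t
  have Wm [measurable]: "W \<in> borel_measurable borel"
  proof -
    have "(\<lambda>t. if t = 0 then 0 else deriv whitham_kernel t) \<in> borel_measurable borel"
    proof (rule borel_measurable_LIMSEQ_real)
      fix t :: real
      show "(\<lambda>n. if t = 0 then 0 else (whitham_kernel (t + inverse (real (Suc n))) - whitham_kernel t) / inverse (real (Suc n))) \<longlonglongrightarrow> (if t = 0 then 0 else deriv whitham_kernel t)"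
      proof (cases "t = 0")
        case False
        then show ?thesis
          using whitham_kernel_deriv_nonzero(1)[OF False] LIMSEQ_inverse_real_of_nat
          unfolding DERIV_def tendsto_at_iff_sequentially comp_def by (auto simp del: inverse_eq_divide of_nat_Suc)
      qed simp
    qed measurable
    then show ?thesis unfolding W_def by measurable
  qed
  have Wb: "\<bar>W t\<bar> \<le> diff_majorant A M t" for t
  proof (cases "t = 0")
    case False
    have "\<bar>W t\<bar> \<le> \<bar>t\<bar> powr (-3/2) * \<bar>G t\<bar>"
      unfolding W_def abs_mult using False whitham_kernel_deriv_nonzero(2)[OF False] by (intro mult_right_mono) auto
    then show ?thesis using G[of t] by simp
  qed (use A0 M0 in \<open>simp add: W_def diff_majorant_def\<close>)
  have Wi: "integrable lborel W"
    by (rule Bochner_Integration.integrable_bound[OF diff_majorant(1)[OF A0 M0]]) (use Wb order_trans[OF _ abs_ge_self] in \<open>auto intro!: AE_I2\<close>)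
  define D where "D = integral\<^sup>L lborel W"
  have "\<bar>D\<bar> \<le> integral\<^sup>L lborel (diff_majorant A M)"
    unfolding D_def using Bochner_Integration.integral_norm_bound_integral[OF Wi diff_majorant(1)[OF A0 M0]] Wb by simp
  then have Db: "\<bar>D\<bar> \<le> 8 * A + 8 * M" using diff_majorant(2)[OF A0 M0] by simp
  have "(whitham_op f has_real_derivative D) (at z)"
    unfolding DERIV_def tendsto_at_iff_sequentially comp_def
  proof (intro allI impI)
    fix h :: "nat \<Rightarrow> real" assume h: "\<forall>i. h i \<in> UNIV - {0}" "h \<longlonglongrightarrow> 0"
    then have h0: "h n \<noteq> 0" for n by auto
    define N where "N n = {t. \<bar>t\<bar> \<le> 2 * \<bar>h n\<bar>}" for n
    have [measurable]: "N n \<in> sets borel" for n unfolding N_def by measurable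
    define F where "F n t = (whitham_kernel (t + h n) - whitham_kernel t) * G t" for n t
    have Fi: "integrable lborel (F n)" for n
      unfolding F_def G_def by (rule whitham_op_increment(2)[OF f])
    have Fm [measurable]: "F n \<in> borel_measurable borel" for n using Fi by auto
    have Fin: "integrable lborel (\<lambda>t. F n t * indicator (N n) t)" "integrable lborel (\<lambda>t. F n t * indicator (- N n) t)" for n
      using Fi by (auto intro!: integrable_mult_bounded[where M = 1] simp: indicator_def)
    have q: "(whitham_op f (z + h n) - whitham_op f z) / h n = (LINT t|lborel. F n t * indicator (N n) t) / h n + (LINT t|lborel. F n t * indicator (- N n) t / h n)" for n
    proof -
      have "whitham_op f (z + h n) - whitham_op f z = (LINT t|lborel. F n t * indicator (N n) t + F n t * indicator (- N n) t)"
        unfolding whitham_op_increment(1)[OF f] by (intro Bochner_Integration.integral_cong) (auto simp: F_def G_def indicator_def)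
      also have "\<dots> = (LINT t|lborel. F n t * indicator (N n) t) + (LINT t|lborel. F n t * indicator (- N n) t)"
        by (rule Bochner_Integration.integral_add[OF Fin])
      finally show ?thesis by (simp add: add_divide_distrib)
    qed
    have "(\<lambda>n. (LINT t|lborel. F n t * indicator (N n) t) / h n) \<longlonglongrightarrow> 0"
    proof (rule Lim_null_comparison)
      show "\<forall>\<^sub>F n in sequentially. norm ((LINT t|lborel. F n t * indicator (N n) t) / h n) \<le> A * (2 powr (3/4) * 32) * \<bar>h n\<bar> powr (1/4)"
      proof (intro always_eventually allI)
        fix n
        define c where "c = A * (2 powr (3/4) * 32 * \<bar>h n\<bar> powr (3/4 + 1/2))"
        have "\<bar>LINT t|lborel. F n t * indicator (N n) t\<bar> \<le> c"
        proof (rule abs_integral_le_nn_integral[OF Fin(1)])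
          have "(\<integral>\<^sup>+t. ennreal \<bar>F n t * indicator (N n) t\<bar> \<partial>lborel) \<le> (\<integral>\<^sup>+t. ennreal A * (ennreal (\<bar>whitham_kernel (t + h n) - whitham_kernel t\<bar> * \<bar>t\<bar> powr (3/4)) * indicator {t. \<bar>t\<bar> \<le> 2 * \<bar>h n\<bar>} t) \<partial>lborel)"
          proof (rule nn_integral_mono)
            fix t
            have "\<bar>F n t\<bar> \<le> \<bar>whitham_kernel (t + h n) - whitham_kernel t\<bar> * (A * \<bar>t\<bar> powr (3/4))"
              unfolding F_def abs_mult G_def by (intro mult_left_mono A) auto
            then have "ennreal \<bar>F n t\<bar> \<le> ennreal A * ennreal (\<bar>whitham_kernel (t + h n) - whitham_kernel t\<bar> * \<bar>t\<bar> powr (3/4))"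
              using A0 by (subst ennreal_mult[symmetric]) (auto intro!: ennreal_leI simp: mult_ac)
            then show "ennreal \<bar>F n t * indicator (N n) t\<bar> \<le> ennreal A * (ennreal (\<bar>whitham_kernel (t + h n) - whitham_kernel t\<bar> * \<bar>t\<bar> powr (3/4)) * indicator {t. \<bar>t\<bar> \<le> 2 * \<bar>h n\<bar>} t)"
              by (auto simp: N_def indicator_def)
          qed
          also have "\<dots> = ennreal A * (\<integral>\<^sup>+t. (ennreal (\<bar>whitham_kernel (t + h n) - whitham_kernel t\<bar> * \<bar>t\<bar> powr (3/4)) * indicator {t. \<bar>t\<bar> \<le> 2 * \<bar>h n\<bar>} t) \<partial>lborel)"
            by (rule nn_integral_cmult) measurable
          also have "\<dots> \<le> ennreal A * ennreal (2 powr (3/4) * 32 * \<bar>h n\<bar> powr (3/4 + 1/2))"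
            by (intro mult_left_mono whitham_kernel_increment_near h0) auto
          also have "\<dots> = ennreal c" unfolding c_def using A0 by (subst ennreal_mult) auto
          finally show "(\<integral>\<^sup>+t. ennreal \<bar>F n t * indicator (N n) t\<bar> \<partial>lborel) \<le> ennreal c" .
        qed (use A0 in \<open>simp add: c_def\<close>)
        then have "norm ((LINT t|lborel. F n t * indicator (N n) t) / h n) \<le> c / \<bar>h n\<bar>"
          by (simp add: abs_divide divide_right_mono)
        also have "c / \<bar>h n\<bar> = A * (2 powr (3/4) * 32) * (\<bar>h n\<bar> powr (3/4 + 1/2) * \<bar>h n\<bar> powr (-1))"
        proof -
          have m1: "\<bar>h n\<bar> powr (-1) = 1 / \<bar>h n\<bar>" using powr_minus_divide[of "\<bar>h n\<bar>" 1] h0[of n] by simp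
          show ?thesis unfolding m1 by (simp add: c_def)
        qed
        also have "\<bar>h n\<bar> powr (3/4 + 1/2) * \<bar>h n\<bar> powr (-1) = \<bar>h n\<bar> powr (1/4)"
          unfolding powr_add[symmetric] by simp
        finally show "norm ((LINT t|lborel. F n t * indicator (N n) t) / h n) \<le> A * (2 powr (3/4) * 32) * \<bar>h n\<bar> powr (1/4)" .
      qed
      have "(\<lambda>n. \<bar>h n\<bar>) \<longlonglongrightarrow> 0" using h(2) by (simp add: tendsto_rabs_zero)
      then have "(\<lambda>n. \<bar>h n\<bar> powr (1/4)) \<longlonglongrightarrow> 0 powr (1/4)"
        by (intro tendsto_powr2) auto
      then show "(\<lambda>n. A * (2 powr (3/4) * 32) * \<bar>h n\<bar> powr (1/4)) \<longlonglongrightarrow> 0"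
        by (intro tendsto_mult_right_zero) simp
    qed
    moreover have "(\<lambda>n. LINT t|lborel. F n t * indicator (- N n) t / h n) \<longlonglongrightarrow> D"
      unfolding D_def
    proof (rule integral_dominated_convergence)
      show "integrable lborel (\<lambda>t. 2 powr (3/2) * diff_majorant A M t)" using diff_majorant(1)[OF A0 M0] by simp
      show "AE t in lborel. (\<lambda>n. F n t * indicator (- N n) t / h n) \<longlonglongrightarrow> W t"
      proof (use AE_lborel_singleton[of 0] in eventually_elim)
        fix t :: real assume t: "t \<noteq> 0"
        have "(\<lambda>n. (whitham_kernel (t + h n) - whitham_kernel t) / h n) \<longlonglongrightarrow> deriv whitham_kernel t"
          using whitham_kernel_deriv_nonzero(1)[OF t] h
          unfolding DERIV_def tendsto_at_iff_sequentially comp_def by auto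
        moreover have "W t = deriv whitham_kernel t * G t" using t by (simp add: W_def)
        ultimately have 1: "(\<lambda>n. (whitham_kernel (t + h n) - whitham_kernel t) / h n * G t) \<longlonglongrightarrow> W t"
          by (simp only: tendsto_mult[OF _ tendsto_const])
        have "(\<lambda>n. 2 * \<bar>h n\<bar>) \<longlonglongrightarrow> 0" using h(2) by (intro tendsto_mult_right_zero tendsto_rabs_zero)
        then have "\<forall>\<^sub>F n in sequentially. 2 * \<bar>h n\<bar> < \<bar>t\<bar>" by (rule order_tendstoD) (use t in auto)
        then have "\<forall>\<^sub>F n in sequentially. (whitham_kernel (t + h n) - whitham_kernel t) / h n * G t = F n t * indicator (- N n) t / h n"
          by (rule eventually_mono) (simp add: N_def F_def)
        with 1 show "(\<lambda>n. F n t * indicator (- N n) t / h n) \<longlonglongrightarrow> W t" by (rule Lim_transform_eventually)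
      qed
      show "AE t in lborel. norm (F n t * indicator (- N n) t / h n) \<le> 2 powr (3/2) * diff_majorant A M t" for n
      proof (rule AE_I2)
        fix t
        show "norm (F n t * indicator (- N n) t / h n) \<le> 2 powr (3/2) * diff_majorant A M t"
        proof (cases "t \<in> N n")
          case True then show ?thesis using A0 M0 by (simp add: diff_majorant_def)
        next
          case False
          then have "\<bar>whitham_kernel (t + h n) - whitham_kernel t\<bar> \<le> \<bar>h n\<bar> * (2 powr (3/2) * \<bar>t\<bar> powr (-3/2))"
            by (intro whitham_kernel_increment_far) (simp add: N_def)
          then have "\<bar>F n t\<bar> \<le> \<bar>h n\<bar> * (2 powr (3/2) * \<bar>t\<bar> powr (-3/2)) * \<bar>G t\<bar>"
            unfolding F_def abs_mult by (intro mult_right_mono) auto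
          then have "\<bar>F n t\<bar> / \<bar>h n\<bar> \<le> 2 powr (3/2) * (\<bar>t\<bar> powr (-3/2) * \<bar>G t\<bar>)"
            using h0[of n] by (simp add: divide_le_eq mult_ac)
          also have "\<dots> \<le> 2 powr (3/2) * diff_majorant A M t" by (intro mult_left_mono G) auto
          finally show ?thesis using False by (simp add: abs_divide)
        qed
      qed
    qed (use Wm in measurable)
    ultimately show "(\<lambda>n. (whitham_op f (z + h n) - whitham_op f z) / h n) \<longlonglongrightarrow> D"
      unfolding q using tendsto_add[of _ 0 sequentially _ D] by fastforce
  qed
  then show ?thesis using Db by blast
qed

section \<open>Convolution of odd periodic functions\<close>

text \<open>Kept as a finite symmetric sum: every estimate holds for each \<open>N\<close>, and
  \<open>N\<close> tends to infinity only in the integrals over windows.\<close>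

definition periodized_kernel :: "real \<Rightarrow> nat \<Rightarrow> real \<Rightarrow> real" where
  "periodized_kernel P N x = whitham_kernel x + (\<Sum>k=1..N. whitham_kernel (x - real k * P) + whitham_kernel (x + real k * P))"

lemma periodized_kernel_even: "periodized_kernel P N (- x) = periodized_kernel P N x"
proof -
  have "whitham_kernel (- x - c) + whitham_kernel (- x + c) = whitham_kernel (x - c) + whitham_kernel (x + c)" for c
  proof -
    have "- x - c = - (x + c)" "- x + c = - (x - c)" by simp_all
    then show ?thesis by (simp only: whitham_kernel_even add.commute)
  qed
  then show ?thesis by (simp add: periodized_kernel_def whitham_kernel_even)
qed

text \<open>Each summand below is symmetric about \<open>(k + 1/2) P\<close>, so that convexity compares its values at two
  points, although the periodised kernel is not a sum of monotone terms.\<close>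

lemma periodized_kernel_pairs:
  "periodized_kernel P N u = (\<Sum>k<N. whitham_kernel (real k * P + u) + whitham_kernel (real (Suc k) * P - u)) + whitham_kernel (real N * P + u)"
proof (induction N)
  case (Suc N)
  have "whitham_kernel (u - real (Suc N) * P) = whitham_kernel (real (Suc N) * P - u)"
    using whitham_kernel_even[of "u - real (Suc N) * P"] by simp
  then show ?case using Suc by (simp add: periodized_kernel_def algebra_simps)
qed (simp add: periodized_kernel_def)

text \<open>In the k-th pair, passing from v to u gains the drop of the kernel starting at k P + u
  and loses the drop of the same length starting at (k + 1) P - v. As u + v <= P, the former starts
  further left, and by convexity it is the larger. The second estimate keeps only the pair k = 0 and
  discards its positive term K (P - u).\<close>

lemma periodized_kernel_diff_ge:
  assumes u: "0 < u" "u \<le> v" "u + v \<le> P" "v < P"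
  shows "periodized_kernel P N v \<le> periodized_kernel P N u"
    "whitham_kernel u - whitham_kernel v - whitham_kernel (P - v) \<le> periodized_kernel P N u - periodized_kernel P N v"
proof -
  define p where "p k x = whitham_kernel (real k * P + x) + whitham_kernel (real (Suc k) * P - x)" for k x
  have pair: "p k v \<le> p k u" for k
  proof -
    have "whitham_kernel (real (Suc k) * P - v) - whitham_kernel (real (Suc k) * P - v + (v - u)) \<le> whitham_kernel (real k * P + u) - whitham_kernel (real k * P + u + (v - u))"
      using u by (intro whitham_kernel_convex) (auto simp: algebra_simps intro: add_pos_nonneg)
    then show ?thesis by (simp add: p_def algebra_simps)
  qed
  have last: "whitham_kernel (real N * P + v) \<le> whitham_kernel (real N * P + u)"
    using u by (intro whitham_kernel_decreasing) (auto intro: add_nonneg_pos)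
  have e: "periodized_kernel P N x = (\<Sum>k<N. p k x) + whitham_kernel (real N * P + x)" for x
    unfolding p_def by (rule periodized_kernel_pairs)
  show "periodized_kernel P N v \<le> periodized_kernel P N u"
    unfolding e by (intro add_mono sum_mono pair last)
  show "whitham_kernel u - whitham_kernel v - whitham_kernel (P - v) \<le> periodized_kernel P N u - periodized_kernel P N v"
  \<comment> \<open>For \<open>N = 0\<close> there is no pair to keep; the difference is exactly K u
    - K v, and subtracting the positive K (P - v) only weakens it.\<close>
  proof (cases N)
    case 0
    then show ?thesis using whitham_kernel_pos[of "P - v"] u by (simp add: periodized_kernel_def)
  next
    case (Suc N')
    have "(\<Sum>k<N. p k x) = p 0 x + (\<Sum>k=1..<N. p k x)" for x
      unfolding lessThan_atLeast0 using Suc by (subst sum.atLeast_Suc_lessThan) auto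
    moreover have "(\<Sum>k=1..<N. p k v) \<le> (\<Sum>k=1..<N. p k u)" by (intro sum_mono pair)
    ultimately have "p 0 u - p 0 v \<le> periodized_kernel P N u - periodized_kernel P N v"
      unfolding e using last by simp
    moreover have "whitham_kernel (P - u) > 0" using u by (intro whitham_kernel_pos) auto
    ultimately show ?thesis by (simp add: p_def)
  qed
qed

lemma whitham_kernel_gap:
  assumes "0 < u" "u \<le> b" "0 < g" "u + g \<le> v"
  shows "whitham_kernel b - whitham_kernel (b + g) \<le> whitham_kernel u - whitham_kernel v"
  using whitham_kernel_convex[of u b g] whitham_kernel_decreasing[of "u + g" v] assms by simp

text \<open>The window consists of exactly 2 N + 1 whole periods, which match the 2 N + 1 translates
  in the truncated kernel.\<close>

lemma integral_periodized:
  fixes E :: "real \<Rightarrow> real"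
  assumes int: "integrable lborel (\<lambda>c. whitham_kernel (z - c) * E c)"
    and per: "\<And>c. E (c + P) = E c" and P: "P > 0"
  shows "(\<lambda>c. periodized_kernel P N (z - c) * E c) integrable_on {-P/2..P/2}"
    "integral {-(real N * P + P/2)..real N * P + P/2} (\<lambda>c. whitham_kernel (z - c) * E c)
      = integral {-P/2..P/2} (\<lambda>c. periodized_kernel P N (z - c) * E c)"
proof -
  define g where "g = (\<lambda>c. whitham_kernel (z - c) * E c)"
  have gi: "g integrable_on {u..v}" for u v
  proof -
    have "set_integrable lborel {u..v} g"
      unfolding set_integrable_def using integrable_mult_indicator[OF _ int, of "{u..v}"] by (simp add: g_def)
    then show ?thesis by (rule set_borel_integral_eq_integral)
  qed
  have per': "E (c + real k * P) = E c" for c k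
  proof (induction k)
    case (Suc k)
    have "E (c + real (Suc k) * P) = E ((c + real k * P) + P)" by (simp add: algebra_simps)
    then show ?case using per Suc by simp
  qed simp
  have per'': "E (c - real k * P) = E c" for c k
    using per'[of "c - real k * P" k] by simp
  have sh: "(\<lambda>c. g (c + d)) integrable_on {-P/2..P/2}" "integral {-P/2..P/2} (\<lambda>c. g (c + d)) = integral {-P/2+d..P/2+d} g" for d
    using integrable_shift_real_ivl[OF gi[of "-P/2+d" "P/2+d"], of d] integral_shift_real_ivl[of "-P/2+d" d "P/2+d" g] by simp_all
  have step: "periodized_kernel P (Suc N) (z - c) * E c = periodized_kernel P N (z - c) * E c + (g (c + real (Suc N) * P) + g (c + (- (real (Suc N) * P))))" for c N
  proof -
    have "g (c + real (Suc N) * P) = whitham_kernel (z - c - real (Suc N) * P) * E c"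
      unfolding g_def per' by (simp add: algebra_simps)
    moreover have "g (c + (- (real (Suc N) * P))) = whitham_kernel (z - c + real (Suc N) * P) * E c"
      unfolding g_def using per''[of c "Suc N"] by (simp add: algebra_simps)
    ultimately show ?thesis by (simp add: periodized_kernel_def algebra_simps)
  qed
  have "(\<lambda>c. periodized_kernel P N (z - c) * E c) integrable_on {-P/2..P/2} \<and>
    integral {-(real N * P + P/2)..real N * P + P/2} g = integral {-P/2..P/2} (\<lambda>c. periodized_kernel P N (z - c) * E c)"
  proof (induction N)
    case 0
    then show ?case using gi by (simp add: periodized_kernel_def g_def)
  next
    case (Suc N)
    define L where "L = real N * P + P/2"
    define d where "d = real (Suc N) * P"
    have L: "L \<ge> 0" "L + P = d + P/2" using P by (auto simp: L_def d_def algebra_simps)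
    have i: "(\<lambda>c. periodized_kernel P (Suc N) (z - c) * E c) integrable_on {-P/2..P/2}"
      unfolding step
      by (rule Henstock_Kurzweil_Integration.integrable_add[OF conjunct1[OF Suc] Henstock_Kurzweil_Integration.integrable_add[OF sh(1) sh(1)]])
    have "integral {-(L+P)..L+P} g = integral {-(L+P)..-L} g + integral {-L..L+P} g"
      using L P by (intro Henstock_Kurzweil_Integration.integral_combine[symmetric] gi) auto
    also have "integral {-L..L+P} g = integral {-L..L} g + integral {L..L+P} g"
      using L P by (intro Henstock_Kurzweil_Integration.integral_combine[symmetric] gi) auto
    also have "integral {L..L+P} g = integral {-P/2..P/2} (\<lambda>c. g (c + d))"
    proof -
      have "-P/2 + d = L" "P/2 + d = L + P" using L by auto
      then show ?thesis using sh(2)[of d] by (simp only:)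
    qed
    also have "integral {-(L+P)..-L} g = integral {-P/2..P/2} (\<lambda>c. g (c + (- d)))"
    proof -
      have "-P/2 + (-d) = -(L+P)" "P/2 + (-d) = -L" using L by auto
      then show ?thesis using sh(2)[of "-d"] by (simp only:)
    qed
    also have "integral {-L..L} g = integral {-P/2..P/2} (\<lambda>c. periodized_kernel P N (z - c) * E c)"
      using Suc by (simp add: L_def)
    also have "integral {-P/2..P/2} (\<lambda>c. g (c + (- d))) + (integral {-P/2..P/2} (\<lambda>c. periodized_kernel P N (z - c) * E c) + integral {-P/2..P/2} (\<lambda>c. g (c + d)))
       = integral {-P/2..P/2} (\<lambda>c. periodized_kernel P N (z - c) * E c + (g (c + d) + g (c + (- d))))"
      using Henstock_Kurzweil_Integration.integral_add[OF conjunct1[OF Suc] Henstock_Kurzweil_Integration.integrable_add[OF sh(1)[of d] sh(1)[of "- d"]]]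
        Henstock_Kurzweil_Integration.integral_add[OF sh(1)[of d] sh(1)[of "- d"]] by simp
    also have "\<dots> = integral {-P/2..P/2} (\<lambda>c. periodized_kernel P (Suc N) (z - c) * E c)"
      unfolding step d_def ..
    also have "L + P = real (Suc N) * P + P/2" by (simp add: L_def algebra_simps)
    finally show ?case using i by simp
  qed
  then show "(\<lambda>c. periodized_kernel P N (z - c) * E c) integrable_on {-P/2..P/2}"
    "integral {-(real N * P + P/2)..real N * P + P/2} (\<lambda>c. whitham_kernel (z - c) * E c)
      = integral {-P/2..P/2} (\<lambda>c. periodized_kernel P N (z - c) * E c)"
    unfolding g_def by auto
qed

lemma integral_window_limit:
  fixes g :: "real \<Rightarrow> real"
  assumes g: "integrable lborel g" and L: "filterlim L at_top sequentially"
  shows "(\<lambda>n. integral {- L n..L n} g) \<longlonglongrightarrow> integral\<^sup>L lborel g"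
proof -
  have [measurable]: "g \<in> borel_measurable borel" using g by auto
  have s: "set_integrable lborel {- L n..L n} g" for n
    unfolding set_integrable_def using integrable_mult_indicator[OF _ g, of "{- L n..L n}"] by simp
  have "(\<lambda>n. LINT c|lborel. indicator {- L n..L n} c *\<^sub>R g c) \<longlonglongrightarrow> integral\<^sup>L lborel g"
  proof (rule integral_dominated_convergence)
    show "integrable lborel (\<lambda>c. norm (g c))" using g by simp
    show "AE c in lborel. (\<lambda>n. indicat_real {- L n..L n} c *\<^sub>R g c) \<longlonglongrightarrow> g c"
    proof (intro AE_I2 tendsto_eventually)
      fix c
      have "\<forall>\<^sub>F n in sequentially. \<bar>c\<bar> \<le> L n" using L by (simp add: filterlim_at_top)
      then show "\<forall>\<^sub>F n in sequentially. indicat_real {- L n..L n} c *\<^sub>R g c = g c"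
        by (rule eventually_mono) (auto simp: indicator_def)
    qed
  qed (auto simp: indicator_def)
  then show ?thesis
    using set_borel_integral_eq_integral(2)[OF s] by (simp add: set_lebesgue_integral_def)
qed

text \<open>Needed because the value of the kernel at 0 is a dummy.\<close>

lemma integral_remove_point:
  fixes h :: "real \<Rightarrow> real"
  shows "integral (A - {z}) h = integral A h" "h integrable_on A - {z} \<longleftrightarrow> h integrable_on A"
proof -
  have n1: "negligible {x \<in> (A - {z}) - A. h x \<noteq> 0}"
    by (rule negligible_subset[OF negligible_sing[of z]]) blast
  have n2: "negligible {x \<in> A - (A - {z}). h x \<noteq> 0}"
    by (rule negligible_subset[OF negligible_sing[of z]]) blast
  show "integral (A - {z}) h = integral A h" by (rule integral_spike_set[OF n1 n2])
  show "h integrable_on A - {z} \<longleftrightarrow> h integrable_on A"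
    unfolding integrable_on_def has_integral_spike_set_eq[OF n1 n2] ..
qed

text \<open>Oddness folds one period onto its negative half, where E >= 0 meets the difference of
  the periodised kernel at z - c and z + c. That difference is nonnegative throughout and at least d
  on the compact interval.\<close>

lemma convolution_odd_periodic_lower_bound:
  fixes E :: "real \<Rightarrow> real"
  assumes E: "continuous_on UNIV E" "\<And>c. \<bar>E c\<bar> \<le> M"
    and odd: "\<And>c. E (- c) = - E c" and per: "\<And>c. E (c + P) = E c"
    and pos: "\<And>c. -P/2 \<le> c \<Longrightarrow> c \<le> 0 \<Longrightarrow> 0 \<le> E c"
    and ab: "0 < a" "a \<le> b" "2 * b < P" and z: "-b \<le> z" "z \<le> -a"
    and d: "0 \<le> d" "d \<le> whitham_kernel b - whitham_kernel (b + 2 * a) - whitham_kernel (P - 2 * b)"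
  shows "d * integral {-b..-a} E \<le> (LINT c|lborel. whitham_kernel (z - c) * E c)"
proof -
  have [measurable]: "E \<in> borel_measurable borel" using E(1) by (rule borel_measurable_continuous_onI)
  have kz: "integrable lborel (\<lambda>c. whitham_kernel (z - c))"
    using lborel_integrable_real_affine[OF whitham_kernel_integrable(1), of "-1" z] by simp
  have int: "integrable lborel (\<lambda>c. whitham_kernel (z - c) * E c)"
    by (rule integrable_mult_bounded[OF kz _ E(2)]) simp
  have P: "P > 0" using ab by linarith
  have "d * integral {-b..-a} E \<le> integral {-(real N * P + P/2)..real N * P + P/2} (\<lambda>c. whitham_kernel (z - c) * E c)" for N
  proof -
    define F where "F = (\<lambda>c. periodized_kernel P N (z - c) * E c)"
    note ip = integral_periodized[OF int per P, of N, folded F_def]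
    have Fi: "F integrable_on {u..v}" if "-P/2 \<le> u" "v \<le> P/2" for u v
      using ip(1) that by (intro integrable_subinterval_real[OF ip(1)]) auto
    have Fr: "F (- c) = - periodized_kernel P N (z + c) * E c" for c
      by (simp add: F_def odd)
    define D where "D c = periodized_kernel P N (z - c) - periodized_kernel P N (z + c)" for c
    have FD: "F c + F (- c) = D c * E c" for c unfolding Fr by (simp add: F_def D_def algebra_simps)
    have i1: "F integrable_on {-P/2..0}" "F integrable_on {0..P/2}" using P by (auto intro!: Fi)
    have i2: "(\<lambda>c. F (- c)) integrable_on {-P/2..0}"
      using i1(2) Henstock_Kurzweil_Integration.integrable_reflect_real[where f = F and a = 0 and b = "P/2"] by simp
    have DEi: "(\<lambda>c. D c * E c) integrable_on {-P/2..0}"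
      unfolding FD[symmetric] by (intro Henstock_Kurzweil_Integration.integrable_add i1 i2)
    have "integral {-P/2..P/2} F = integral {-P/2..0} F + integral {0..P/2} F"
      using P ip(1) by (intro Henstock_Kurzweil_Integration.integral_combine[symmetric]) auto
    also have "integral {0..P/2} F = integral {-P/2..0} (\<lambda>c. F (- c))"
      using Henstock_Kurzweil_Integration.integral_reflect_real[where f = F and a = 0 and b = "P/2"] by simp
    also have "integral {-P/2..0} F + integral {-P/2..0} (\<lambda>c. F (- c)) = integral {-P/2..0} (\<lambda>c. D c * E c)"
      unfolding FD[symmetric] by (rule Henstock_Kurzweil_Integration.integral_add[symmetric, OF i1(1) i2])
    also have "\<dots> = integral ({-P/2..0} - {z}) (\<lambda>c. D c * E c)"
      by (rule integral_remove_point(1)[symmetric])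
    finally have W: "integral {-P/2..P/2} F = integral ({-P/2..0} - {z}) (\<lambda>c. D c * E c)" .
    have ge: "0 \<le> D c" "c \<in> {-b..-a} \<Longrightarrow> d \<le> D c" if c: "c \<in> {-P/2..0} - {z}" for c
    proof -
      \<comment> \<open>These are the difference and the sum of |z| and |c|. So u + v = 2 max |z|
        |c| is at most P, and v - u = 2 min |z| |c| is at least 2 a on the compact interval.\<close>
      define u v where "u = \<bar>z - c\<bar>" and "v = - (z + c)"
      have uv: "0 < u" "u \<le> v" "u + v \<le> P" "v < P"
        using c z ab by (auto simp: u_def v_def)
      have De: "D c = periodized_kernel P N u - periodized_kernel P N v"
        using periodized_kernel_even[of P N "z - c"] periodized_kernel_even[of P N "z + c"] by (simp add: D_def u_def v_def abs_if)
      show "0 \<le> D c" unfolding De using periodized_kernel_diff_ge(1)[OF uv] by simp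
      assume c': "c \<in> {-b..-a}"
      have "u \<le> b" "u + 2 * a \<le> v" using c' z ab by (auto simp: u_def v_def)
      then have 1: "whitham_kernel b - whitham_kernel (b + 2 * a) \<le> whitham_kernel u - whitham_kernel v"
        using uv ab by (intro whitham_kernel_gap) auto
      have "whitham_kernel (P - v) \<le> whitham_kernel (P - 2 * b)"
        using c' z ab by (intro whitham_kernel_decreasing) (auto simp: v_def)
      then show "d \<le> D c" using 1 d periodized_kernel_diff_ge(2)[OF uv, of N] unfolding De by linarith
    qed
    have sub: "{-b..-a} \<subseteq> {-P/2..0}" using ab by auto
    have Ei: "E integrable_on {u..v}" for u v
      using E(1) by (intro integrable_continuous_real) (auto intro: continuous_on_subset)
    have "d * integral {-b..-a} E = integral {-b..-a} (\<lambda>c. d * E c)" by simp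
    also have "\<dots> = integral ({-b..-a} - {z}) (\<lambda>c. d * E c)"
      by (rule integral_remove_point(1)[symmetric])
    also have "\<dots> \<le> integral ({-b..-a} - {z}) (\<lambda>c. D c * E c)"
    proof (rule integral_le)
      note rem = iffD2[OF integral_remove_point(2)]
      show "(\<lambda>c. d * E c) integrable_on {-b..-a} - {z}" using Ei by (intro rem integrable_on_mult_right)
      show "(\<lambda>c. D c * E c) integrable_on {-b..-a} - {z}"
        using integrable_subinterval_real[OF DEi sub] by (rule rem)
      fix c assume c: "c \<in> {-b..-a} - {z}"
      then have c0: "c \<in> {-P/2..0} - {z}" using sub by auto
      then have "0 \<le> E c" using pos by auto
      then show "d * E c \<le> D c * E c" using ge(2)[OF c0] c by (intro mult_right_mono) auto
    qed
    also have "\<dots> \<le> integral ({-P/2..0} - {z}) (\<lambda>c. D c * E c)"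
    proof (rule integral_subset_le)
      note rem = iffD2[OF integral_remove_point(2)]
      show "(\<lambda>c. D c * E c) integrable_on {-b..-a} - {z}"
        using integrable_subinterval_real[OF DEi sub] by (rule rem)
      show "(\<lambda>c. D c * E c) integrable_on {-P/2..0} - {z}" using DEi by (rule rem)
      show "\<forall>c\<in>{-P/2..0} - {z}. 0 \<le> D c * E c"
        using ge(1) pos by (intro ballI mult_nonneg_nonneg) auto
    qed (use sub in auto)
    finally show ?thesis using W ip(2) by (simp add: F_def)
  qed
  moreover have "(\<lambda>N. integral {-(real N * P + P/2)..real N * P + P/2} (\<lambda>c. whitham_kernel (z - c) * E c)) \<longlonglongrightarrow> (LINT c|lborel. whitham_kernel (z - c) * E c)"
  proof (rule integral_window_limit[OF int])
    have "filterlim (\<lambda>N. P * real N) at_top sequentially"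
      using P by (intro filterlim_tendsto_pos_mult_at_top[OF tendsto_const] filterlim_real_sequentially)
    then have "filterlim (\<lambda>N. P/2 + P * real N) at_top sequentially"
      by (intro filterlim_tendsto_add_at_top[OF tendsto_const])
    then show "filterlim (\<lambda>N. real N * P + P/2) at_top sequentially" by (simp add: add.commute mult.commute)
  qed
  ultimately show ?thesis by (intro LIMSEQ_le_const) auto
qed

section \<open>Hoelder classes\<close>

text \<open>Only the last derivative is Hoelder continuous. For \<open>\<alpha> = 0\<close> the Hoelder condition follows from
  boundedness (note that \<open>0 powr 0 = 0\<close>), so it leaves just measurability and boundedness.\<close>

primrec hoelder_class :: "nat \<Rightarrow> real \<Rightarrow> (real \<Rightarrow> real) \<Rightarrow> bool" where
  "hoelder_class 0 \<alpha> f \<longleftrightarrow> f \<in> borel_measurable borel \<and> (\<exists>M. \<forall>x. \<bar>f x\<bar> \<le> M) \<and> (\<exists>A. \<forall>x y. \<bar>f x - f y\<bar> \<le> A * \<bar>x - y\<bar> powr \<alpha>)"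
| "hoelder_class (Suc k) \<alpha> f \<longleftrightarrow> (\<exists>M. \<forall>x. \<bar>f x\<bar> \<le> M) \<and> (\<forall>x. f differentiable (at x)) \<and> hoelder_class k \<alpha> (deriv f)"

lemma hoelder_class_0I:
  "f \<in> borel_measurable borel \<Longrightarrow> (\<And>x. \<bar>f x\<bar> \<le> M) \<Longrightarrow> (\<And>x y. \<bar>f x - f y\<bar> \<le> A * \<bar>x - y\<bar> powr \<alpha>) \<Longrightarrow> hoelder_class 0 \<alpha> f"
  by auto

lemma hoelder_class_bounded: "hoelder_class k \<alpha> f \<Longrightarrow> \<exists>M. \<forall>x. \<bar>f x\<bar> \<le> M"
  by (cases k) auto

lemma hoelder_class_measurable: "hoelder_class k \<alpha> f \<Longrightarrow> f \<in> borel_measurable borel"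
proof (cases k)
  case (Suc j)
  assume "hoelder_class k \<alpha> f"
  then have "continuous_on UNIV f"
    using Suc by (auto intro!: differentiable_imp_continuous_on simp: differentiable_on_def)
  then show ?thesis by (rule borel_measurable_continuous_onI)
qed simp

lemma differentiable_deriv_measurable:
  fixes f :: "real \<Rightarrow> real"
  assumes "\<And>x. f differentiable (at x)"
  shows "deriv f \<in> borel_measurable borel"
proof (rule borel_measurable_LIMSEQ_real)
  have "continuous_on UNIV f" using assms by (auto intro!: differentiable_imp_continuous_on simp: differentiable_on_def)
  then have [measurable]: "f \<in> borel_measurable borel" by (rule borel_measurable_continuous_onI)
  show "(\<lambda>x. (f (x + inverse (real (Suc n))) - f x) / inverse (real (Suc n))) \<in> borel_measurable borel" for n
    by measurable
  fix x
  have "(f has_real_derivative deriv f x) (at x)"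
    using assms[of x] by (metis DERIV_imp_deriv real_differentiableE)
  then show "(\<lambda>n. (f (x + inverse (real (Suc n))) - f x) / inverse (real (Suc n))) \<longlonglongrightarrow> deriv f x"
    using LIMSEQ_inverse_real_of_nat unfolding DERIV_def tendsto_at_iff_sequentially comp_def by (auto simp del: inverse_eq_divide of_nat_Suc)
qed

lemma hoelder_class_deriv:
  assumes "hoelder_class (Suc k) \<alpha> f" shows "(f has_real_derivative deriv f x) (at x)"
  using assms by (metis DERIV_imp_deriv hoelder_class.simps(2) real_differentiableE)

lemma hoelder_interpolate:
  fixes f :: "real \<Rightarrow> real"
  assumes M: "\<And>x. \<bar>f x\<bar> \<le> M" and A: "\<And>x y. \<bar>x - y\<bar> \<le> 1 \<Longrightarrow> \<bar>f x - f y\<bar> \<le> A * \<bar>x - y\<bar> powr \<beta>" and \<alpha>: "0 \<le> \<alpha>" "\<alpha> \<le> \<beta>"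
  shows "\<bar>f x - f y\<bar> \<le> (\<bar>A\<bar> + 2 * M) * \<bar>x - y\<bar> powr \<alpha>"
proof -
  have M0: "0 \<le> M" using M[of 0] by linarith
  show ?thesis
  proof (cases "\<bar>x - y\<bar> \<le> 1")
    case True
    have "\<bar>f x - f y\<bar> \<le> A * \<bar>x - y\<bar> powr \<beta>" by (rule A[OF True])
    also have "\<dots> \<le> \<bar>A\<bar> * \<bar>x - y\<bar> powr \<alpha>"
      using True \<alpha> by (intro mult_mono powr_mono') auto
    also have "\<dots> \<le> (\<bar>A\<bar> + 2 * M) * \<bar>x - y\<bar> powr \<alpha>" using M0 by (intro mult_right_mono) auto
    finally show ?thesis .
  next
    case False
    have "\<bar>f x - f y\<bar> \<le> 2 * M" using M[of x] M[of y] by linarith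
    also have "\<dots> \<le> (\<bar>A\<bar> + 2 * M) * 1" by simp
    also have "\<dots> \<le> (\<bar>A\<bar> + 2 * M) * \<bar>x - y\<bar> powr \<alpha>"
      using False \<alpha> M0 by (intro mult_left_mono ge_one_powr_ge_zero) auto
    finally show ?thesis .
  qed
qed

lemma hoelder_class_exponent_mono:
  assumes "hoelder_class k \<beta> f" "0 \<le> \<alpha>" "\<alpha> \<le> \<beta>"
  shows "hoelder_class k \<alpha> f"
  using assms(1)
proof (induction k arbitrary: f)
  case 0
  then obtain M A where "\<And>x. \<bar>f x\<bar> \<le> M" "\<And>x y. \<bar>f x - f y\<bar> \<le> A * \<bar>x - y\<bar> powr \<beta>" by auto
  from hoelder_interpolate[OF this assms(2,3)] show ?case using 0 by auto
qed auto

lemma hoelder_class_Suc_imp: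
  assumes "hoelder_class (Suc k) \<alpha> f" "0 \<le> \<alpha>" "\<alpha> \<le> 1"
  shows "hoelder_class k \<alpha> f"
  using assms(1)
proof (induction k arbitrary: f)
  case 0
  then obtain M B where M: "\<And>x. \<bar>f x\<bar> \<le> M" and B: "\<And>x. \<bar>deriv f x\<bar> \<le> B" by auto
  have "\<bar>f x - f y\<bar> \<le> B * \<bar>x - y\<bar> powr 1" for x y
    using field_differentiable_bound[of UNIV f "deriv f" B x y] hoelder_class_deriv[OF 0] B by simp
  from hoelder_interpolate[OF M this assms(2,3)] show ?case using 0 hoelder_class_measurable[OF 0] by auto
qed auto

lemma hoelder_class_const: "hoelder_class k \<alpha> (\<lambda>x. c)"
proof (induction k arbitrary: c)
  case 0 show ?case by (rule hoelder_class_0I[of _ "\<bar>c\<bar>" 0]) auto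
next
  case (Suc k)
  have "deriv (\<lambda>x::real. c) = (\<lambda>x. 0)" by (auto intro!: DERIV_imp_deriv derivative_eq_intros)
  then show ?case using Suc by auto
qed

text \<open>Products and sums go through one induction because the derivative of a product is a sum
  of products one order lower.\<close>

lemma hoelder_class_mult_add:
  assumes "hoelder_class k \<alpha> f" "hoelder_class k \<alpha> g" "0 \<le> \<alpha>" "\<alpha> \<le> 1"
  shows "hoelder_class k \<alpha> (\<lambda>x. f x * g x) \<and> hoelder_class k \<alpha> (\<lambda>x. f x + g x)"
  using assms(1,2)
proof (induction k arbitrary: f g)
  case 0
  then obtain M A N B where M: "\<And>x. \<bar>f x\<bar> \<le> M" and A: "\<And>x y. \<bar>f x - f y\<bar> \<le> A * \<bar>x - y\<bar> powr \<alpha>"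
    and N: "\<And>x. \<bar>g x\<bar> \<le> N" and B: "\<And>x y. \<bar>g x - g y\<bar> \<le> B * \<bar>x - y\<bar> powr \<alpha>" by auto
  have mn: "0 \<le> M" "0 \<le> N" using M[of 0] N[of 0] by auto
  have p: "\<bar>f x * g x\<bar> \<le> M * N" for x unfolding abs_mult by (intro mult_mono M N mn) auto
  have pd: "\<bar>f x * g x - f y * g y\<bar> \<le> (M * B + A * N) * \<bar>x - y\<bar> powr \<alpha>" for x y
  proof -
    have "\<bar>f x * g x - f y * g y\<bar> = \<bar>f x * (g x - g y) + (f x - f y) * g y\<bar>" by (simp add: algebra_simps)
    also have "\<dots> \<le> \<bar>f x\<bar> * \<bar>g x - g y\<bar> + \<bar>f x - f y\<bar> * \<bar>g y\<bar>" by (metis abs_mult abs_triangle_ineq)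
    also have "\<dots> \<le> M * (B * \<bar>x - y\<bar> powr \<alpha>) + (A * \<bar>x - y\<bar> powr \<alpha>) * N"
      by (intro add_mono mult_mono M N A B mn) (use A[of x y] in auto)
    finally show ?thesis by (simp add: algebra_simps)
  qed
  have s: "\<bar>f x + g x\<bar> \<le> M + N" for x using M[of x] N[of x] by linarith
  have sd: "\<bar>(f x + g x) - (f y + g y)\<bar> \<le> (A + B) * \<bar>x - y\<bar> powr \<alpha>" for x y
    using A[of x y] B[of x y] unfolding distrib_right by linarith
  have "f \<in> borel_measurable borel" "g \<in> borel_measurable borel" using 0 by auto
  then show ?case using p pd s sd unfolding hoelder_class.simps by (intro conjI exI allI) (auto intro!: borel_measurable_times borel_measurable_add)
next
  case (Suc k)
  note df = hoelder_class_deriv[OF Suc.prems(1)] and dg = hoelder_class_deriv[OF Suc.prems(2)]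
  note f = hoelder_class_Suc_imp[OF Suc.prems(1) assms(3,4)] and g = hoelder_class_Suc_imp[OF Suc.prems(2) assms(3,4)]
  have f': "hoelder_class k \<alpha> (deriv f)" and g': "hoelder_class k \<alpha> (deriv g)" using Suc.prems by auto
  have d1: "((\<lambda>x. f x * g x) has_real_derivative deriv f x * g x + f x * deriv g x) (at x)" for x
    using DERIV_mult[OF df dg, of x] by (simp add: mult.commute add.commute)
  have d2: "((\<lambda>x. f x + g x) has_real_derivative deriv f x + deriv g x) (at x)" for x
    by (rule DERIV_add[OF df dg])
  have e1: "deriv (\<lambda>x. f x * g x) = (\<lambda>x. deriv f x * g x + f x * deriv g x)" using d1 by (auto intro!: DERIV_imp_deriv)
  have e2: "deriv (\<lambda>x. f x + g x) = (\<lambda>x. deriv f x + deriv g x)" using d2 by (auto intro!: DERIV_imp_deriv)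
  obtain M N where M: "\<And>x. \<bar>f x\<bar> \<le> M" and N: "\<And>x. \<bar>g x\<bar> \<le> N" using Suc.prems by auto
  have mn: "0 \<le> M" "0 \<le> N" using M[of 0] N[of 0] by auto
  have p: "\<bar>f x * g x\<bar> \<le> M * N" for x unfolding abs_mult by (intro mult_mono M N mn) auto
  have s: "\<bar>f x + g x\<bar> \<le> M + N" for x using M[of x] N[of x] by linarith
  have h1: "hoelder_class k \<alpha> (\<lambda>x. deriv f x * g x + f x * deriv g x)"
    using Suc.IH[OF f' g] Suc.IH[OF f g'] Suc.IH by blast
  have h2: "hoelder_class k \<alpha> (\<lambda>x. deriv f x + deriv g x)" using Suc.IH[OF f' g'] by blast
  show ?case unfolding hoelder_class.simps e1 e2
    using p s h1 h2 real_differentiable_def d1 d2 by (intro conjI allI) blast+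
qed

lemmas hoelder_class_mult = hoelder_class_mult_add[THEN conjunct1]
lemmas hoelder_class_add = hoelder_class_mult_add[THEN conjunct2]

text \<open>The derivative is written as a product of -1, the derivative of g and two factors 1 / g,
  all available one order lower.\<close>

lemma hoelder_class_inverse:
  assumes "hoelder_class k \<alpha> g" "0 \<le> \<alpha>" "\<alpha> \<le> 1" and \<gamma>: "0 < \<gamma>" "\<And>x. \<gamma> \<le> g x"
  shows "hoelder_class k \<alpha> (\<lambda>x. 1 / g x)"
  using assms(1)
proof (induction k)
  have gp: "0 < g x" for x using \<gamma>(1) \<gamma>(2)[of x] by linarith
  have b: "\<bar>1 / g x\<bar> \<le> 1 / \<gamma>" for x using gp[of x] \<gamma> by (simp add: frac_le)
  {
    case 0
    then obtain A where A: "\<And>x y. \<bar>g x - g y\<bar> \<le> A * \<bar>x - y\<bar> powr \<alpha>" by auto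
    have "\<bar>1 / g x - 1 / g y\<bar> \<le> (A / \<gamma>\<^sup>2) * \<bar>x - y\<bar> powr \<alpha>" for x y
    proof -
      have "\<bar>1 / g x - 1 / g y\<bar> = \<bar>g x - g y\<bar> / (g x * g y)"
        using gp[of x] gp[of y] by (simp add: field_simps abs_mult abs_minus_commute)
      also have "\<dots> \<le> (A * \<bar>x - y\<bar> powr \<alpha>) / (\<gamma> * \<gamma>)"
        using gp \<gamma> A[of x y] by (intro frac_le mult_mono) (auto intro: less_imp_le)
      finally show ?thesis by (simp add: power2_eq_square)
    qed
    moreover have "(\<lambda>x. 1 / g x) \<in> borel_measurable borel"
    proof -
      have [measurable]: "g \<in> borel_measurable borel" using 0 by simp
      show ?thesis by measurable
    qed
    ultimately show ?case using b by (intro hoelder_class_0I)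
  next
    case (Suc k)
    have d: "((\<lambda>x. 1 / g x) has_real_derivative (-1 * deriv g x) * ((1 / g x) * (1 / g x))) (at x)" for x
      using hoelder_class_deriv[OF Suc.prems, of x] gp[of x] by (auto intro!: derivative_eq_intros simp: divide_inverse)
    have e: "deriv (\<lambda>x. 1 / g x) = (\<lambda>x. (-1 * deriv g x) * ((1 / g x) * (1 / g x)))" using d by (auto intro!: DERIV_imp_deriv)
    have "hoelder_class k \<alpha> (\<lambda>x. 1 / g x)" by (rule Suc.IH[OF hoelder_class_Suc_imp[OF Suc.prems assms(2,3)]])
    moreover have "hoelder_class k \<alpha> (deriv g)" using Suc.prems by simp
    ultimately have "hoelder_class k \<alpha> (\<lambda>x. (-1 * deriv g x) * ((1 / g x) * (1 / g x)))"
      by (intro hoelder_class_mult assms(2,3) hoelder_class_const)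
    then show ?case unfolding hoelder_class.simps e using b d by (auto simp: real_differentiable_def)
  }
qed

text \<open>The derivative of g is that of F times 1 / (2 g), so one order of g and of its
  reciprocal suffices for the next order of g. The root is given through its square because it will
  be \<nu>/2 - f.\<close>

lemma hoelder_class_sqrt:
  assumes "hoelder_class k \<alpha> F" "0 \<le> \<alpha>" "\<alpha> \<le> 1" and \<gamma>: "0 < \<gamma>" "\<And>x. \<gamma> \<le> g x" and F: "\<And>x. (g x)\<^sup>2 = F x"
  shows "hoelder_class k \<alpha> g"
  using assms(1)
proof (induction k)
  have gp: "0 < g x" for x using \<gamma>(1) \<gamma>(2)[of x] by linarith
  have gs: "g = (\<lambda>x. sqrt (F x))" using gp F by (metis abs_of_pos real_sqrt_abs)
  {
    case 0
    then obtain M A where M: "\<And>x. \<bar>F x\<bar> \<le> M" and A: "\<And>x y. \<bar>F x - F y\<bar> \<le> A * \<bar>x - y\<bar> powr \<alpha>" by auto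
    have b: "\<bar>g x\<bar> \<le> sqrt M" for x
    proof -
      have "\<bar>g x\<bar> = sqrt (F x)" using gp[of x] fun_cong[OF gs, of x] by linarith
      moreover have "F x \<le> M" using M[of x] by linarith
      ultimately show ?thesis by simp
    qed
    have "\<bar>g x - g y\<bar> \<le> (A / \<gamma>) * \<bar>x - y\<bar> powr \<alpha>" for x y
    proof -
      have "\<bar>g x - g y\<bar> * \<gamma> \<le> \<bar>g x - g y\<bar> * (g x + g y)" using \<gamma>(2)[of x] gp[of y] by (intro mult_left_mono) auto
      also have "\<dots> = \<bar>F x - F y\<bar>"
        unfolding F[symmetric] using gp[of x] gp[of y] by (simp add: power2_eq_square square_diff_square_factored abs_mult mult.commute)
      also have "\<dots> \<le> A * \<bar>x - y\<bar> powr \<alpha>" by (rule A)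
      finally show ?thesis using \<gamma>(1) by (simp add: field_simps)
    qed
    moreover have "g \<in> borel_measurable borel"
    proof -
      have [measurable]: "F \<in> borel_measurable borel" using 0 by simp
      show ?thesis unfolding gs by measurable
    qed
    ultimately show ?case using b by (intro hoelder_class_0I)
  next
    case (Suc k)
    have Fp: "0 < F x" for x using gp[of x] F[of x] by (metis zero_less_power)
    have d: "(g has_real_derivative deriv F x * ((1 / 2) * (1 / g x))) (at x)" for x
      unfolding gs using hoelder_class_deriv[OF Suc.prems, of x] Fp[of x] by (auto intro!: derivative_eq_intros simp: field_simps)
    have e: "deriv g = (\<lambda>x. deriv F x * ((1 / 2) * (1 / g x)))" using d by (auto intro!: DERIV_imp_deriv)
    have g: "hoelder_class k \<alpha> g" by (rule Suc.IH[OF hoelder_class_Suc_imp[OF Suc.prems assms(2,3)]])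
    have "hoelder_class k \<alpha> (deriv F)" using Suc.prems by simp
    then have "hoelder_class k \<alpha> (\<lambda>x. deriv F x * ((1 / 2) * (1 / g x)))"
      by (intro hoelder_class_mult assms(2,3) hoelder_class_const hoelder_class_inverse[OF g _ _ \<gamma>])
    then show ?case unfolding hoelder_class.simps e using hoelder_class_bounded[OF g] d by (auto simp: real_differentiable_def)
  }
qed

section \<open>The convolution operator on Hoelder classes\<close>

lemma whitham_op_bound:
  assumes "f \<in> borel_measurable borel" "\<And>x. \<bar>f x\<bar> \<le> M"
  shows "\<bar>whitham_op f x\<bar> \<le> M"
proof -
  have [measurable]: "f \<in> borel_measurable borel" by fact
  have i: "integrable lborel (\<lambda>t. whitham_kernel t * f (x - t))"
    by (rule integrable_mult_bounded[OF whitham_kernel_integrable(1) _ assms(2)]) simp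
  have "\<bar>LINT t|lborel. whitham_kernel t * f (x - t)\<bar> \<le> (LINT t|lborel. \<bar>whitham_kernel t * f (x - t)\<bar>)"
    using integral_norm_bound[of lborel "\<lambda>t. whitham_kernel t * f (x - t)"] by simp
  also have "\<dots> \<le> (LINT t|lborel. whitham_kernel t * M)"
  proof (rule integral_mono_AE)
    show "AE t in lborel. \<bar>whitham_kernel t * f (x - t)\<bar> \<le> whitham_kernel t * M"
      using AE_lborel_singleton[of 0]
    proof eventually_elim
      case (elim t)
      then show ?case using whitham_kernel_pos[of t] assms(2)[of "x - t"] by (simp add: abs_mult mult_left_mono)
    qed
  qed (use i whitham_kernel_integrable in auto)
  also have "\<dots> = M" using whitham_kernel_integrable by simp
  finally show ?thesis by (simp add: whitham_op_eq)
qed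

lemma whitham_op_deriv:
  assumes f: "\<And>x. (f has_real_derivative f' x) (at x)" and b: "\<And>x. \<bar>f x\<bar> \<le> M" "\<And>x. \<bar>f' x\<bar> \<le> B"
    and [measurable]: "f \<in> borel_measurable borel" "f' \<in> borel_measurable borel"
  shows "(whitham_op f has_real_derivative whitham_op f' x) (at x)"
  unfolding DERIV_def tendsto_at_iff_sequentially comp_def
proof (intro allI impI)
  fix h :: "nat \<Rightarrow> real" assume h: "\<forall>i. h i \<in> UNIV - {0}" "h \<longlonglongrightarrow> 0"
  have h0: "h n \<noteq> 0" for n using h by auto
  have "(\<lambda>n. LINT t|lborel. whitham_kernel t * ((f (x - t + h n) - f (x - t)) / h n)) \<longlonglongrightarrow> (LINT t|lborel. whitham_kernel t * f' (x - t))"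
  proof (rule integral_dominated_convergence)
    show "integrable lborel (\<lambda>t. \<bar>whitham_kernel t\<bar> * B)" using whitham_kernel_integrable by auto
    show "AE t in lborel. (\<lambda>n. whitham_kernel t * ((f (x - t + h n) - f (x - t)) / h n)) \<longlonglongrightarrow> whitham_kernel t * f' (x - t)"
      using f h unfolding DERIV_def tendsto_at_iff_sequentially comp_def by (intro AE_I2 tendsto_intros) auto
    show "AE t in lborel. norm (whitham_kernel t * ((f (x - t + h n) - f (x - t)) / h n)) \<le> \<bar>whitham_kernel t\<bar> * B" for n
    proof (rule AE_I2)
      fix t
      have "\<bar>f (x - t + h n) - f (x - t)\<bar> \<le> B * \<bar>h n\<bar>"
        using field_differentiable_bound[of UNIV f f' B "x - t + h n" "x - t"] f b by simp
      then have "\<bar>(f (x - t + h n) - f (x - t)) / h n\<bar> \<le> B" using h0[of n] by (simp add: abs_divide divide_le_eq)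
      then show "norm (whitham_kernel t * ((f (x - t + h n) - f (x - t)) / h n)) \<le> \<bar>whitham_kernel t\<bar> * B"
        unfolding real_norm_def abs_mult by (intro mult_left_mono) auto
    qed
  qed measurable
  moreover have "(LINT t|lborel. whitham_kernel t * ((f (x - t + h n) - f (x - t)) / h n)) = (whitham_op f (x + h n) - whitham_op f x) / h n" for n
  proof -
    have i: "integrable lborel (\<lambda>t. whitham_kernel t * f (y - t))" for y
      by (rule integrable_mult_bounded[OF whitham_kernel_integrable(1) _ b(1)]) simp
    have "whitham_op f (x + h n) - whitham_op f x = (LINT t|lborel. whitham_kernel t * f (x + h n - t) - whitham_kernel t * f (x - t))"
      unfolding whitham_op_eq by (rule Bochner_Integration.integral_diff[symmetric, OF i i])
    then show ?thesis by (simp add: diff_divide_distrib right_diff_distrib algebra_simps flip: integral_divide_zero)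
  qed
  ultimately show "(\<lambda>n. (whitham_op f (x + h n) - whitham_op f x) / h n) \<longlonglongrightarrow> whitham_op f' x"
    by (simp only: whitham_op_eq[of f' x])
qed

lemma whitham_op_measurable:
  assumes [measurable]: "f \<in> borel_measurable borel"
  shows "whitham_op f \<in> borel_measurable borel"
  unfolding whitham_op_def[abs_def] by measurable

lemma hoelder_class_op_deriv:
  assumes "hoelder_class (Suc k) \<alpha> f"
  shows "(whitham_op f has_real_derivative whitham_op (deriv f) x) (at x)"
proof -
  obtain M B where "\<And>x. \<bar>f x\<bar> \<le> M" "\<And>x. \<bar>deriv f x\<bar> \<le> B"
    using assms hoelder_class_bounded[of k \<alpha> "deriv f"] by auto
  then show ?thesis using hoelder_class_deriv[OF assms] hoelder_class_measurable[OF assms] hoelder_class_measurable[of k \<alpha> "deriv f"] assms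
    by (intro whitham_op_deriv) auto
qed

text \<open>Convolution commutes with differentiation, so the gain of one half is spent on the last
  derivative.\<close>

lemma hoelder_class_op:
  assumes \<beta>: "0 \<le> \<beta>" "\<beta> < 1/2" and "hoelder_class k \<beta> f"
  shows "hoelder_class k (\<beta> + 1/2) (whitham_op f)"
  using assms(3)
proof (induction k arbitrary: f)
  case 0
  then obtain M A where M: "\<And>x. \<bar>f x\<bar> \<le> M" and A: "\<And>x y. \<bar>f x - f y\<bar> \<le> A * \<bar>x - y\<bar> powr \<beta>" and f: "f \<in> borel_measurable borel" by auto
  have "\<bar>whitham_op f x - whitham_op f y\<bar> \<le> ((64 + 8 / (1/2 - \<beta>)) * A) * \<bar>x - y\<bar> powr (\<beta> + 1/2)" for x y
  proof -
    have "\<bar>f (y - t) - f y\<bar> \<le> A * \<bar>t\<bar> powr \<beta>" for t using A[of "y - t" y] by simp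
    from whitham_op_hoelder_gain[OF f M \<beta> this, of "x - y"] show ?thesis by simp
  qed
  then show ?case unfolding hoelder_class.simps
    using whitham_op_bound[OF f M] whitham_op_measurable[OF f] by (intro conjI exI allI) auto
next
  case (Suc k)
  obtain M where M: "\<And>x. \<bar>f x\<bar> \<le> M" using hoelder_class_bounded[OF Suc.prems] by auto
  have e: "deriv (whitham_op f) = whitham_op (deriv f)" using hoelder_class_op_deriv[OF Suc.prems] by (auto intro!: DERIV_imp_deriv)
  show ?case unfolding hoelder_class.simps e
    using hoelder_class_op_deriv[OF Suc.prems] whitham_op_bound[OF hoelder_class_measurable[OF Suc.prems] M] Suc
    by (auto simp: real_differentiable_def)
qed

text \<open>Since 3/4 + 1/2 exceeds 1, the gain yields a whole further derivative. The surplus 1/4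
  is given up: only measurability and boundedness of the new derivative are recorded.\<close>

lemma hoelder_class_op_differentiable:
  assumes "hoelder_class k (3/4) f"
  shows "hoelder_class (Suc k) 0 (whitham_op f)"
  using assms
proof (induction k arbitrary: f)
  case 0
  then obtain M A where M: "\<And>x. \<bar>f x\<bar> \<le> M" and A: "\<And>x y. \<bar>f x - f y\<bar> \<le> A * \<bar>x - y\<bar> powr (3/4)" and f: "f \<in> borel_measurable borel" by auto
  have D: "\<exists>D. (whitham_op f has_real_derivative D) (at x) \<and> \<bar>D\<bar> \<le> 8 * A + 8 * M" for x
  proof -
    have "\<bar>f (x - t) - f x\<bar> \<le> A * \<bar>t\<bar> powr (3/4)" for t using A[of "x - t" x] by simp
    from whitham_op_differentiable[OF f M this] show ?thesis .
  qed
  have d: "whitham_op f differentiable (at x)" for x using D by (auto simp: real_differentiable_def)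
  have b: "\<bar>deriv (whitham_op f) x\<bar> \<le> 8 * A + 8 * M" for x using D[of x] DERIV_imp_deriv by auto
  have "\<bar>deriv (whitham_op f) x - deriv (whitham_op f) y\<bar> \<le> 2 * (8 * A + 8 * M) * \<bar>x - y\<bar> powr 0" for x y
    using b[of x] b[of y] by (cases "x = y") auto
  then have "hoelder_class 0 0 (deriv (whitham_op f))"
    using b differentiable_deriv_measurable[OF d] by (intro hoelder_class_0I)
  then show ?case unfolding hoelder_class.simps(2)
    using d whitham_op_bound[OF f M] by blast
next
  case (Suc k)
  obtain M where M: "\<And>x. \<bar>f x\<bar> \<le> M" using hoelder_class_bounded[OF Suc.prems] by auto
  have e: "deriv (whitham_op f) = whitham_op (deriv f)" using hoelder_class_op_deriv[OF Suc.prems] by (auto intro!: DERIV_imp_deriv)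
  have "hoelder_class (Suc k) 0 (whitham_op (deriv f))" using Suc.IH[of "deriv f"] Suc.prems by simp
  then show ?case unfolding hoelder_class.simps(2)[of "Suc k"] e
    using hoelder_class_op_deriv[OF Suc.prems] whitham_op_bound[OF hoelder_class_measurable[OF Suc.prems] M]
    by (auto simp: real_differentiable_def)
qed

lemma hoelder_class_imp_differentiable:
  "hoelder_class (Suc k) \<alpha> f \<Longrightarrow> (deriv ^^ k) f differentiable (at x)"
proof (induction k arbitrary: f)
  case (Suc k)
  then have "(deriv ^^ k) (deriv f) differentiable (at x)" by simp
  then show ?case by (simp add: funpow_Suc_right del: funpow.simps)
qed simp

section \<open>Admissible periodic solutions\<close>

lemma hoelder_space_continuous:
  assumes "f \<in> hoelder_space \<alpha>" "\<alpha> > 0"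
  shows "continuous_on UNIV f"
proof -
  obtain C where C: "\<And>x y. \<bar>f x - f y\<bar> \<le> C * \<bar>x - y\<bar> powr \<alpha>"
    using assms(1) by (auto simp: hoelder_space_def)
  have "isCont f x" for x
  proof -
    have "((\<lambda>y. C * \<bar>y - x\<bar> powr \<alpha>) \<longlongrightarrow> C * \<bar>x - x\<bar> powr \<alpha>) (at x)"
      using assms(2) by (intro tendsto_intros tendsto_powr2) auto
    then have "((\<lambda>y. C * \<bar>y - x\<bar> powr \<alpha>) \<longlongrightarrow> 0) (at x)" by simp
    then have "((\<lambda>y. f y - f x) \<longlongrightarrow> 0) (at x)"
      by (rule Lim_null_comparison[rotated]) (use C in auto)
    then show ?thesis unfolding isCont_def by (rule LIM_zero_cancel)
  qed
  then show ?thesis by (simp add: continuous_on_eq_continuous_at)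
qed

lemma solution_square_eq:
  assumes "whitham_solution_pair f \<mu>"
  shows "(\<mu> / 2 - f x)\<^sup>2 = \<mu>\<^sup>2 / 4 - whitham_op f x"
  using assms[unfolded whitham_solution_pair_def, rule_format, of x] by (simp add: power2_eq_square algebra_simps)

text \<open>For p, q >= 0 one has (p - q)^2 <= |p^2 - q^2|, so the modulus of L f passes to f at the
  price of a square root. The constant does not involve \<mu>, and no distance from \<mu>/2 is
  needed: the family is equicontinuous even at highest crests.\<close>

lemma solution_hoelder:
  assumes f: "f \<in> borel_measurable borel" "\<And>t. \<bar>f t\<bar> \<le> 1" and s: "whitham_solution_pair f \<mu>"
    and le: "\<And>x. f x \<le> \<mu> / 2"
  shows "\<bar>f x - f y\<bar> \<le> sqrt (160 * \<bar>x - y\<bar> powr (1/2))"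
proof (rule real_le_rsqrt)
  define p q where "p = \<mu> / 2 - f x" and "q = \<mu> / 2 - f y"
  have pq: "0 \<le> p" "0 \<le> q" using le by (auto simp: p_def q_def)
  have "\<bar>f x - f y\<bar>\<^sup>2 = \<bar>p - q\<bar> * \<bar>p - q\<bar>" by (simp add: p_def q_def power2_eq_square abs_minus_commute)
  also have "\<dots> \<le> \<bar>p - q\<bar> * (p + q)" using pq by (intro mult_left_mono) auto
  also have "\<dots> = \<bar>p\<^sup>2 - q\<^sup>2\<bar>"
    using pq by (simp add: power2_eq_square square_diff_square_factored abs_mult mult.commute)
  also have "p\<^sup>2 - q\<^sup>2 = - (whitham_op f x - whitham_op f y)"
    unfolding p_def q_def solution_square_eq[OF s] by simp
  also have "\<bar>\<dots>\<bar> \<le> 160 * \<bar>x - y\<bar> powr (1/2)"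
    using whitham_op_hoelder_half[OF f, of x y] by simp
  finally show "\<bar>f x - f y\<bar>\<^sup>2 \<le> 160 * \<bar>x - y\<bar> powr (1/2)" .
qed

lemma admissible_pair_facts:
  assumes "admissible_pair P \<kappa> f \<mu>"
  shows "continuous_on UNIV f" "f \<in> borel_measurable borel" "\<And>x. \<bar>f x\<bar> \<le> 1" "\<And>x. f x \<le> \<mu> / 2"
    "\<And>x. f (x + P) = f x" "\<And>x. f (- x) = f x" "whitham_solution_pair f \<mu>" "0 < P"
proof -
  have A: "0 < P" "0 < \<kappa>" "\<kappa> \<le> 1" "f \<in> hoelder_space (1/2)" "periodic_fun_simple f P" "whitham_solution_pair f \<mu>"
     "0 < \<mu>" "\<mu> \<le> 1" "\<And>x. \<mu> - 1 \<le> f x" "\<And>x. f x \<le> f 0" "even_fun f" "f 0 = \<kappa> * \<mu> / 2"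
    using assms unfolding admissible_pair_def by blast+
  show c: "continuous_on UNIV f" using A(4) by (rule hoelder_space_continuous) simp
  then show "f \<in> borel_measurable borel" by (rule borel_measurable_continuous_onI)
  have "\<kappa> * \<mu> \<le> 1 * \<mu>" using A by (intro mult_right_mono) auto
  then have k: "\<kappa> * \<mu> / 2 \<le> \<mu> / 2" by simp
  show le: "f x \<le> \<mu> / 2" for x using A(10)[of x] A(12) k by linarith
  show "\<bar>f x\<bar> \<le> 1" for x using le[of x] A(9)[of x] A(7,8) by (simp add: abs_le_iff)
  interpret periodic_fun_simple f P by fact
  show "f (x + P) = f x" for x by (rule plus_period)
  show "f (- x) = f x" for x using A(11) by (simp add: even_fun_def)
  show "whitham_solution_pair f \<mu>" "0 < P" by fact+
qed

text \<open>Monotonicity is given only on the open half-period. Both points are contracted towards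
  its midpoint -P/4, compared there, and released by continuity.\<close>

lemma admissible_pair_mono:
  assumes ad: "admissible_pair P \<kappa> f \<mu>" and xy: "-P/2 \<le> x" "x \<le> y" "y \<le> 0"
  shows "f x \<le> f y"
proof (cases "x = y")
  case False
  have P: "0 < P" using ad by (simp add: admissible_pair_def)
  have sm: "strict_mono_on {- P / 2<..<0} f" using ad by (simp add: admissible_pair_def)
  define m where "m = - P / 4"
  define X where "X s = x + s * (m - x)" for s
  define Y where "Y s = y + s * (m - y)" for s
  have "f (X s) \<le> f (Y s)" if s: "s \<in> {0<..<1}" for s
  proof -
    have *: "t + s * (m - t) \<in> {- P / 2<..<0}" if "-P/2 \<le> t" "t \<le> 0" for t
    proof -
      have e: "t + s * (m - t) = (1 - s) * t + s * m" by (simp add: algebra_simps)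
      have "(1 - s) * (-P/2) \<le> (1 - s) * t" "(1 - s) * t \<le> 0"
        using that s by (intro mult_left_mono mult_nonneg_nonpos; simp)+
      moreover have "s * (-P/2) < s * m" "s * m < s * 0" using s P by (auto simp: m_def intro!: mult_strict_left_mono)
      moreover have "(1 - s) * (-P/2) + s * (-P/2) = -P/2" by (simp add: algebra_simps)
      ultimately show ?thesis unfolding e by auto
    qed
    have "X s < Y s"
    proof -
      have "Y s - X s = (1 - s) * (y - x)" by (simp add: X_def Y_def algebra_simps)
      also have "\<dots> > 0" using s False xy by (intro mult_pos_pos) auto
      finally show ?thesis by simp
    qed
    moreover have "X s \<in> {- P / 2<..<0}" "Y s \<in> {- P / 2<..<0}" using *[of x] *[of y] xy P by (auto simp: X_def Y_def)
    ultimately show ?thesis using sm by (auto simp: strict_mono_on_def less_imp_le)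
  qed
  then have ev: "\<forall>\<^sub>F s in at_right 0. f (X s) \<le> f (Y s)"
    by (rule eventually_at_rightI[of 0 1]) simp_all
  have lim: "((\<lambda>s. f (x + s * (m - x))) \<longlongrightarrow> f (x + 0 * (m - x))) (at_right 0)" for x
    by (intro continuous_on_tendsto_compose[OF admissible_pair_facts(1)[OF ad]] tendsto_intros) auto
  show ?thesis using tendsto_le[OF _ lim[of y] lim[of x]] ev by (simp add: X_def Y_def)
qed simp

text \<open>Reflection in 0 and in -P/2 preserves f and brings both points back into the half-period
  on which f increases; for c in that half-period their order is kept.\<close>

lemma admissible_increment_nonneg:
  assumes ad: "admissible_pair P \<kappa> f \<mu>" and h: "0 < h" "h \<le> P / 2" and c: "-P/2 \<le> c" "c \<le> 0"
  shows "0 \<le> f (c + h/2) - f (c - h/2)"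
proof -
  define x y where "x = c - h/2" and "y = c + h/2"
  define y' where "y' = (if y \<le> 0 then y else - y)"
  define x' where "x' = (if x \<ge> -P/2 then x else - x - P)"
  note F = admissible_pair_facts[OF ad]
  have "f y' = f y" by (simp add: y'_def F(6))
  moreover have "f x' = f x" using F(5)[of "- x - P"] F(6)[of x] by (simp add: x'_def)
  moreover have "f x' \<le> f y'"
    by (rule admissible_pair_mono[OF ad]) (use h c in \<open>auto simp: x'_def y'_def x_def y_def\<close>)
  ultimately show ?thesis by (simp add: x_def y_def)
qed

lemma admissible_increment_bound:
  assumes ad: "admissible_pair P \<kappa> f \<mu>" and h: "0 < h" "h \<le> P / 2" and ab: "0 < a" "a \<le> b" "2 * b < P"
    and z: "-b \<le> z" "z \<le> -a"
    and d: "0 \<le> d" "d \<le> whitham_kernel b - whitham_kernel (b + 2 * a) - whitham_kernel (P - 2 * b)"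
  shows "d * integral {-b..-a} (\<lambda>c. f (c + h/2) - f (c - h/2)) \<le> (\<mu> - f (z + h/2) - f (z - h/2)) * (f (z + h/2) - f (z - h/2))"
proof -
  note F = admissible_pair_facts[OF ad]
  have [measurable]: "f \<in> borel_measurable borel" by (rule F)
  define E where "E c = f (c + h/2) - f (c - h/2)" for c
  have "d * integral {-b..-a} E \<le> (LINT c|lborel. whitham_kernel (z - c) * E c)"
  proof (rule convolution_odd_periodic_lower_bound[OF _ _ _ _ _ ab z d])
    show "continuous_on UNIV E" unfolding E_def
      by (intro continuous_intros continuous_on_compose2[OF F(1)]) auto
    show "\<bar>E c\<bar> \<le> 2" for c using F(3)[of "c + h/2"] F(3)[of "c - h/2"] by (simp add: E_def abs_le_iff)
    show "E (- c) = - E c" for c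
      using F(6)[of "c + h/2"] F(6)[of "c - h/2"] by (simp add: E_def algebra_simps)
    show "E (c + P) = E c" for c
      using F(5)[of "c + h/2"] F(5)[of "c - h/2"] by (simp add: E_def algebra_simps)
    show "0 \<le> E c" if "-P/2 \<le> c" "c \<le> 0" for c
      unfolding E_def by (rule admissible_increment_nonneg[OF ad h that])
  qed
  also have "(LINT c|lborel. whitham_kernel (z - c) * E c) = whitham_op f (z + h/2) - whitham_op f (z - h/2)"
  proof -
    have op: "whitham_op f (z + s) = (LINT c|lborel. whitham_kernel (z - c) * f (c + s))" for s
      unfolding whitham_op_def
      using lborel_integral_real_affine[of 1 "\<lambda>y. whitham_kernel (z + s - y) * f y" s] by (simp add: add.commute)
    have kz: "integrable lborel (\<lambda>c. whitham_kernel (z - c))"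
      using lborel_integrable_real_affine[OF whitham_kernel_integrable(1), of "-1" z] by simp
    have i: "integrable lborel (\<lambda>c. whitham_kernel (z - c) * f (c + s))" for s
      by (rule integrable_mult_bounded[OF kz _ F(3)]) simp
    show ?thesis using op[of "h/2"] op[of "-h/2"] i[of "h/2"] i[of "-h/2"] by (simp add: E_def right_diff_distrib)
  qed
  also have "\<dots> = (\<mu> - f (z + h/2) - f (z - h/2)) * (f (z + h/2) - f (z - h/2))"
    using F(7)[unfolded whitham_solution_pair_def, rule_format, of "z + h/2"] F(7)[unfolded whitham_solution_pair_def, rule_format, of "z - h/2"]
    by (simp add: power2_eq_square algebra_simps)
  finally show ?thesis by (simp add: E_def[abs_def])
qed

lemma whitham_kernel_tendsto_0: "(whitham_kernel \<longlongrightarrow> 0) at_top"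
proof (rule Lim_null_comparison)
  show "\<forall>\<^sub>F x in at_top. norm (whitham_kernel x) \<le> 2 * x powr (-1/2)"
    using eventually_gt_at_top[of 0]
    by eventually_elim (use whitham_kernel_le whitham_kernel_pos in \<open>auto simp: less_imp_le\<close>)
  have "((\<lambda>x::real. x powr (-1/2)) \<longlongrightarrow> 0) at_top"
    by (rule tendsto_neg_powr) (auto intro: filterlim_ident)
  then show "((\<lambda>x::real. 2 * x powr (-1/2)) \<longlongrightarrow> 0) at_top" by (rule tendsto_mult_right_zero)
qed

text \<open>The constant in the lower bound does not depend on the period, which is what survives the limit.\<close>

lemma admissible_increment_uniform:
  assumes ab: "0 < a" "a \<le> b"
  obtains d where "d > 0" "\<And>h. 0 < h \<Longrightarrow> \<forall>\<^sub>F P in at_top. \<forall>\<kappa> f \<mu> z. admissible_pair P \<kappa> f \<mu> \<longrightarrow> z \<in> {-b..-a} \<longrightarrow>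
      d * integral {-b..-a} (\<lambda>c. f (c + h/2) - f (c - h/2)) \<le> (\<mu> - f (z + h/2) - f (z - h/2)) * (f (z + h/2) - f (z - h/2))"
proof
  \<comment> \<open>Half of the drop of the kernel; the other half absorbs K (P - 2 b), which tends
    to 0. Thus \<open>d\<close> is independent of \<open>h\<close>, and only the threshold for
    \<open>P\<close> depends on it.\<close>
  define d where "d = (whitham_kernel b - whitham_kernel (b + 2 * a)) / 2"
  show d: "d > 0" using whitham_kernel_strict_decreasing[of b "b + 2 * a"] ab by (simp add: d_def)
  fix h :: real assume h: "0 < h"
  have "filterlim (\<lambda>P. P - 2 * b) at_top at_top"
    using filterlim_tendsto_add_at_top[OF tendsto_const[of "- 2 * b"] filterlim_ident] by (simp add: add.commute)
  then have "((\<lambda>P. whitham_kernel (P - 2 * b)) \<longlongrightarrow> 0) at_top"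
    by (rule filterlim_compose[OF whitham_kernel_tendsto_0])
  then have "\<forall>\<^sub>F P in at_top. whitham_kernel (P - 2 * b) < d" by (rule order_tendstoD) (rule d)
  moreover have "\<forall>\<^sub>F P in at_top. 2 * b < P" "\<forall>\<^sub>F P in at_top. 2 * h \<le> P" by (rule eventually_gt_at_top eventually_ge_at_top)+
  ultimately show "\<forall>\<^sub>F P in at_top. \<forall>\<kappa> f \<mu> z. admissible_pair P \<kappa> f \<mu> \<longrightarrow> z \<in> {-b..-a} \<longrightarrow>
      d * integral {-b..-a} (\<lambda>c. f (c + h/2) - f (c - h/2)) \<le> (\<mu> - f (z + h/2) - f (z - h/2)) * (f (z + h/2) - f (z - h/2))"
  proof eventually_elim
    case (elim P)
    have dd: "d \<le> whitham_kernel b - whitham_kernel (b + 2 * a) - whitham_kernel (P - 2 * b)"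
      using elim(1) unfolding d_def by simp
    show ?case
    proof (intro allI impI)
      fix \<kappa> f \<mu> z assume "admissible_pair P \<kappa> f \<mu>" "z \<in> {-b..-a}"
      then show "d * integral {-b..-a} (\<lambda>c. f (c + h/2) - f (c - h/2)) \<le> (\<mu> - f (z + h/2) - f (z - h/2)) * (f (z + h/2) - f (z - h/2))"
        using elim h ab d dd by (intro admissible_increment_bound[where P = P and \<kappa> = \<kappa>]) auto
    qed
  qed
qed

section \<open>Limits of admissible solutions\<close>

text \<open>Pointwise convergence is enough here: the limit inherits the common modulus of
  continuity, and integrals converge because all functions are bounded by 1.\<close>

locale admissible_limit =
  fixes \<kappa> :: real and P :: "nat \<Rightarrow> real" and \<phi> :: "nat \<Rightarrow> real \<Rightarrow> real" and \<mu> :: "nat \<Rightarrow> real"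
    and f :: "real \<Rightarrow> real" and \<nu> :: real
  assumes kappa: "0 < \<kappa>" "\<kappa> \<le> 1"
    and P: "filterlim P at_top sequentially"
    and ad: "\<And>n. admissible_pair (P n) \<kappa> (\<phi> n) (\<mu> n)"
    and lim: "\<And>x. (\<lambda>n. \<phi> n x) \<longlonglongrightarrow> f x"
    and mu: "\<mu> \<longlonglongrightarrow> \<nu>"
begin

lemmas facts = admissible_pair_facts[OF ad]

lemma nu_bounds: "0 \<le> \<nu>" "\<nu> \<le> 1"
proof -
  have "0 \<le> \<mu> n" "\<mu> n \<le> 1" for n using ad[of n] by (auto simp: admissible_pair_def)
  then show "0 \<le> \<nu>" "\<nu> \<le> 1" using mu by (auto intro: LIMSEQ_le_const LIMSEQ_le_const2)
qed

lemma f_0: "f 0 = \<kappa> * \<nu> / 2"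
proof -
  have "\<phi> n 0 = \<kappa> * \<mu> n / 2" for n using ad[of n] by (simp add: admissible_pair_def)
  moreover have "(\<lambda>n. \<kappa> * \<mu> n / 2) \<longlonglongrightarrow> \<kappa> * \<nu> / 2" by (intro tendsto_intros mu) simp
  ultimately have "(\<lambda>n. \<phi> n 0) \<longlonglongrightarrow> \<kappa> * \<nu> / 2" by (simp only:)
  then show ?thesis using lim[of 0] LIMSEQ_unique by blast
qed

lemma f_bounds: "\<nu> - 1 \<le> f x" "f x \<le> \<kappa> * \<nu> / 2" "f x \<le> \<nu> / 2" "\<bar>f x\<bar> \<le> 1"
proof -
  have b: "\<mu> n - 1 \<le> \<phi> n x" "\<phi> n x \<le> \<phi> n 0" for n using ad[of n] by (auto simp: admissible_pair_def)
  show l: "\<nu> - 1 \<le> f x" using b by (intro LIMSEQ_le[OF tendsto_diff[OF mu tendsto_const] lim]) auto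
  have "f x \<le> f 0" using b by (intro LIMSEQ_le[OF lim lim]) auto
  then show u: "f x \<le> \<kappa> * \<nu> / 2" by (simp add: f_0)
  have "\<kappa> * \<nu> \<le> 1 * \<nu>" using kappa nu_bounds by (intro mult_right_mono) auto
  then show "f x \<le> \<nu> / 2" using u by simp
  then show "\<bar>f x\<bar> \<le> 1" using l nu_bounds by (simp add: abs_le_iff)
qed

lemma f_even: "f (- x) = f x"
  using lim[of x] lim[of "- x"] facts(6) LIMSEQ_unique by auto

lemma f_hoelder: "\<bar>f x - f y\<bar> \<le> sqrt (160 * \<bar>x - y\<bar> powr (1/2))"
proof (rule LIMSEQ_le_const2)
  show "(\<lambda>n. \<bar>\<phi> n x - \<phi> n y\<bar>) \<longlonglongrightarrow> \<bar>f x - f y\<bar>" by (intro tendsto_intros lim)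
  show "\<exists>N. \<forall>n\<ge>N. \<bar>\<phi> n x - \<phi> n y\<bar> \<le> sqrt (160 * \<bar>x - y\<bar> powr (1/2))"
    using solution_hoelder[OF facts(2,3,7,4)] by blast
qed

lemma f_continuous: "continuous_on UNIV f"
proof -
  have "isCont f x" for x
  proof -
    have "((\<lambda>y. sqrt (160 * \<bar>y - x\<bar> powr (1/2))) \<longlongrightarrow> sqrt (160 * \<bar>x - x\<bar> powr (1/2))) (at x)"
      by (intro tendsto_intros tendsto_powr2) auto
    then have "((\<lambda>y. sqrt (160 * \<bar>y - x\<bar> powr (1/2))) \<longlongrightarrow> 0) (at x)" by simp
    then have "((\<lambda>y. f y - f x) \<longlongrightarrow> 0) (at x)"
      by (rule Lim_null_comparison[rotated]) (use f_hoelder in auto)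
    then show ?thesis unfolding isCont_def by (rule LIM_zero_cancel)
  qed
  then show ?thesis by (simp add: continuous_on_eq_continuous_at)
qed

lemma f_measurable [measurable]: "f \<in> borel_measurable borel"
  by (rule borel_measurable_continuous_onI[OF f_continuous])

lemma f_solution: "whitham_solution_pair f \<nu>"
  unfolding whitham_solution_pair_def
proof
  fix x
  have "(\<lambda>n. whitham_op (\<phi> n) x) \<longlonglongrightarrow> whitham_op f x"
    unfolding whitham_op_eq
  proof (rule integral_dominated_convergence)
    show "integrable lborel (\<lambda>t. \<bar>whitham_kernel t\<bar>)" using whitham_kernel_integrable by auto
    show "AE t in lborel. (\<lambda>n. whitham_kernel t * \<phi> n (x - t)) \<longlonglongrightarrow> whitham_kernel t * f (x - t)"
      by (intro AE_I2 tendsto_intros lim)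
    show "AE t in lborel. norm (whitham_kernel t * \<phi> n (x - t)) \<le> \<bar>whitham_kernel t\<bar>" for n
      using facts(3) by (auto simp: abs_mult mult_left_le)
    show "(\<lambda>t. whitham_kernel t * \<phi> n (x - t)) \<in> borel_measurable lborel" for n
    proof -
      have [measurable]: "\<phi> n \<in> borel_measurable borel" by (rule facts)
      show ?thesis by measurable
    qed
  qed measurable
  then have "(\<lambda>n. - \<mu> n * \<phi> n x + whitham_op (\<phi> n) x + (\<phi> n x)\<^sup>2) \<longlonglongrightarrow> - \<nu> * f x + whitham_op f x + (f x)\<^sup>2"
    by (intro tendsto_intros mu lim)
  moreover have "- \<mu> n * \<phi> n x + whitham_op (\<phi> n) x + (\<phi> n x)\<^sup>2 = 0" for n
    using facts(7)[of n] by (simp add: whitham_solution_pair_def)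
  ultimately show "- \<nu> * f x + whitham_op f x + (f x)\<^sup>2 = 0"
    by (metis (lifting) LIMSEQ_unique LIMSEQ_const_iff ext)
qed

section \<open>Monotonicity and nontriviality of the limit\<close>

lemma f_mono: assumes "x \<le> y" "y \<le> 0" shows "f x \<le> f y"
proof (rule LIMSEQ_le[OF lim lim])
  have "\<forall>\<^sub>F n in sequentially. - 2 * x \<le> P n" using P by (simp add: filterlim_at_top)
  then have "\<forall>\<^sub>F n in sequentially. \<phi> n x \<le> \<phi> n y"
    by (rule eventually_mono) (rule admissible_pair_mono[OF ad], use assms in auto)
  then show "\<exists>N. \<forall>n\<ge>N. \<phi> n x \<le> \<phi> n y" by (simp add: eventually_sequentially)
qed

lemma f_increment_nonneg: assumes "c \<le> 0" "0 \<le> h" shows "0 \<le> f (c + h/2) - f (c - h/2)"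
proof (cases "c + h/2 \<le> 0")
  case True then show ?thesis using f_mono[of "c - h/2" "c + h/2"] assms by simp
next
  case False
  have "f (c - h/2) \<le> f (- (c + h/2))" using False assms by (intro f_mono) auto
  then show ?thesis by (simp only: f_even)
qed

lemma continuous_increment:
  fixes g :: "real \<Rightarrow> real"
  assumes "continuous_on UNIV g"
  shows "continuous_on A (\<lambda>c. g (c + h/2) - g (c - h/2))"
  by (intro continuous_on_diff continuous_on_compose2[OF assms] continuous_on_add continuous_on_id continuous_on_const) auto

lemma f_increment_bound:
  assumes ab: "0 < a" "a \<le> b"
  obtains d where "d > 0" "\<And>h z. 0 < h \<Longrightarrow> z \<in> {-b..-a} \<Longrightarrow>
     d * integral {-b..-a} (\<lambda>c. f (c + h/2) - f (c - h/2)) \<le> (\<nu> - f (z + h/2) - f (z - h/2)) * (f (z + h/2) - f (z - h/2))"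
proof -
  obtain d where d: "d > 0" and ev: "\<And>h. 0 < h \<Longrightarrow> \<forall>\<^sub>F P in at_top. \<forall>\<kappa> f \<mu> z. admissible_pair P \<kappa> f \<mu> \<longrightarrow> z \<in> {-b..-a} \<longrightarrow>
      d * integral {-b..-a} (\<lambda>c. f (c + h/2) - f (c - h/2)) \<le> (\<mu> - f (z + h/2) - f (z - h/2)) * (f (z + h/2) - f (z - h/2))"
    using admissible_increment_uniform[OF ab] by blast
  show thesis
  proof
    show "d > 0" by fact
    fix h z :: real assume h: "0 < h" and z: "z \<in> {-b..-a}"
    have dc: "(\<lambda>n. integral {-b..-a} (\<lambda>c. \<phi> n (c + h/2) - \<phi> n (c - h/2))) \<longlonglongrightarrow> integral {-b..-a} (\<lambda>c. f (c + h/2) - f (c - h/2))"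
    proof (rule dominated_convergence(2))
      show "(\<lambda>c. \<phi> n (c + h/2) - \<phi> n (c - h/2)) integrable_on {-b..-a}" for n
        by (intro integrable_continuous_real continuous_increment facts)
      show "(\<lambda>c. 2 :: real) integrable_on {-b..-a}" by (rule integrable_const_ivl)
      show "norm (\<phi> n (c + h/2) - \<phi> n (c - h/2)) \<le> 2" for n c
        using facts(3)[of n "c + h/2"] facts(3)[of n "c - h/2"] by (simp add: abs_le_iff)
      show "(\<lambda>n. \<phi> n (c + h/2) - \<phi> n (c - h/2)) \<longlonglongrightarrow> f (c + h/2) - f (c - h/2)" for c
        by (intro tendsto_intros lim)
    qed
    have "\<forall>\<^sub>F n in sequentially. d * integral {-b..-a} (\<lambda>c. \<phi> n (c + h/2) - \<phi> n (c - h/2))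
       \<le> (\<mu> n - \<phi> n (z + h/2) - \<phi> n (z - h/2)) * (\<phi> n (z + h/2) - \<phi> n (z - h/2))"
      using eventually_compose_filterlim[OF ev[OF h] P] by (rule eventually_mono) (use ad z in blast)
    moreover have "(\<lambda>n. (\<mu> n - \<phi> n (z + h/2) - \<phi> n (z - h/2)) * (\<phi> n (z + h/2) - \<phi> n (z - h/2))) \<longlonglongrightarrow> (\<nu> - f (z + h/2) - f (z - h/2)) * (f (z + h/2) - f (z - h/2))"
      by (intro tendsto_intros mu lim)
    ultimately show "d * integral {-b..-a} (\<lambda>c. f (c + h/2) - f (c - h/2)) \<le> (\<nu> - f (z + h/2) - f (z - h/2)) * (f (z + h/2) - f (z - h/2))"
      using tendsto_le[OF sequentially_bot _ tendsto_mult[OF tendsto_const dc]] by blast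
  qed
qed

text \<open>Dividing the increment bound by the smallest increment on \<open>[-3, -1]\<close> gives a lower bound for
  \<open>\<mu> n - 2 * \<phi> n (-7/2)\<close> that is uniform in \<open>n\<close>; it excludes the trivial limit with \<open>\<nu> = 0\<close>.\<close>

lemma uniform_gap: "f (-7/2) < \<nu> / 2"
proof -
  obtain d where d: "d > 0" and ev: "\<And>h. 0 < h \<Longrightarrow> \<forall>\<^sub>F P in at_top. \<forall>\<kappa> f \<mu> z. admissible_pair P \<kappa> f \<mu> \<longrightarrow> z \<in> {-3..-1} \<longrightarrow>
      d * integral {-3..-1} (\<lambda>c. f (c + h/2) - f (c - h/2)) \<le> (\<mu> - f (z + h/2) - f (z - h/2)) * (f (z + h/2) - f (z - h/2))"
    using admissible_increment_uniform[of 1 3] by auto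
  have "\<forall>\<^sub>F n in sequentially. P n \<ge> 8" using P by (simp add: filterlim_at_top)
  with eventually_compose_filterlim[OF ev[OF zero_less_one] P]
  have "\<forall>\<^sub>F n in sequentially. 2 * d \<le> \<mu> n - 2 * \<phi> n (-7/2)"
  proof (rule eventually_elim2)
    fix n assume A: "\<forall>\<kappa> f \<mu> z. admissible_pair (P n) \<kappa> f \<mu> \<longrightarrow> z \<in> {-3..-1} \<longrightarrow>
      d * integral {-3..-1} (\<lambda>c. f (c + 1/2) - f (c - 1/2)) \<le> (\<mu> - f (z + 1/2) - f (z - 1/2)) * (f (z + 1/2) - f (z - 1/2))"
      and P8: "P n \<ge> 8"
    define E where "E c = \<phi> n (c + 1/2) - \<phi> n (c - 1/2)" for c
    have cE: "continuous_on {-3..-1} E" unfolding E_def by (intro continuous_increment facts)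
    obtain z where z: "z \<in> {-3..-1}" "\<And>c. c \<in> {-3..-1} \<Longrightarrow> E z \<le> E c"
      using continuous_attains_inf[OF compact_Icc _ cE] by auto
    have sm: "strict_mono_on {- P n / 2<..<0} (\<phi> n)" using ad[of n] by (simp add: admissible_pair_def)
    \<comment> \<open>As \<open>P n\<close> is at least 8, the points z - 1/2 and z + 1/2, which lie
      between -7/2 and -1/2, are inside the half-period where the wave strictly increases.\<close>
    have Ez: "E z > 0" using sm[unfolded strict_mono_on_def, rule_format, of "z - 1/2" "z + 1/2"] z(1) P8 by (simp add: E_def)
    \<comment> \<open>The 2 is the length of the interval from -3 to -1.\<close>
    have "E z * 2 = integral {-3..-1::real} (\<lambda>c. E z)" by simp
    also have "\<dots> \<le> integral {-3..-1} E"
      using cE z(2) by (intro integral_le integrable_continuous_real) auto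
    finally have "d * (E z * 2) \<le> d * integral {-3..-1} E" using d by simp
    also have "\<dots> \<le> (\<mu> n - \<phi> n (z + 1/2) - \<phi> n (z - 1/2)) * E z"
      using A ad[of n] z(1) unfolding E_def[abs_def] by blast
    also have "\<dots> \<le> (\<mu> n - 2 * \<phi> n (-7/2)) * E z"
    proof (rule mult_right_mono)
      have "\<phi> n (-7/2) \<le> \<phi> n (z + 1/2)" "\<phi> n (-7/2) \<le> \<phi> n (z - 1/2)"
        using z(1) P8 by (auto intro!: admissible_pair_mono[OF ad])
      then show "\<mu> n - \<phi> n (z + 1/2) - \<phi> n (z - 1/2) \<le> \<mu> n - 2 * \<phi> n (-7/2)" by simp
    qed (use Ez in simp)
    also have "d * (E z * 2) = (2 * d) * E z" by simp
    finally show "2 * d \<le> \<mu> n - 2 * \<phi> n (-7/2)" unfolding mult_le_cancel_right_pos[OF Ez] .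
  qed
  moreover have "(\<lambda>n. \<mu> n - 2 * \<phi> n (-7/2)) \<longlonglongrightarrow> \<nu> - 2 * f (-7/2)" by (intro tendsto_intros mu lim)
  ultimately have "2 * d \<le> \<nu> - 2 * f (-7/2)" by (intro tendsto_lowerbound[of _ _ sequentially]) auto
  then show ?thesis using d by simp
qed

text \<open>The kernel has mass 1, so a constant solution is 0 or \<nu> - 1, and f 0 >= 0 leaves
  only 0. The relative height then forces \<nu> = 0, and the gap at -7/2 would read 0 < 0.\<close>

lemma f_nonconstant: "\<not> (\<forall>x. f x = f 0)"
proof
  assume c: "\<forall>x. f x = f 0"
  have "(\<lambda>t. whitham_kernel t * f (0 - t)) = (\<lambda>t. whitham_kernel t * f 0)"
    by (rule ext, rule arg_cong[where f = "\<lambda>y. _ * y"]) (use c in blast)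
  then have "whitham_op f 0 = f 0"
    using whitham_kernel_integrable unfolding whitham_op_eq by simp
  then have "f 0 * (f 0 + (1 - \<nu>)) = 0"
    using f_solution[unfolded whitham_solution_pair_def, rule_format, of 0] by (simp add: power2_eq_square algebra_simps)
  moreover have "f 0 \<ge> 0" unfolding f_0 using kappa nu_bounds by simp
  ultimately have "f 0 = 0" using nu_bounds by auto
  then have "\<nu> = 0" using f_0 kappa by simp
  then show False using uniform_gap c \<open>f 0 = 0\<close> by simp
qed

text \<open>If one increment of width h vanishes, the increment bound annihilates the integral of
  all nonnegative increments of that width, hence each of them on the negative axis. Then f has the
  same value at every -n h, so monotonicity makes it constant there, and evenness
  everywhere.\<close>

lemma f_strict_mono: assumes "x < y" "y \<le> 0" shows "f x < f y"
proof (rule ccontr)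
  assume "\<not> f x < f y"
  then have eq: "f x = f y" using f_mono[of x y] assms by simp
  define h where "h = y - x"
  define z where "z = (x + y) / 2"
  have h: "h > 0" and z: "z < 0" and zh: "z + h/2 = y" "z - h/2 = x"
    using assms by (auto simp: h_def z_def field_simps)
  have E0: "f (c + h/2) = f (c - h/2)" if "c < 0" for c
  proof -
    \<comment> \<open>The interval is chosen to contain both \<open>z\<close>, where the increment
      vanishes, and the arbitrary point \<open>c\<close>.\<close>
    define a where "a = min (-z) (-c) / 2"
    define b where "b = max (-z) (-c)"
    have ab: "0 < a" "a < b" using that z by (auto simp: a_def b_def min_def max_def)
    have zc: "z \<in> {-b..-a}" "c \<in> {-b..-a}" using that z by (auto simp: a_def b_def min_def max_def)
    obtain d where d: "d > 0" and D: "\<And>h z. 0 < h \<Longrightarrow> z \<in> {-b..-a} \<Longrightarrow>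
     d * integral {-b..-a} (\<lambda>c. f (c + h/2) - f (c - h/2)) \<le> (\<nu> - f (z + h/2) - f (z - h/2)) * (f (z + h/2) - f (z - h/2))"
      using f_increment_bound[of a b] ab by auto
    define I where "I = integral {-b..-a} (\<lambda>c. f (c + h/2) - f (c - h/2))"
    have nn: "0 \<le> f (c + h/2) - f (c - h/2)" if "c \<in> {-b..-a}" for c
      using that ab h by (intro f_increment_nonneg) auto
    have "d * I \<le> 0" using D[OF h zc(1)] eq unfolding zh I_def by simp
    then have "I \<le> 0" using d by (simp add: mult_le_0_iff)
    moreover have "0 \<le> I" unfolding I_def
      by (rule Henstock_Kurzweil_Integration.integral_nonneg) (use nn in \<open>auto intro!: integrable_continuous_real continuous_increment f_continuous\<close>)
    ultimately have "I = 0" by simp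
    then show ?thesis
      using integral_eq_0_iff[of "-b" "-a" "\<lambda>c. f (c + h/2) - f (c - h/2)"] continuous_increment[OF f_continuous] ab nn zc(2)
      unfolding I_def by auto
  qed
  have step: "f (- (real n * h)) = f 0" for n
  proof (induction n)
    case (Suc n)
    have "f (- (real n * h) - h/2 + h/2) = f (- (real n * h) - h/2 - h/2)"
    proof (rule E0)
      have "0 \<le> real n * h" using h by simp
      then show "- (real n * h) - h/2 < 0" using h by linarith
    qed
    moreover have "- (real n * h) - h/2 + h/2 = - (real n * h)" "- (real n * h) - h/2 - h/2 = - (real (Suc n) * h)"
      by (simp_all add: algebra_simps)
    ultimately show ?case using Suc by (simp only:)
  qed simp
  have nonpos: "f x = f 0" if "x \<le> 0" for x
  proof -
    obtain n where "- x < real n * h" using reals_Archimedean3[OF h] by blast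
    then have "f (- (real n * h)) \<le> f x" using that by (intro f_mono) auto
    then show ?thesis using f_mono[of x 0] that step[of n] by simp
  qed
  have "f x = f 0" for x using nonpos[of x] nonpos[of "- x"] f_even[of x] by (cases "x \<le> 0") auto
  then show False using f_nonconstant by blast
qed

lemma f_less_half_nu: assumes "x < 0" shows "f x < \<nu> / 2"
  using f_strict_mono[OF assms] f_bounds(3)[of 0] by simp

lemma f_nonperiodic: "\<not> (\<exists>T>0. periodic_fun_simple f T)"
proof
  assume "\<exists>T>0. periodic_fun_simple f T"
  then obtain T where T: "T > 0" "periodic_fun_simple f T" by blast
  then interpret periodic_fun_simple f T by simp
  have "f (- T + T) = f (- T)" by (rule plus_period)
  then show False using f_strict_mono[of "- T" 0] T by simp
qed

text \<open>The factorised difference of squares transfers the modulus of L f at x to f at x after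
  division by \<gamma>; only the gap at x enters, the gap at x - t being merely nonnegative. The
  exponents run 1/2, then 3/4, then differentiability.\<close>

lemma f_op_differentiable:
  assumes \<gamma>: "0 < \<gamma>" "\<gamma> \<le> \<nu> / 2 - f x"
  shows "\<exists>D. (whitham_op f has_real_derivative D) (at x)"
proof -
  define g where "g y = \<nu> / 2 - f y" for y
  have gain: "\<bar>f (x - t) - f x\<bar> \<le> \<bar>whitham_op f (x - t) - whitham_op f x\<bar> / \<gamma>" for t
  proof -
    have gp: "0 \<le> g (x - t)" "\<gamma> \<le> g x" using f_bounds(3) \<gamma> by (auto simp: g_def)
    have "\<bar>f (x - t) - f x\<bar> * \<gamma> \<le> \<bar>f (x - t) - f x\<bar> * (g (x - t) + g x)" using gp by (intro mult_left_mono) auto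
    also have "\<dots> = \<bar>g (x - t) - g x\<bar> * \<bar>g (x - t) + g x\<bar>" using gp \<gamma> by (simp add: g_def abs_minus_commute)
    also have "\<dots> = \<bar>(g (x - t))\<^sup>2 - (g x)\<^sup>2\<bar>"
      by (simp add: abs_mult[symmetric] power2_eq_square algebra_simps)
    also have "\<dots> = \<bar>whitham_op f (x - t) - whitham_op f x\<bar>"
      unfolding g_def solution_square_eq[OF f_solution] by simp
    finally show ?thesis using \<gamma> by (simp add: field_simps)
  qed
  have half: "\<bar>f (x - t) - f x\<bar> \<le> (160 / \<gamma>) * \<bar>t\<bar> powr (1/2)" for t
  proof -
    have "\<bar>whitham_op f (x - t) - whitham_op f x\<bar> \<le> 160 * \<bar>t\<bar> powr (1/2)"
      using whitham_op_hoelder_half[OF f_measurable f_bounds(4), of "x - t" x] by simp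
    then have "\<bar>whitham_op f (x - t) - whitham_op f x\<bar> / \<gamma> \<le> (160 * \<bar>t\<bar> powr (1/2)) / \<gamma>"
      using \<gamma> by (intro divide_right_mono) auto
    then show ?thesis using gain[of t] by simp
  qed
  \<comment> \<open>The exponent is lowered from 1/2 to 1/4 because the gain of half a derivative
    requires an exponent below 1/2. For |t| > 1 the bound comes from |f| <= 1.\<close>
  have quarter: "\<bar>f (x - t) - f x\<bar> \<le> (160 / \<gamma> + 2) * \<bar>t\<bar> powr (1/4)" for t
  proof (cases "\<bar>t\<bar> \<le> 1")
    case True
    have "(160 / \<gamma>) * \<bar>t\<bar> powr (1/2) \<le> (160 / \<gamma> + 2) * \<bar>t\<bar> powr (1/4)"
      using True \<gamma> by (intro mult_mono powr_mono') auto
    then show ?thesis using half[of t] by simp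
  next
    case False
    have "\<bar>f (x - t) - f x\<bar> \<le> 2 * 1" using f_bounds(4)[of "x - t"] f_bounds(4)[of x] by simp
    also have "\<dots> \<le> (160 / \<gamma> + 2) * \<bar>t\<bar> powr (1/4)"
      using False \<gamma> by (intro mult_mono ge_one_powr_ge_zero) auto
    finally show ?thesis .
  qed
  define A where "A = (64 + 8 / (1/2 - 1/4)) * (160 / \<gamma> + 2)"
  have "\<bar>f (x - t) - f x\<bar> \<le> (A / \<gamma>) * \<bar>t\<bar> powr (3/4)" for t
  proof -
    have "\<bar>whitham_op f (x + (- t)) - whitham_op f x\<bar> \<le> A * \<bar>- t\<bar> powr (1/4 + 1/2)"
      unfolding A_def by (rule whitham_op_hoelder_gain[OF f_measurable f_bounds(4) _ _ quarter]) auto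
    then have "\<bar>whitham_op f (x - t) - whitham_op f x\<bar> / \<gamma> \<le> (A * \<bar>t\<bar> powr (3/4)) / \<gamma>"
      using \<gamma> by (intro divide_right_mono) auto
    then show ?thesis using gain[of t] by simp
  qed
  from whitham_op_differentiable[OF f_measurable f_bounds(4) this] show ?thesis by blast
qed

lemma f_differentiable:
  assumes "x < 0" shows "f differentiable (at x)"
proof -
  have g: "0 < \<nu> / 2 - f x" using f_less_half_nu[OF assms] by simp
  obtain D where D: "(whitham_op f has_real_derivative D) (at x)" using f_op_differentiable[OF g] by blast
  have e: "f = (\<lambda>y. \<nu> / 2 - sqrt (\<nu>\<^sup>2 / 4 - whitham_op f y))"
  proof
    fix y
    have "sqrt (\<nu>\<^sup>2 / 4 - whitham_op f y) = \<bar>\<nu> / 2 - f y\<bar>"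
      unfolding solution_square_eq[OF f_solution, symmetric] by simp
    then show "f y = \<nu> / 2 - sqrt (\<nu>\<^sup>2 / 4 - whitham_op f y)" using f_bounds(3)[of y] by simp
  qed
  have p: "0 < \<nu>\<^sup>2 / 4 - whitham_op f x" unfolding solution_square_eq[OF f_solution, symmetric] using g by simp
  have "((\<lambda>y. \<nu> / 2 - sqrt (\<nu>\<^sup>2 / 4 - whitham_op f y)) has_real_derivative
      0 - (inverse (sqrt (\<nu>\<^sup>2 / 4 - whitham_op f x)) / 2 * (0 - D))) (at x)"
    by (intro DERIV_diff DERIV_const D
        DERIV_chain2[where f = sqrt and g = "\<lambda>y. \<nu>\<^sup>2 / 4 - whitham_op f y", OF DERIV_real_sqrt[OF p]])
  then show ?thesis unfolding e[symmetric] by (auto simp: real_differentiable_def)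
qed

text \<open>After shifting, the two integrals cancel except over windows of width h around -a and
  -b, where f is compared with its values at the left and right edge respectively. Widening the
  windows to the fixed \<open>h0\<close> makes the factor of h independent of h.\<close>

lemma integral_increment_lower_bound:
  assumes h: "0 < h" "h \<le> h0" and ab: "- a + h0/2 \<le> 0" "a \<le> b"
  shows "h * (f (- a - h0/2) - f (- b + h0/2)) \<le> integral {-b..-a} (\<lambda>c. f (c + h/2) - f (c - h/2))"
proof -
  have fi: "f integrable_on {u..v}" for u v
    using f_continuous by (intro integrable_continuous_real) (auto intro: continuous_on_subset)
  have sh: "integral {-b..-a} (\<lambda>c. f (c + s)) = integral {-b+s..-a+s} f" "(\<lambda>c. f (c + s)) integrable_on {-b..-a}" for s
    using integral_shift_real_ivl[of "-b+s" s "-a+s" f] integrable_shift_real_ivl[OF fi[of "-b+s" "-a+s"], of s] by simp_all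
  have "integral {-b..-a} (\<lambda>c. f (c + h/2) - f (c - h/2)) = integral {-b..-a} (\<lambda>c. f (c + h/2)) - integral {-b..-a} (\<lambda>c. f (c + (-h/2)))"
    using Henstock_Kurzweil_Integration.integral_diff[OF sh(2)[of "h/2"] sh(2)[of "-h/2"]] by simp
  also have "\<dots> = integral {-b+h/2..-a+h/2} f - integral {-b-h/2..-a-h/2} f"
    unfolding sh by simp
  also have "\<dots> = integral {-a-h/2..-a+h/2} f - integral {-b-h/2..-b+h/2} f"
  proof -
    have "integral {-b-h/2..-b+h/2} f + integral {-b+h/2..-a+h/2} f = integral {-b-h/2..-a+h/2} f"
      using h ab by (intro Henstock_Kurzweil_Integration.integral_combine fi) auto
    moreover have "integral {-b-h/2..-a-h/2} f + integral {-a-h/2..-a+h/2} f = integral {-b-h/2..-a+h/2} f"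
      using h ab by (intro Henstock_Kurzweil_Integration.integral_combine fi) auto
    ultimately show ?thesis by linarith
  qed
  also have "\<dots> \<ge> h * f (- a - h0/2) - h * f (- b + h0/2)"
  proof (rule diff_mono)
    have "integral {-a-h/2..-a+h/2} (\<lambda>c. f (- a - h0/2)) \<le> integral {-a-h/2..-a+h/2} f"
      using h ab by (intro integral_le fi f_mono integrable_const_ivl) auto
    then show "h * f (- a - h0/2) \<le> integral {-a-h/2..-a+h/2} f" using h by simp
    have "integral {-b-h/2..-b+h/2} f \<le> integral {-b-h/2..-b+h/2} (\<lambda>c. f (- b + h0/2))"
      using h ab by (intro integral_le fi f_mono integrable_const_ivl) auto
    then show "integral {-b-h/2..-b+h/2} f \<le> h * f (- b + h0/2)" using h by simp
  qed
  finally show ?thesis by (simp add: algebra_simps)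
qed

text \<open>The integral of increments is at least a constant times h, and the coefficient \<nu> - f
  (x + h/2) - f (x - h/2) is at most 3, so the centred difference quotient stays above a positive
  constant.\<close>

lemma f_deriv_pos:
  assumes x: "x < 0" shows "deriv f x > 0"
proof -
  \<comment> \<open>The interval runs from 3x/2 to x/2, around x; with this \<open>h0\<close> the
    constant \<open>e\<close> below is f (3x/4) - f (5x/4), positive by strict monotonicity.\<close>
  define a b h0 where "a = - x / 2" and "b = - 3 * x / 2" and "h0 = - x / 2"
  have ab: "0 < a" "a \<le> b" "x \<in> {-b..-a}" "- a + h0/2 \<le> 0" "0 < h0" using x by (auto simp: a_def b_def h0_def)
  obtain d where d: "d > 0" and D: "\<And>h z. 0 < h \<Longrightarrow> z \<in> {-b..-a} \<Longrightarrow>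
     d * integral {-b..-a} (\<lambda>c. f (c + h/2) - f (c - h/2)) \<le> (\<nu> - f (z + h/2) - f (z - h/2)) * (f (z + h/2) - f (z - h/2))"
    using f_increment_bound[of a b] ab by auto
  define e where "e = f (- a - h0/2) - f (- b + h0/2)"
  have e: "e > 0" unfolding e_def using f_strict_mono[of "- b + h0/2" "- a - h0/2"] x by (simp add: a_def b_def h0_def)
  define L where "L = deriv f x"
  have L: "(f has_real_derivative L) (at x)"
    unfolding L_def using f_differentiable[OF x] by (metis DERIV_imp_deriv real_differentiableE)
  have "((\<lambda>h. f (x + h/2) - f (x - h/2)) has_real_derivative (L * (1/2) - L * (- 1/2))) (at 0)"
    using L by (intro DERIV_diff DERIV_chain2[where f = f]) (auto intro!: derivative_eq_intros)
  then have t: "((\<lambda>h. (f (x + h/2) - f (x - h/2)) / h) \<longlongrightarrow> L) (at_right 0)"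
    unfolding DERIV_def by (auto intro: filterlim_mono[OF _ order_refl at_le])
  have "\<forall>\<^sub>F h in at_right 0. d * e / 3 \<le> (f (x + h/2) - f (x - h/2)) / h"
  proof (rule eventually_at_rightI[of 0 h0])
    fix h assume h: "h \<in> {0<..<h0}"
    have nn: "0 \<le> f (x + h/2) - f (x - h/2)" using h x by (intro f_increment_nonneg) auto
    have "d * (h * e) \<le> d * integral {-b..-a} (\<lambda>c. f (c + h/2) - f (c - h/2))"
      unfolding e_def using h ab d by (intro mult_left_mono integral_increment_lower_bound) auto
    also have "\<dots> \<le> (\<nu> - f (x + h/2) - f (x - h/2)) * (f (x + h/2) - f (x - h/2))"
      using h ab by (intro D) auto
    also have "\<dots> \<le> 3 * (f (x + h/2) - f (x - h/2))"
      using nn f_bounds(4)[of "x + h/2"] f_bounds(4)[of "x - h/2"] nu_bounds by (intro mult_right_mono) auto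
    finally show "d * e / 3 \<le> (f (x + h/2) - f (x - h/2)) / h" using h by (simp add: field_simps)
  qed (rule ab)
  then have "d * e / 3 \<le> L" by (intro tendsto_lowerbound[OF t]) auto
  moreover have "0 < d * e / 3" using d e by simp
  ultimately show ?thesis unfolding L_def by linarith
qed

text \<open>For \<kappa> < 1 and \<nu> > 0 the gap \<nu>/2 - f is bounded below by (1 - \<kappa>)
  \<nu> / 2 on the whole line, so the root loses no regularity. Each round of the induction raises
  the exponent from 0 to 1/2, lowers it to 1/4, raises it to 3/4 and then wins a derivative.\<close>

lemma f_smooth:
  assumes "\<kappa> < 1" "0 < \<nu>" shows "smooth_on UNIV f"
proof -
  define \<gamma> where "\<gamma> = \<nu> / 2 - \<kappa> * \<nu> / 2"
  have "\<kappa> * \<nu> < 1 * \<nu>" using assms by (intro mult_strict_right_mono)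
  then have \<gamma>: "0 < \<gamma>" "\<And>x. \<gamma> \<le> \<nu> / 2 - f x" using f_bounds(2) by (auto simp: \<gamma>_def)
  have op_imp: "hoelder_class k \<alpha> f" if "hoelder_class k \<alpha> (whitham_op f)" "0 \<le> \<alpha>" "\<alpha> \<le> 1" for k \<alpha>
  proof -
    have F: "hoelder_class k \<alpha> (\<lambda>x. \<nu>\<^sup>2 / 4 + (-1) * whitham_op f x)"
      using that by (intro hoelder_class_add hoelder_class_mult hoelder_class_const)
    have "hoelder_class k \<alpha> (\<lambda>x. \<nu> / 2 - f x)"
      by (rule hoelder_class_sqrt[OF F that(2,3) \<gamma>]) (simp add: solution_square_eq[OF f_solution])
    then have "hoelder_class k \<alpha> (\<lambda>x. \<nu> / 2 + (-1) * (\<nu> / 2 - f x))"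
      using that by (intro hoelder_class_add hoelder_class_mult hoelder_class_const)
    then show ?thesis by simp
  qed
  have H: "hoelder_class k 0 f" for k
  proof (induction k)
    case 0
    have "\<bar>f x - f y\<bar> \<le> 2 * \<bar>x - y\<bar> powr 0" for x y
      using f_bounds(4)[of x] f_bounds(4)[of y] by (cases "x = y") auto
    then show ?case using f_bounds(4) f_measurable by (intro hoelder_class_0I)
  next
    case (Suc k)
    have "hoelder_class k (1/2) f" using hoelder_class_op[OF _ _ Suc] by (intro op_imp) auto
    then have "hoelder_class k (1/4) f" by (rule hoelder_class_exponent_mono) auto
    then have "hoelder_class k (1/4 + 1/2) (whitham_op f)" by (intro hoelder_class_op) auto
    then have "hoelder_class k (3/4) f" by (intro op_imp) auto
    then have "hoelder_class (Suc k) 0 (whitham_op f)" by (rule hoelder_class_op_differentiable)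
    then show ?case by (rule op_imp) auto
  qed
  show ?thesis unfolding smooth_on_def using hoelder_class_imp_differentiable[OF H] by blast
qed

end

section \<open>Compactness\<close>

text \<open>The wave speeds are extracted first, so that their convergence survives the diagonal
  subsequence taken over the intervals [-i, i].\<close>

lemma admissible_compactness:
  assumes ad: "\<And>n. admissible_pair (P n) \<kappa> (\<phi> n) (\<mu> n)"
  obtains r :: "nat \<Rightarrow> nat" and f \<nu> where "strict_mono r" "(\<lambda>n. \<mu> (r n)) \<longlonglongrightarrow> \<nu>"
    "\<And>C. compact C \<Longrightarrow> uniform_limit C (\<lambda>n. \<phi> (r n)) f sequentially"
proof -
  note facts = admissible_pair_facts[OF ad]
  have "\<mu> n \<in> {0..1}" for n using ad[of n] by (auto simp: admissible_pair_def)
  then have "\<forall>n. \<mu> n \<in> {0..1}" by blast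
  moreover have "seq_compact {0..1::real}" by (simp add: compact_imp_seq_compact)
  ultimately obtain \<nu> r0 where r0: "strict_mono r0" "(\<mu> \<circ> r0) \<longlonglongrightarrow> \<nu>"
    unfolding seq_compact_def by blast
  define Q where "Q i r \<longleftrightarrow> (\<exists>g. uniform_limit {- real i..real i} (\<lambda>n. \<phi> (r n)) g sequentially)" for i r
  have ex: "\<exists>k. strict_mono k \<and> Q i (r \<circ> k)" for i and r :: "nat \<Rightarrow> nat"
  proof -
    have equi: "\<exists>d>0. \<forall>n y. y \<in> {- real i..real i} \<and> norm (x - y) < d \<longrightarrow> norm (\<phi> (r n) x - \<phi> (r n) y) < e" if "e > 0" for x e
    \<comment> \<open>This inverts the common modulus sqrt (160 |x - y|^(1/2)) at the value
      e.\<close>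
    proof (intro exI[of _ "(e\<^sup>2 / 160)\<^sup>2"] conjI allI impI)
      show "0 < (e\<^sup>2 / 160)\<^sup>2" using that by simp
      fix n y assume "y \<in> {- real i..real i} \<and> norm (x - y) < (e\<^sup>2 / 160)\<^sup>2"
      then have "sqrt \<bar>x - y\<bar> < e\<^sup>2 / 160" using that by (intro real_less_lsqrt) auto
      then have "160 * \<bar>x - y\<bar> powr (1/2) < e\<^sup>2" by (simp add: powr_half_sqrt)
      then have "sqrt (160 * \<bar>x - y\<bar> powr (1/2)) < e" using that by (intro real_less_lsqrt) auto
      then show "norm (\<phi> (r n) x - \<phi> (r n) y) < e"
        using solution_hoelder[OF facts(2,3,7,4), of "r n" x y] by simp
    qed
    have "\<exists>g (k :: nat \<Rightarrow> nat). strict_mono k \<and> (\<forall>e>0. \<exists>N. \<forall>n x. N \<le> n \<and> x \<in> {- real i..real i} \<longrightarrow> norm (\<phi> (r (k n)) x - g x) < e)"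
    proof (rule Arzela_Ascoli[of "{- real i..real i}" "\<lambda>n. \<phi> (r n)" 1])
      show "compact {- real i..real i}" by simp
      show "norm (\<phi> (r n) x) \<le> 1" for n x using facts(3) by simp
      show "\<exists>d>0. \<forall>n y. y \<in> {- real i..real i} \<and> norm (x - y) < d \<longrightarrow> norm (\<phi> (r n) x - \<phi> (r n) y) < e" if "0 < e" for x e
        by (rule equi[OF that])
    qed blast+
    then obtain g and k :: "nat \<Rightarrow> nat" where "strict_mono k" and k: "\<And>e. 0 < e \<Longrightarrow> \<exists>N. \<forall>n x. N \<le> n \<and> x \<in> {- real i..real i} \<longrightarrow> norm (\<phi> (r (k n)) x - g x) < e"
      by blast
    moreover have "uniform_limit {- real i..real i} (\<lambda>n. \<phi> ((r \<circ> k) n)) g sequentially"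
      unfolding uniform_limit_sequentially_iff dist_norm comp_apply using k by blast
    ultimately show ?thesis unfolding Q_def by blast
  qed
  \<comment> \<open>Uniform convergence depends only on the tail, which is what the diagonal
    sequence shares with each of the successive subsequences.\<close>
  have sub: "Q i (r \<circ> k2)" if Q1: "Q i (r \<circ> k1)" and k12: "\<And>j. N \<le> j \<Longrightarrow> \<exists>j'\<ge>j. k2 j = k1 j'" for i r k1 k2 and N :: nat
  proof -
    obtain g where g: "uniform_limit {- real i..real i} (\<lambda>n. \<phi> ((r \<circ> k1) n)) g sequentially"
      using Q1 unfolding Q_def by blast
    have "uniform_limit {- real i..real i} (\<lambda>n. \<phi> ((r \<circ> k2) n)) g sequentially"
      unfolding uniform_limit_sequentially_iff
    proof (intro allI impI)
      fix e :: real assume "e > 0"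
      then obtain M where M: "\<forall>n\<ge>M. \<forall>x\<in>{- real i..real i}. dist (\<phi> ((r \<circ> k1) n) x) (g x) < e"
        using g unfolding uniform_limit_sequentially_iff by blast
      show "\<exists>M. \<forall>n\<ge>M. \<forall>x\<in>{- real i..real i}. dist (\<phi> ((r \<circ> k2) n) x) (g x) < e"
      proof (intro exI[of _ "max M N"] allI impI ballI)
        fix n x assume n: "max M N \<le> n" and x: "x \<in> {- real i..real i}"
        obtain j' where "j' \<ge> n" "k2 n = k1 j'" using k12[of n] n by auto
        then show "dist (\<phi> ((r \<circ> k2) n) x) (g x) < e" using M n x by auto
      qed
    qed
    then show ?thesis unfolding Q_def by blast
  qed
  obtain k where k: "strict_mono k" "\<And>i. Q i (r0 \<circ> k)"
  proof (rule subsequence_diagonalization_lemma[of Q r0])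
    show "\<exists>k. strict_mono k \<and> Q i (r \<circ> k)" for i and r :: "nat \<Rightarrow> nat" by (rule ex)
    show "Q i (r \<circ> k2)" if "Q i (r \<circ> k1)" "\<And>j. N \<le> j \<Longrightarrow> \<exists>j'\<ge>j. k2 j = k1 j'" for i r k1 k2 and N :: nat
      by (rule sub[OF that])
  qed auto
  define r where "r = r0 \<circ> k"
  \<comment> \<open>The limits on the separate intervals are merged through pointwise limits, with
    which each of them agrees by uniqueness.\<close>
  define f where "f x = lim (\<lambda>n. \<phi> (r n) x)" for x
  have ul: "uniform_limit {- real i..real i} (\<lambda>n. \<phi> (r n)) f sequentially" for i
  proof -
    obtain g where g: "uniform_limit {- real i..real i} (\<lambda>n. \<phi> (r n)) g sequentially"
      using k(2)[of i] unfolding Q_def r_def by blast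
    have eq: "g x = f x" if "x \<in> {- real i..real i}" for x
      using tendsto_uniform_limitI[OF g that] unfolding f_def by (simp add: limI)
    show ?thesis unfolding uniform_limit_sequentially_iff
    proof (intro allI impI)
      fix e :: real assume "e > 0"
      then obtain N where N: "\<forall>n\<ge>N. \<forall>x\<in>{- real i..real i}. dist (\<phi> (r n) x) (g x) < e"
        using g unfolding uniform_limit_sequentially_iff by blast
      show "\<exists>N. \<forall>n\<ge>N. \<forall>x\<in>{- real i..real i}. dist (\<phi> (r n) x) (f x) < e"
      proof (intro exI[of _ N] allI impI ballI)
        fix n x assume "N \<le> n" and x: "x \<in> {- real i..real i}"
        then show "dist (\<phi> (r n) x) (f x) < e" using N unfolding eq[OF x, symmetric] by blast
      qed
    qed
  qed
  show thesis
  proof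
    show "strict_mono r" unfolding r_def using r0 k by (intro strict_mono_o)
    show "(\<lambda>n. \<mu> (r n)) \<longlonglongrightarrow> \<nu>"
      using LIMSEQ_subseq_LIMSEQ[OF r0(2) k(1)] by (simp add: r_def o_def)
    fix C :: "real set" assume "compact C"
    then obtain B where B: "\<And>x. x \<in> C \<Longrightarrow> norm x \<le> B" using compact_imp_bounded bounded_iff by metis
    obtain i :: nat where "B \<le> real i" using real_arch_simple by blast
    then have "C \<subseteq> {- real i..real i}" using B by (force simp: abs_le_iff)
    then show "uniform_limit C (\<lambda>n. \<phi> (r n)) f sequentially" by (rule uniform_limit_on_subset[OF ul])
  qed
qed

theorem theorem4p3:
  fixes \<kappa> :: real and P :: "nat \<Rightarrow> real"
    and \<phi> :: "nat \<Rightarrow> real \<Rightarrow> real" and \<mu> :: "nat \<Rightarrow> real"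
  assumes "0 < \<kappa>" "\<kappa> \<le> 1"
    and "filterlim P at_top sequentially"
    and "\<And>n. admissible_pair (P n) \<kappa> (\<phi> n) (\<mu> n)"
  shows "\<exists>(r :: nat \<Rightarrow> nat) (\<phi>' :: real \<Rightarrow> real) (\<nu> :: real).
      strict_mono r \<and>
      (\<forall>C. compact C \<longrightarrow> uniform_limit C (\<lambda>n. \<phi> (r n)) \<phi>' sequentially) \<and>
      (\<lambda>n. \<mu> (r n)) \<longlonglongrightarrow> \<nu> \<and>
      continuous_on UNIV \<phi>' \<and> \<nu> \<in> {0..1} \<and>
      whitham_solution_pair \<phi>' \<nu> \<and>
      \<phi>' 0 = \<kappa> * \<nu> / 2 \<and>
      (\<forall>x. \<nu> - 1 \<le> \<phi>' x \<and> \<phi>' x \<le> \<kappa> * \<nu> / 2) \<and>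
      even_fun \<phi>' \<and>
      \<not> \<phi>' constant_on UNIV \<and>
      \<not> (\<exists>T>0. periodic_fun_simple \<phi>' T) \<and>
      strict_mono_on {..<0} \<phi>' \<and>
      (\<forall>x<0. \<phi>' differentiable (at x) \<and> deriv \<phi>' x > 0) \<and>
      (\<kappa> < 1 \<and> 0 < \<nu> \<longrightarrow> smooth_on UNIV \<phi>')"
proof -
  obtain r :: "nat \<Rightarrow> nat" and f \<nu> where r: "strict_mono r" and mu: "(\<lambda>n. \<mu> (r n)) \<longlonglongrightarrow> \<nu>"
    and ul: "\<And>C. compact C \<Longrightarrow> uniform_limit C (\<lambda>n. \<phi> (r n)) f sequentially"
  proof (rule admissible_compactness[of P \<kappa> \<phi> \<mu>, OF assms(4)])
    fix r :: "nat \<Rightarrow> nat" and f \<nu>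
    assume "strict_mono r" "(\<lambda>n. \<mu> (r n)) \<longlonglongrightarrow> \<nu>"
      "\<And>C. compact C \<Longrightarrow> uniform_limit C (\<lambda>n. \<phi> (r n)) f sequentially"
    then show thesis by (rule that)
  qed
  interpret admissible_limit \<kappa> "\<lambda>n. P (r n)" "\<lambda>n. \<phi> (r n)" "\<lambda>n. \<mu> (r n)" f \<nu>
  proof
    show "filterlim (\<lambda>n. P (r n)) at_top sequentially"
      using filterlim_compose[OF assms(3) filterlim_subseq[OF r]] .
    show "(\<lambda>n. \<phi> (r n) x) \<longlonglongrightarrow> f x" for x
      using tendsto_uniform_limitI[OF ul[of "{x}"]] by simp
  qed (use assms mu in auto)
  show ?thesis
  proof (intro exI[of _ r] exI[of _ f] exI[of _ \<nu>] conjI)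
    show "\<not> f constant_on UNIV" using f_nonconstant unfolding constant_on_def by (metis UNIV_I)
    show "strict_mono_on {..<0} f" using f_strict_mono by (auto simp: strict_mono_on_def)
    show "\<forall>C. compact C \<longrightarrow> uniform_limit C (\<lambda>n. \<phi> (r n)) f sequentially" using ul by blast
    show "\<kappa> < 1 \<and> 0 < \<nu> \<longrightarrow> smooth_on UNIV f" using f_smooth by blast
    show "\<forall>x<0. f differentiable (at x) \<and> deriv f x > 0" using f_differentiable f_deriv_pos by blast
    show "even_fun f" using f_even by (simp add: even_fun_def)
  qed (use r mu f_continuous f_solution f_0 f_bounds nu_bounds f_nonperiodic in auto)
qed

end
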